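(* Let $C\equiv f(x,y)=0$ be a branch with semigroup of values $\langle 3,s_1\rangle$ and Zariski invariant equal to $\lambda$. Then the discriminant curve $D(u,v)=0$ of the morphism $(x,f)$ is degenerate and its topological type is determined by $(3,s_1,\lambda)$ in the following way: (1) If $\lambda=0$, then the discriminant is the double smooth branch $(v+u^{s_1})^2=0$. (2) If $\lambda\neq 0$, then: (a) when $\gcd(2,s_1+\lambda)=2$, the discriminant curve is the union of two smooth branches $D_i(u,v)=0$, $1\le i\le 2$, with intersection number $i_0(D_1,D_2)=\frac{s_1+\lambda}{2}$; (b) when $\gcd(2,s_1+\lambda)=1$, the discriminant is a branch of semigroup $\langle 2,s_1+\lambda\rangle$.
   Context: A branch $C\equiv f(x,y)=0$ is the germ at $0\in\mathbb C^2$ of the curve $f(x,y)=0$ with $f\in\mathbb C\{x,y\}$ irreducible. Its multiplicity is $n=\mathrm{ord}\, f$, and it is smooth if $n=1$. The intersection number is $i_0(f,h)=\dim_{\mathbb C}\mathbb C\{x,y\}/(f,h)$. The semigroup of values of $C$ is $S(C)=S(f)=\{i_0(f,h): h\in\mathbb C\{x,y\},\ h\not\equiv 0 \bmod f\}$, and $\langle s_0,\dots,s_g\rangle$ denotes the semigroup with minimal system of generators $s_0=n<s_1<\dots<s_g$. Topological type means type as an embedded germ in $\mathbb C^2$ up to topological equivalence; two branches have the same topological type if and only if they have the same semigroup of values. Zariski invariant: let $(x(t),y(t))$ be a Puiseux parametrization of $C$. For $\omega=g\,dx+h\,dy$ with $g,h\in\mathbb C\{x,y\}$ put $\nu(\omega)=\mathrm{ord}_t\big(g(x(t),y(t))x'(t)+h(x(t),y(t))y'(t)\big)+1$,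 and let $\Lambda$ be the set of all (finite) values $\nu(\omega)$. If $\Lambda\setminus S(C)\neq\emptyset$, the Zariski invariant is $\lambda=\min(\Lambda\setminus S(C))-n$; otherwise one writes $\lambda=0$. Discriminant: consider the morphism $(x,f):(\mathbb C^2,0)\to(\mathbb C^2,0)$, $(x,y)\mapsto(u,v)=(x,f(x,y))$. Its polar curve is $\frac{\partial f}{\partial y}=0$, and its discriminant curve $D(u,v)=0$ is the direct image of the polar curve. With Newton–Puiseux factorizations $f=u_1(x,y)\prod_{i=1}^{n}(y-\alpha_i(x))$ and $\frac{\partial f}{\partial y}=u_2(x,y)\prod_{j=1}^{n-1}(y-\gamma_j(x))$, where $u_1,u_2$ are units and $n=\mathrm{ord}\, f$, it is given by $D(u,v)=\prod_{j=1}^{n-1}\big(v-f(u,\gamma_j(u))\big)$. Degeneracy (in the sense of Kouchnirenko, with respect to the coordinates $(u,v)$): the Newton polygon $\mathcal N(h)$ of $h=\sum a_{ij}u^iv^j$ is the convex hull of $\mathrm{supp}(h)+\mathbb R_{\ge 0}^2$, where $\mathrm{supp}(h)=\{(i,j):a_{ij}\ne 0\}$. The series $h$ (and the curve $h=0$) is non degenerate if for every compact edge $L$ of $\mathcal N(h)$, with $h_L=\sum_{(i,j)\in L\cap\mathrm{supp}(h)}a_{ij}u^iv^j$ and $j_0=\min\{j:(i,j)\in L\}$, the polynomial $h_L(1,z)/z^{j_0}$ has no multiple roots; otherwise it is degenerate.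
   Formalization: Part (1) fails for general f (f=2(y^3-x^4) gives (v+2u^4)^2; f=(1+y)(y^3-x^4) gives two distinct branches). It is replaced by: if λ=0, C is analytically equivalent to y^3-x^{s_1}=0, and the discriminant of (x, y^3-x^{s_1}) is (v+u^{s_1})^2=0. *)

theory Defs
  imports "HOL-Analysis.Analysis" "HOL-Computational_Algebra.Computational_Algebra"
begin

section \<open>The ring of convergent power series in two variables\<close>

text \<open>
  A power series in \<open>x, y\<close> is an element of \<open>complex fps fps\<close>; the outer variable is \<open>y\<close>.
  For discriminants the variables \<open>(u, v)\<close> take the roles of \<open>(x, y)\<close>.
\<close>

definition bicoeff :: "complex fps fps \<Rightarrow> nat \<Rightarrow> nat \<Rightarrow> complex" where
  "bicoeff F i j = fps_nth (fps_nth F j) i"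

text \<open>By Abel's lemma, this says that the series converges absolutely near the origin.\<close>

definition biconvergent :: "complex fps fps \<Rightarrow> bool" where
  "biconvergent F \<longleftrightarrow> (\<exists>r>0. \<exists>M. \<forall>i j. norm (bicoeff F i j) * r ^ (i + j) \<le> M)"

lemma bicoeff_simps:
  "bicoeff 0 i j = 0"
  "bicoeff (F + G) i j = bicoeff F i j + bicoeff G i j"
  "bicoeff (F - G) i j = bicoeff F i j - bicoeff G i j"
  "bicoeff (- F) i j = - bicoeff F i j"
  "bicoeff (fps_const a) i j = (if j = 0 then fps_nth a i else 0)"
  "bicoeff 1 i j = (if i = 0 \<and> j = 0 then 1 else 0)"
  "bicoeff fps_X i j = (if i = 0 \<and> j = 1 then 1 else 0)"
  by (auto simp: bicoeff_def fps_X_def)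

lemma bicoeff_mult:
  "bicoeff (F * G) i j = (\<Sum>l\<le>j. \<Sum>k\<le>i. bicoeff F k l * bicoeff G (i - k) (j - l))"
  by (simp add: bicoeff_def fps_mult_nth fps_sum_nth atLeast0AtMost)

lemma bicoeff_deriv: "bicoeff (fps_deriv F) i j = of_nat (Suc j) * bicoeff F i (Suc j)"
proof -
  have "(of_nat (Suc j) :: complex fps) = fps_const (of_nat (Suc j))"
    by (simp only: fps_of_nat)
  then show ?thesis
    by (simp only: bicoeff_def fps_deriv_nth Suc_eq_plus1 [symmetric] fps_mult_left_const_nth)
qed

lemma biconvergentE:
  assumes "biconvergent F"
  obtains r M where "r > 0" "M \<ge> 0"
    "\<And>s i j. 0 \<le> s \<Longrightarrow> s \<le> r \<Longrightarrow> norm (bicoeff F i j) * s ^ (i + j) \<le> M"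
proof -
  obtain r M where r: "r > 0" and M: "\<And>i j. norm (bicoeff F i j) * r ^ (i + j) \<le> M"
    using assms unfolding biconvergent_def by blast
  have "0 \<le> norm (bicoeff F 0 0) * r ^ (0 + 0)" by simp
  with M have "M \<ge> 0" by (meson order_trans)
  moreover have "norm (bicoeff F i j) * s ^ (i + j) \<le> M" if "0 \<le> s" "s \<le> r" for s i j
    using M[of i j] mult_left_mono[OF power_mono[OF that(2,1)], of "norm (bicoeff F i j)" "i + j"]
    by simp
  ultimately show thesis using r that by blast
qed

lemma biconvergent_finite:
  assumes "\<And>i j. i + j > 1 \<Longrightarrow> bicoeff F i j = 0"
  shows "biconvergent F"
proof -
  have "norm (bicoeff F i j) * 1 ^ (i + j)
      \<le> norm (bicoeff F 0 0) + norm (bicoeff F 1 0) + norm (bicoeff F 0 1)" for i j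
  proof -
    consider "i = 0 \<and> j = 0" | "i = 1 \<and> j = 0" | "i = 0 \<and> j = 1" | "i + j > 1" by linarith
    then show ?thesis by cases (auto simp: assms)
  qed
  then show ?thesis unfolding biconvergent_def by (intro exI[of _ 1]) auto
qed

lemma biconvergent_add:
  assumes "biconvergent F" "biconvergent G"
  shows "biconvergent (F + G)"
proof -
  obtain r M where F: "r > 0" "M \<ge> 0"
    "\<And>s i j. 0 \<le> s \<Longrightarrow> s \<le> r \<Longrightarrow> norm (bicoeff F i j) * s ^ (i + j) \<le> M"
    using biconvergentE[OF assms(1)] by metis
  obtain q N where G: "q > 0" "N \<ge> 0"
    "\<And>s i j. 0 \<le> s \<Longrightarrow> s \<le> q \<Longrightarrow> norm (bicoeff G i j) * s ^ (i + j) \<le> N"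
    using biconvergentE[OF assms(2)] by metis
  define s where "s = min r q"
  have s: "s > 0" "s \<le> r" "s \<le> q" using F G by (auto simp: s_def)
  have "norm (bicoeff (F + G) i j) * s ^ (i + j) \<le> M + N" for i j
  proof -
    have "norm (bicoeff (F + G) i j) * s ^ (i + j)
        \<le> (norm (bicoeff F i j) + norm (bicoeff G i j)) * s ^ (i + j)"
      using s by (intro mult_right_mono) (auto simp: bicoeff_simps norm_triangle_ineq)
    also have "\<dots> \<le> M + N" using F(3)[of s i j] G(3)[of s i j] s by (simp add: algebra_simps)
    finally show ?thesis .
  qed
  then show ?thesis using s unfolding biconvergent_def by blast
qed

lemma biconvergent_uminus: "biconvergent F \<Longrightarrow> biconvergent (- F)"
  by (simp add: biconvergent_def bicoeff_simps)

lemma Suc_le_two_power: "real (Suc n) \<le> 2 ^ n"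
proof -
  have "Suc n \<le> 2 ^ n" by (induction n) auto
  then have "real (Suc n) \<le> real (2 ^ n)" by (rule of_nat_mono)
  then show ?thesis by simp
qed

lemma biconvergent_mult:
  assumes "biconvergent F" "biconvergent G"
  shows "biconvergent (F * G)"
proof -
  obtain r M where F: "r > 0" "M \<ge> 0"
    "\<And>s i j. 0 \<le> s \<Longrightarrow> s \<le> r \<Longrightarrow> norm (bicoeff F i j) * s ^ (i + j) \<le> M"
    using biconvergentE[OF assms(1)] by metis
  obtain q N where G: "q > 0" "N \<ge> 0"
    "\<And>s i j. 0 \<le> s \<Longrightarrow> s \<le> q \<Longrightarrow> norm (bicoeff G i j) * s ^ (i + j) \<le> N"
    using biconvergentE[OF assms(2)] by metis
  define s where "s = min r q"
  have s: "s > 0" "s \<le> r" "s \<le> q" using F G by (auto simp: s_def)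
  have "norm (bicoeff (F * G) i j) * (s / 2) ^ (i + j) \<le> M * N" for i j
  proof -
    have "norm (bicoeff (F * G) i j) * s ^ (i + j)
        \<le> (\<Sum>l\<le>j. \<Sum>k\<le>i. norm (bicoeff F k l * bicoeff G (i - k) (j - l))) * s ^ (i + j)"
      unfolding bicoeff_mult using s
      by (intro mult_right_mono) (auto intro!: sum_norm_le)
    also have "\<dots> = (\<Sum>l\<le>j. \<Sum>k\<le>i. (norm (bicoeff F k l) * s ^ (k + l)) *
        (norm (bicoeff G (i - k) (j - l)) * s ^ ((i - k) + (j - l))))"
      unfolding sum_distrib_right
    proof (intro sum.cong refl)
      fix l k assume "l \<in> {..j}" "k \<in> {..i}"
      then have "i + j = (k + l) + ((i - k) + (j - l))" by auto
      then have "s ^ (i + j) = s ^ (k + l) * s ^ ((i - k) + (j - l))" by (metis power_add)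
      then show "norm (bicoeff F k l * bicoeff G (i - k) (j - l)) * s ^ (i + j) =
          (norm (bicoeff F k l) * s ^ (k + l)) *
          (norm (bicoeff G (i - k) (j - l)) * s ^ ((i - k) + (j - l)))"
        by (simp add: norm_mult)
    qed
    also have "\<dots> \<le> (\<Sum>l\<le>j. \<Sum>k\<le>i. M * N)"
      using s by (intro sum_mono mult_mono F(3) G(3)) (auto simp: F(2) G(2))
    also have "\<dots> = real (Suc j) * real (Suc i) * (M * N)" by simp
    also have "\<dots> \<le> (2 ^ j * 2 ^ i) * (M * N)"
      using F G Suc_le_two_power by (intro mult_right_mono mult_mono) auto
    finally have "norm (bicoeff (F * G) i j) * s ^ (i + j) / 2 ^ (i + j) \<le> M * N"
      by (simp add: field_simps power_add)
    then show ?thesis by (simp add: power_divide)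
  qed
  moreover have "s / 2 > 0" using s by simp
  ultimately show ?thesis unfolding biconvergent_def by blast
qed

lemma biconvergent_deriv:
  assumes "biconvergent F"
  shows "biconvergent (fps_deriv F)"
proof -
  obtain r M where F: "r > 0" "M \<ge> 0"
    "\<And>s i j. 0 \<le> s \<Longrightarrow> s \<le> r \<Longrightarrow> norm (bicoeff F i j) * s ^ (i + j) \<le> M"
    using biconvergentE[OF assms] by metis
  have "norm (bicoeff (fps_deriv F) i j) * (r / 2) ^ (i + j) \<le> M / r" for i j
  proof -
    have "norm (bicoeff (fps_deriv F) i j) * (r / 2) ^ (i + j)
        = real (Suc j) / 2 ^ (i + j) * (norm (bicoeff F i (Suc j)) * r ^ (i + j))"
      by (simp add: bicoeff_deriv norm_mult power_divide del: of_nat_Suc)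
    also have "\<dots> \<le> 1 * (norm (bicoeff F i (Suc j)) * r ^ (i + j))"
    proof (intro mult_right_mono)
      have "real (Suc j) \<le> 2 ^ j" by (rule Suc_le_two_power)
      also have "\<dots> \<le> 2 ^ (i + j)" by (intro power_increasing) auto
      finally show "real (Suc j) / 2 ^ (i + j) \<le> 1" by simp
    qed (use F in auto)
    also have "\<dots> \<le> M / r" using F(3)[of r i "Suc j"] F(1) by (simp add: field_simps)
    finally show ?thesis .
  qed
  moreover have "r / 2 > 0" using F by simp
  ultimately show ?thesis unfolding biconvergent_def by blast
qed

typedef cps = "{F. biconvergent F}"
  morphisms fps_of_cps Abs_cps
  by (rule exI[of _ 0]) (auto intro: biconvergent_finite simp: bicoeff_simps)

setup_lifting type_definition_cps

instantiation cps :: idom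
begin

lift_definition zero_cps :: cps is 0
  by (auto intro: biconvergent_finite simp: bicoeff_simps)
lift_definition one_cps :: cps is 1
  by (rule biconvergent_finite) (auto simp: bicoeff_simps)
lift_definition plus_cps :: "cps \<Rightarrow> cps \<Rightarrow> cps" is "(+)" by (rule biconvergent_add)
lift_definition uminus_cps :: "cps \<Rightarrow> cps" is uminus by (rule biconvergent_uminus)
lift_definition minus_cps :: "cps \<Rightarrow> cps \<Rightarrow> cps" is "(-)"
  by (metis biconvergent_add biconvergent_uminus diff_conv_add_uminus)
lift_definition times_cps :: "cps \<Rightarrow> cps \<Rightarrow> cps" is "(*)" by (rule biconvergent_mult)

instance
  by standard (transfer; simp add: algebra_simps)+

end

lift_definition cps_const :: "complex \<Rightarrow> cps" is "\<lambda>c. fps_const (fps_const c)"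
  by (auto intro: biconvergent_finite simp: bicoeff_simps)

lift_definition cps_X :: cps is "fps_const fps_X"
  by (auto intro!: biconvergent_finite simp: bicoeff_simps fps_X_def)

lift_definition cps_Y :: cps is "fps_X"
  by (auto intro!: biconvergent_finite simp: bicoeff_simps)

lift_definition cps_dy :: "cps \<Rightarrow> cps" is fps_deriv by (rule biconvergent_deriv)

definition cps_coeff :: "cps \<Rightarrow> nat \<Rightarrow> nat \<Rightarrow> complex" where
  "cps_coeff f i j = bicoeff (fps_of_cps f) i j"

text \<open>
  Substitution of series without constant term: \<open>A\<^sup>i B\<^sup>j\<close> has order at least \<open>i + j\<close>, so that
  the truncated sums below contain all contributions to the coefficient in question.
\<close>

definition subst_arc :: "cps \<Rightarrow> complex fps \<Rightarrow> complex fps \<Rightarrow> complex fps" where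
  "subst_arc f a b =
     Abs_fps (\<lambda>k. \<Sum>i\<le>k. \<Sum>j\<le>k. cps_coeff f i j * fps_nth (a ^ i * b ^ j) k)"

definition subst_coords :: "cps \<Rightarrow> cps \<Rightarrow> cps \<Rightarrow> complex fps fps" where
  "subst_coords f A B =
     Abs_fps (\<lambda>l. Abs_fps (\<lambda>k.
       \<Sum>i\<le>k+l. \<Sum>j\<le>k+l. cps_coeff f i j * cps_coeff (A ^ i * B ^ j) k l))"

section \<open>Branches\<close>

definition mult0 :: "cps \<Rightarrow> nat" where
  "mult0 f = (LEAST n. \<exists>i j. i + j = n \<and> cps_coeff f i j \<noteq> 0)"

definition branch :: "cps \<Rightarrow> bool" where
  "branch f \<longleftrightarrow> irreducible f"

definition smooth_branch :: "cps \<Rightarrow> bool" where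
  "smooth_branch f \<longleftrightarrow> branch f \<and> mult0 f = 1"

text \<open>
  The residue classes of the elements of \<open>B\<close> form a (finite) basis of the complex vector space
  \<open>\<complex>{x,y} / I\<close>, without repetition.
\<close>

definition quotient_basis :: "cps set \<Rightarrow> cps set \<Rightarrow> bool" where
  "quotient_basis I B \<longleftrightarrow> finite B \<and>
     (\<forall>h. \<exists>!c. (\<forall>b. b \<notin> B \<longrightarrow> c b = 0) \<and> h - (\<Sum>b\<in>B. cps_const (c b) * b) \<in> I)"

text \<open>The infimum is \<open>\<infinity>\<close> if the quotient is infinite-dimensional.\<close>

definition quotient_dim :: "cps set \<Rightarrow> enat" where
  "quotient_dim I = Inf {enat (card B) | B. quotient_basis I B}"

definition intersection_number :: "cps \<Rightarrow> cps \<Rightarrow> enat" where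
  "intersection_number f h = quotient_dim {a * f + b * h | a b. True}"

definition value_semigroup :: "cps \<Rightarrow> nat set" where
  "value_semigroup f = {k. \<exists>h. \<not> f dvd h \<and> intersection_number f h = enat k}"

definition generated_semigroup :: "nat set \<Rightarrow> nat set" where
  "generated_semigroup G = {\<Sum>s\<in>G. c s * s | c. True}"

definition has_semigroup :: "cps \<Rightarrow> nat list \<Rightarrow> bool" where
  "has_semigroup f ss \<longleftrightarrow>
     ss \<noteq> [] \<and> hd ss = mult0 f \<and> sorted_wrt (<) ss \<and>
     value_semigroup f = generated_semigroup (set ss) \<and>
     (\<forall>G. G \<subset> set ss \<longrightarrow> value_semigroup f \<noteq> generated_semigroup G)"

text \<open>
  The line \<open>x = 0\<close> is not tangent to the curve. This is the condition on the coordinates under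
  which \<open>f\<close> is a unit times a product of exactly \<open>ord f\<close> factors \<open>y - \<alpha>\<^sub>i(x)\<close>.
\<close>

definition x_transversal :: "cps \<Rightarrow> bool" where
  "x_transversal f \<longleftrightarrow> cps_coeff f 0 (mult0 f) \<noteq> 0"

text \<open>
  Equality of curve germs up to an analytic change of coordinates \<open>(A, B)\<close> and a unit \<open>w\<close>.
  It is needed because the discriminant of \<open>(x, f)\<close> depends on the coordinates and on the
  equation: \<open>y\<^sup>3 - x\<^sup>4\<close> and \<open>2y\<^sup>3 - 2x\<^sup>4\<close> define the same curve, but have discriminants
  \<open>(v + u\<^sup>4)\<^sup>2\<close> and \<open>(v + 2u\<^sup>4)\<^sup>2\<close>. An explicit equation for it therefore refers to a normal
  form of the curve.
\<close>

definition analytically_equivalent :: "cps \<Rightarrow> cps \<Rightarrow> bool" where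
  "analytically_equivalent f f' \<longleftrightarrow>
     (\<exists>A B w. cps_coeff A 0 0 = 0 \<and> cps_coeff B 0 0 = 0 \<and>
        cps_coeff A 1 0 * cps_coeff B 0 1 - cps_coeff A 0 1 * cps_coeff B 1 0 \<noteq> 0 \<and>
        w dvd 1 \<and>
        fps_of_cps f' = fps_of_cps w * subst_coords f A B)"

section \<open>The Zariski invariant\<close>

text \<open>
  A Puiseux parametrization is \<open>(t\<^sup>n, y(t))\<close> with \<open>n = ord f\<close>. For a branch to which \<open>x = 0\<close> is
  transversal it is automatically primitive.
\<close>

definition puiseux_parametrization :: "cps \<Rightarrow> complex fps \<Rightarrow> complex fps \<Rightarrow> bool" where
  "puiseux_parametrization f x y \<longleftrightarrow>
     x = fps_X ^ mult0 f \<and> fps_conv_radius y > 0 \<and> fps_nth y 0 = 0 \<and> subst_arc f x y = 0"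

definition differential_values :: "cps \<Rightarrow> nat set" where
  "differential_values f =
     {subdegree w + 1 | w x y g h.
        puiseux_parametrization f x y \<and>
        w = subst_arc g x y * fps_deriv x + subst_arc h x y * fps_deriv y \<and> w \<noteq> 0}"

definition zariski_invariant :: "cps \<Rightarrow> nat" where
  "zariski_invariant f =
     (if differential_values f - value_semigroup f \<noteq> {}
      then Inf (differential_values f - value_semigroup f) - mult0 f else 0)"

section \<open>The discriminant\<close>

text \<open>\<open>F(t\<^sup>N, y)\<close> as a series in \<open>t, y\<close>.\<close>

definition ramify :: "nat \<Rightarrow> cps \<Rightarrow> complex fps fps" where
  "ramify N f = Abs_fps (\<lambda>j. fps_compose (fps_nth (fps_of_cps f) j) (fps_X ^ N))"

text \<open>
  The Puiseux series \<open>\<gamma>\<^sub>j(x)\<close> are convergent power series in \<open>t\<close>, where \<open>t\<^sup>N = x\<close> for a common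
  denominator \<open>N\<close>; all identities are stated after the substitution \<open>x = t\<^sup>N\<close> (resp. \<open>u = t\<^sup>N\<close>).
\<close>

definition is_discriminant :: "cps \<Rightarrow> cps \<Rightarrow> bool" where
  "is_discriminant f D \<longleftrightarrow>
     (\<exists>N w \<gamma>. N \<ge> 1 \<and> w dvd 1 \<and>
        (\<forall>j < mult0 f - 1. fps_conv_radius (\<gamma> j) > 0 \<and> fps_nth (\<gamma> j) 0 = 0) \<and>
        ramify N (cps_dy f) = ramify N w * (\<Prod>j < mult0 f - 1. fps_X - fps_const (\<gamma> j)) \<and>
        ramify N D = (\<Prod>j < mult0 f - 1. fps_X - fps_const (subst_arc f (fps_X ^ N) (\<gamma> j))))"

definition discriminant :: "cps \<Rightarrow> cps" where
  "discriminant f = (THE D. is_discriminant f D)"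

section \<open>Newton polygons and degeneracy\<close>

definition newton_polygon :: "cps \<Rightarrow> (real \<times> real) set" where
  "newton_polygon h =
     convex hull {(real i + a, real j + b) | i j a b. cps_coeff h i j \<noteq> 0 \<and> a \<ge> 0 \<and> b \<ge> 0}"

text \<open>The polynomial \<open>h\<^sub>L(1, z) / z\<^sup>j\<^sup>0\<close>.\<close>

definition edge_polynomial :: "cps \<Rightarrow> (real \<times> real) set \<Rightarrow> complex poly" where
  "edge_polynomial h L =
     (let j0 = (LEAST j. \<exists>i. (real i, real j) \<in> L)
      in \<Sum>(i, j) \<in> {(i, j). (real i, real j) \<in> L \<and> cps_coeff h i j \<noteq> 0}.
           monom (cps_coeff h i j) (j - j0))"

definition nondegenerate :: "cps \<Rightarrow> bool" where
  "nondegenerate h \<longleftrightarrow>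
     (\<forall>L. L edge_of newton_polygon h \<and> compact L \<longrightarrow> rsquarefree (edge_polynomial h L))"

section \<open>Topological type\<close>

definition cps_converges_on :: "cps \<Rightarrow> (complex \<times> complex) set \<Rightarrow> bool" where
  "cps_converges_on h U \<longleftrightarrow>
     (\<forall>(u, v) \<in> U. (\<lambda>(i, j). cps_coeff h i j * u ^ i * v ^ j) summable_on UNIV)"

definition cps_eval :: "cps \<Rightarrow> complex \<times> complex \<Rightarrow> complex" where
  "cps_eval h = (\<lambda>(u, v). \<Sum>\<^sub>\<infinity>(i, j)\<in>UNIV. cps_coeff h i j * u ^ i * v ^ j)"

definition same_topological_type :: "cps \<Rightarrow> cps \<Rightarrow> bool" where
  "same_topological_type h k \<longleftrightarrow>
     (\<exists>U V \<phi> \<psi>. open U \<and> open V \<and> 0 \<in> U \<and> 0 \<in> V \<and>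
        cps_converges_on h U \<and> cps_converges_on k V \<and>
        homeomorphism U V \<phi> \<psi> \<and> \<phi> 0 = 0 \<and>
        \<phi> ` {p \<in> U. cps_eval h p = 0} = {q \<in> V. cps_eval k q = 0})"

end

theory Submission
  imports Defs
begin

text \<open>
  By Weierstrass preparation and completing the cube, \<open>f\<close> is a unit times
  \<open>Y\<^sup>3 + x\<^sup>m p\<^sub>1 Y + x\<^sup>s q\<^sub>1\<close> with \<open>Y = y - \<sigma>(x)\<close>. Irreducibility forces \<open>2s < 3m\<close> and \<open>s = s\<^sub>1\<close>, and Cardano's
  formula yields the parametrization \<open>x = t\<^sup>3\<close>, \<open>Y = t\<^sup>s A(t\<^sup>3) + t\<^bsup>3m-s\<^esup> B(t\<^sup>3)\<close>. Comparing values of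
  differentials modulo 3 gives \<open>\<lambda> = 3m - s\<close> if \<open>p\<^sub>1 \<noteq> 0\<close> and \<open>m + 1 < s\<close>, and \<open>\<lambda> = 0\<close> otherwise.

  The two critical values of \<open>f\<close> in the vertical direction are \<open>\<phi> \<plusminus> \<surd>E\<close> with \<open>ord \<phi> = s\<close>, and with
  \<open>ord E = 3m = s + \<lambda>\<close> if \<open>\<lambda> \<noteq> 0\<close>. So the discriminant is \<open>(v - \<phi>)\<^sup>2 - E\<close>, where \<open>ord E > 2s\<close>: its
  Newton polygon has one edge, whose polynomial is a square, and it splits, or is a branch with
  semigroup \<open>\<langle>2, s + \<lambda>\<rangle>\<close>, according to the parity of \<open>ord E\<close>. If \<open>\<lambda> = 0\<close>, a coordinate change makes \<open>f\<close>
  quasihomogeneous.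
\<close>

unbundle no vec_syntax

section \<open>Formal substitution\<close>

text \<open>The unit \<open>W\<close> cannot be discarded, although it does not change the curve:
  the discriminant depends on the equation, and the critical points of \<open>f\<close> are not
  those of the cubic. Instead of solving for them, two divisions control them. Comparing expansions
  in powers of \<open>Y\<close> shows that the lower coefficients of the Weierstrass polynomial of
  the \<open>y\<close>-derivative are divisible by x^k with k = min(m, s). Reducing \<open>f\<close>
  modulo this quadratic then leaves r0 + r1 Y with r1 divisible by x^k, from which the exponents s
  and 3k in the discriminant can be read off.

  A second obstacle is that intersection numbers are vector space dimensions. They are converted
  into orders along a parametrization, which requires that the kernel of the pull-back be exactly
  the ideal of \<open>f\<close> and that every convergent series of large order be a pull-back. The
  kernel is found from remainders modulo \<open>f\<close>: polynomials in y - \<phi> whose terms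
  have pairwise distinct orders along the branch.

  Inverses, implicit functions and roots of convergent series come from Weierstrass division with n
  = 0 and n = 1.\<close>

type_synonym bifps = "complex fps fps"

abbreviation bi_const :: "complex \<Rightarrow> bifps" where
  "bi_const c \<equiv> fps_const (fps_const c)"

abbreviation bi_X :: bifps where
  "bi_X \<equiv> fps_const fps_X"

lemma fps_const_inject_iff: "fps_const a = fps_const b \<longleftrightarrow> a = b"
  by (auto simp: fps_eq_iff)

lemmas fps_const_injectD = fps_const_inject_iff [THEN iffD1]

section \<open>Coefficients and orders of two-variable series\<close>

lemma bicoeff_eqI: "(\<And>i j. bicoeff F i j = bicoeff G i j) \<Longrightarrow> F = G"
  by (simp add: bicoeff_def fps_eq_iff)

lemma bicoeff_sum: "bicoeff (sum F I) i j = (\<Sum>k\<in>I. bicoeff (F k) i j)"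
  by (simp add: bicoeff_def fps_sum_nth)

lemma bicoeff_const_mult: "bicoeff (bi_const c * F) i j = c * bicoeff F i j"
  by (simp add: bicoeff_def)

lemma bicoeff_X_mult: "bicoeff (bi_X * F) i j = (if i = 0 then 0 else bicoeff F (i - 1) j)"
  by (simp add: bicoeff_def fps_X_mult_nth)

lemma bicoeff_Y_mult: "bicoeff (fps_X * F) i j = (if j = 0 then 0 else bicoeff F i (j - 1))"
  by (simp add: bicoeff_def)

lemma bicoeff_00_mult: "bicoeff (F * G) 0 0 = bicoeff F 0 0 * bicoeff G 0 0"
  by (simp add: bicoeff_mult)

lemma bi_decompose:
  "F = bi_const (bicoeff F 0 0) + bi_X * fps_const (fps_shift 1 (F $ 0)) + fps_X * fps_shift 1 F"
proof -
  have 1: "a = fps_const (a $ 0) + fps_X * fps_shift 1 a" for a :: "'b::comm_ring_1 fps"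
    by (rule fps_ext) (auto simp: Suc_diff_1)
  have "F = fps_const (F $ 0) + fps_X * fps_shift 1 F" by (rule 1)
  also have "fps_const (F $ 0) = fps_const (fps_const (F $ 0 $ 0) + fps_X * fps_shift 1 (F $ 0))"
    using 1[of "F $ 0"] by simp
  finally show ?thesis
    by (simp add: bicoeff_def)
qed

text \<open>This is the m-th power of the maximal ideal (x, y), described by its
  coefficients.\<close>

definition adic :: "nat \<Rightarrow> bifps set" where
  "adic m = {F. \<forall>i j. i + j < m \<longrightarrow> bicoeff F i j = 0}"

lemma adic_0 [simp]: "F \<in> adic 0"
  by (simp add: adic_def)

lemma zero_adic [simp]: "0 \<in> adic m"
  by (simp add: adic_def bicoeff_simps)

lemma adic_add: "F \<in> adic m \<Longrightarrow> G \<in> adic m \<Longrightarrow> F + G \<in> adic m"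
  by (simp add: adic_def bicoeff_simps)

lemma adic_diff: "F \<in> adic m \<Longrightarrow> G \<in> adic m \<Longrightarrow> F - G \<in> adic m"
  by (simp add: adic_def bicoeff_simps)

lemma adic_mult:
  assumes "F \<in> adic a" "G \<in> adic b"
  shows "F * G \<in> adic (a + b)"
proof -
  have "bicoeff F k l * bicoeff G (i - k) (j - l) = 0"
    if "i + j < a + b" "k \<le> i" "l \<le> j" for i j k l
  proof (cases "k + l < a")
    case True
    then show ?thesis using assms by (simp add: adic_def)
  next
    case False
    then have "(i - k) + (j - l) < b" using that by linarith
    then show ?thesis using assms by (simp add: adic_def)
  qed
  then show ?thesis
    unfolding adic_def by (auto simp: bicoeff_mult intro!: sum.neutral)
qed

lemma adic_mult_left: "G \<in> adic b \<Longrightarrow> F * G \<in> adic b"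
  using adic_mult[of F 0 G b] by simp

lemma adic_power: "F \<in> adic (Suc 0) \<Longrightarrow> F ^ i \<in> adic i"
proof (induction i)
  case (Suc i)
  then show ?case using adic_mult[of F "Suc 0" "F ^ i" i] by simp
qed simp

lemma adic_1_iff: "F \<in> adic (Suc 0) \<longleftrightarrow> bicoeff F 0 0 = 0"
  by (auto simp: adic_def)

lemma adic_eqI: "(\<And>m. F - G \<in> adic m) \<Longrightarrow> F = G"
proof (rule bicoeff_eqI)
  fix i j assume "\<And>m. F - G \<in> adic m"
  then have "F - G \<in> adic (Suc (i + j))" by blast
  then show "bicoeff F i j = bicoeff G i j" by (simp add: adic_def bicoeff_simps)
qed

text \<open>Splitting off the constant term writes \<open>F\<close> as a constant plus multiples of
  the two variables. Since \<open>A\<close> and \<open>B\<close> lie in the maximal ideal, each such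
  splitting raises the order of \<open>P F - Q F\<close> by one, so this difference lies in every
  power of the ideal. This serves as the uniqueness principle for all laws of substitution.\<close>

lemma adic_induct_eq:
  assumes "A \<in> adic (Suc 0)" "B \<in> adic (Suc 0)"
    and add: "\<And>F G. P (F + G) = P F + P G" "\<And>F G. Q (F + G) = Q F + Q G"
    and X: "\<And>F. P (bi_X * F) = A * P F" "\<And>F. Q (bi_X * F) = A * Q F"
    and Y: "\<And>F. P (fps_X * F) = B * P F" "\<And>F. Q (fps_X * F) = B * Q F"
    and const: "\<And>c. P (bi_const c) = Q (bi_const c)"
  shows "P F = (Q F :: bifps)"
proof (rule adic_eqI)
  show "P F - Q F \<in> adic m" for m
  proof (induction m arbitrary: F)
    case (Suc m)
    define F1 where "F1 = fps_const (fps_shift 1 (F $ 0))"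
    define F2 where "F2 = fps_shift 1 F"
    have F: "F = bi_const (bicoeff F 0 0) + bi_X * F1 + fps_X * F2"
      unfolding F1_def F2_def by (rule bi_decompose)
    have "P F - Q F = A * (P F1 - Q F1) + B * (P F2 - Q F2)"
      by (subst (1 2) F, simp only: add X Y const) (simp add: algebra_simps)
    moreover have "A * (P F1 - Q F1) \<in> adic (Suc 0 + m)" "B * (P F2 - Q F2) \<in> adic (Suc 0 + m)"
      by (rule adic_mult[OF assms(1) Suc], rule adic_mult[OF assms(2) Suc])
    ultimately show ?case by (auto intro: adic_add)
  qed simp
qed

section \<open>Substitution into formal series, separated from questions of convergence\<close>

definition bisubst :: "bifps \<Rightarrow> bifps \<Rightarrow> bifps \<Rightarrow> bifps" where
  "bisubst F A B = Abs_fps (\<lambda>l. Abs_fps (\<lambda>k.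
     \<Sum>i\<le>k+l. \<Sum>j\<le>k+l. bicoeff F i j * bicoeff (A ^ i * B ^ j) k l))"

definition partial_subst :: "(nat \<times> nat) set \<Rightarrow> bifps \<Rightarrow> bifps \<Rightarrow> bifps \<Rightarrow> bifps" where
  "partial_subst I F A B = (\<Sum>(i, j)\<in>I. bi_const (bicoeff F i j) * (A ^ i * B ^ j))"

lemma bicoeff_partial_subst:
  "bicoeff (partial_subst I F A B) k l = (\<Sum>(i, j)\<in>I. bicoeff F i j * bicoeff (A ^ i * B ^ j) k l)"
  by (simp add: partial_subst_def bicoeff_sum case_prod_unfold bicoeff_const_mult)

context
  fixes A B :: bifps
  assumes A: "A \<in> adic (Suc 0)" and B: "B \<in> adic (Suc 0)"
begin

lemma bicoeff_power_mult_eq_0: "k + l < i + j \<Longrightarrow> bicoeff (A ^ i * B ^ j) k l = 0"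
  using adic_mult[OF adic_power[OF A] adic_power[OF B], of i j] by (simp add: adic_def)

text \<open>Terms with i + j > k + l vanish because A^i B^j has order at least i + j. The freedom in
  choosing \<open>I\<close> allows index shifts in later sums without re-truncating.\<close>

lemma bicoeff_bisubst:
  assumes "finite I" "{(i, j). i + j \<le> k + l} \<subseteq> I"
  shows "bicoeff (bisubst F A B) k l = bicoeff (partial_subst I F A B) k l"
proof -
  let ?t = "\<lambda>(i, j). bicoeff F i j * bicoeff (A ^ i * B ^ j) k l"
  let ?J = "{(i, j). i + j \<le> k + l}"
  have J: "?J \<subseteq> {..k+l} \<times> {..k+l}" by auto
  have t: "?t p = 0" if "p \<notin> ?J" for p
    using that by (cases p) (simp add: bicoeff_power_mult_eq_0 not_le)
  have "bicoeff (bisubst F A B) k l = sum ?t ({..k+l} \<times> {..k+l})"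
    by (simp add: bisubst_def bicoeff_def [of "Abs_fps _"] sum.cartesian_product)
  also have "\<dots> = sum ?t ?J"
    using J t by (intro sum.mono_neutral_right) blast+
  also have "\<dots> = sum ?t I"
    using assms t by (intro sum.mono_neutral_left) blast+
  finally show ?thesis by (simp add: bicoeff_partial_subst)
qed

lemma bisubst_partial_subst:
  assumes "finite I" "{(i, j). i + j < m} \<subseteq> I"
  shows "bisubst F A B - partial_subst I F A B \<in> adic m"
proof -
  have "bicoeff (bisubst F A B) k l = bicoeff (partial_subst I F A B) k l" if "k + l < m" for k l
    using assms that by (intro bicoeff_bisubst) auto
  then show ?thesis by (simp add: adic_def bicoeff_simps)
qed

lemma bisubst_add: "bisubst (F + G) A B = bisubst F A B + bisubst G A B"
  by (rule bicoeff_eqI)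
    (simp add: bisubst_def bicoeff_simps bicoeff_def [of "Abs_fps _"] sum.distrib algebra_simps)

lemma bisubst_const: "bisubst (bi_const c) A B = bi_const c"
proof (rule bicoeff_eqI)
  fix k l :: nat
  let ?I = "{..k+l} \<times> {..k+l}"
  have "bicoeff (bisubst (bi_const c) A B) k l = bicoeff (partial_subst ?I (bi_const c) A B) k l"
    by (rule bicoeff_bisubst) auto
  also have "partial_subst ?I (bi_const c) A B = partial_subst {(0,0)} (bi_const c) A B"
    unfolding partial_subst_def
    by (rule sum.mono_neutral_right) (auto simp: bicoeff_simps split: if_splits)
  also have "\<dots> = bi_const c" by (simp add: partial_subst_def bicoeff_simps)
  finally show "bicoeff (bisubst (bi_const c) A B) k l = bicoeff (bi_const c) k l" .
qed

lemma bisubst_X_mult: "bisubst (bi_X * F) A B = A * bisubst F A B"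
proof (rule adic_eqI)
  fix m
  \<comment> \<open>Multiplication by \<open>bi_X\<close> shifts the first index by one, so the
    rectangle for \<open>F\<close> is one shorter in that direction than the square for the
    product.\<close>
  let ?I = "{..m} \<times> {..Suc m}" and ?J = "{..Suc m} \<times> {..Suc m}"
  have "partial_subst ?J (bi_X * F) A B =
      (\<Sum>i\<le>Suc m. \<Sum>j\<le>Suc m. bi_const (bicoeff (bi_X * F) i j) * (A ^ i * B ^ j))"
    by (simp only: partial_subst_def sum.cartesian_product)
  also have "\<dots> = (\<Sum>i\<le>m. \<Sum>j\<le>Suc m. bi_const (bicoeff F i j) * (A ^ Suc i * B ^ j))"
    by (subst sum.atMost_Suc_shift) (simp add: bicoeff_X_mult del: sum.atMost_Suc)
  also have "\<dots> = A * partial_subst ?I F A B"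
    by (simp only: partial_subst_def sum.cartesian_product [symmetric] sum_distrib_left power_Suc mult_ac)
  finally have "partial_subst ?J (bi_X * F) A B = A * partial_subst ?I F A B" .
  moreover have "bisubst (bi_X * F) A B - partial_subst ?J (bi_X * F) A B \<in> adic m"
    by (rule bisubst_partial_subst) auto
  moreover have "A * (bisubst F A B - partial_subst ?I F A B) \<in> adic m"
    by (rule adic_mult_left, rule bisubst_partial_subst) auto
  ultimately show "bisubst (bi_X * F) A B - A * bisubst F A B \<in> adic m"
    using adic_diff by (fastforce simp: algebra_simps)
qed

lemma bisubst_Y_mult: "bisubst (fps_X * F) A B = B * bisubst F A B"
proof (rule adic_eqI)
  fix m
  let ?I = "{..Suc m} \<times> {..m}" and ?J = "{..Suc m} \<times> {..Suc m}"
  have "partial_subst ?J (fps_X * F) A B =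
      (\<Sum>i\<le>Suc m. \<Sum>j\<le>Suc m. bi_const (bicoeff (fps_X * F) i j) * (A ^ i * B ^ j))"
    by (simp only: partial_subst_def sum.cartesian_product)
  also have "\<dots> = (\<Sum>i\<le>Suc m. \<Sum>j\<le>m. bi_const (bicoeff F i j) * (A ^ i * B ^ Suc j))"
    by (subst sum.atMost_Suc_shift) (simp add: bicoeff_Y_mult del: sum.atMost_Suc)
  also have "\<dots> = B * partial_subst ?I F A B"
    by (simp only: partial_subst_def sum.cartesian_product [symmetric] sum_distrib_left power_Suc mult_ac)
  finally have "partial_subst ?J (fps_X * F) A B = B * partial_subst ?I F A B" .
  moreover have "bisubst (fps_X * F) A B - partial_subst ?J (fps_X * F) A B \<in> adic m"
    by (rule bisubst_partial_subst) auto
  moreover have "B * (bisubst F A B - partial_subst ?I F A B) \<in> adic m"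
    by (rule adic_mult_left, rule bisubst_partial_subst) auto
  ultimately show "bisubst (fps_X * F) A B - B * bisubst F A B \<in> adic m"
    using adic_diff by (fastforce simp: algebra_simps)
qed

lemma bisubst_1 [simp]: "bisubst 1 A B = 1"
  using bisubst_const[of 1] by simp

lemma bisubst_X: "bisubst bi_X A B = A"
  using bisubst_X_mult[of 1] by simp

lemma bisubst_Y: "bisubst fps_X A B = B"
  using bisubst_Y_mult[of 1] by simp

text \<open>For fixed \<open>G\<close>, both sides are additive in \<open>F\<close> and turn
  multiplication by a variable into multiplication by its image, so they agree by the uniqueness
  principle.\<close>

lemma bisubst_mult: "bisubst (F * G) A B = bisubst F A B * bisubst G A B"
proof -
  have c: "bisubst (bi_const c * G) A B = bi_const c * bisubst G A B" for c
    by (rule bicoeff_eqI)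
      (simp add: bisubst_def bicoeff_const_mult bicoeff_def [of "Abs_fps _"] sum_distrib_left mult.assoc)
  show ?thesis
    by (rule adic_induct_eq[OF A B, where P = "\<lambda>F. bisubst (F * G) A B"])
      (simp_all only: bisubst_add bisubst_X_mult bisubst_Y_mult bisubst_const c
        distrib_right mult.assoc)
qed

lemma bisubst_0 [simp]: "bisubst 0 A B = 0"
  using bisubst_const[of 0] by simp

lemma bisubst_uminus: "bisubst (- F) A B = - bisubst F A B"
  using bisubst_add[of F "- F"] by (simp add: eq_neg_iff_add_eq_0 add.commute)

lemma bisubst_diff: "bisubst (F - G) A B = bisubst F A B - bisubst G A B"
  using bisubst_add[of F "- G"] by (simp add: bisubst_uminus)

lemma bisubst_power: "bisubst (F ^ n) A B = bisubst F A B ^ n"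
  by (induction n) (simp_all add: bisubst_mult)

lemma bicoeff_00_bisubst: "bicoeff (bisubst F A B) 0 0 = bicoeff F 0 0"
proof -
  have "bicoeff (bisubst F A B) 0 0 = bicoeff (partial_subst {(0,0)} F A B) 0 0"
    by (rule bicoeff_bisubst) auto
  then show ?thesis by (simp add: bicoeff_partial_subst bicoeff_simps)
qed

lemma bisubst_adic_1: "F \<in> adic (Suc 0) \<Longrightarrow> bisubst F A B \<in> adic (Suc 0)"
  by (simp add: adic_1_iff bicoeff_00_bisubst)

end

lemma bisubst_bisubst:
  assumes "A \<in> adic (Suc 0)" "B \<in> adic (Suc 0)" "C \<in> adic (Suc 0)" "E \<in> adic (Suc 0)"
  shows "bisubst (bisubst F C E) A B = bisubst F (bisubst C A B) (bisubst E A B)"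
  by (rule adic_induct_eq[where P = "\<lambda>F. bisubst (bisubst F C E) A B",
        OF bisubst_adic_1[OF assms(1,2,3)] bisubst_adic_1[OF assms(1,2,4)]])
    (simp_all only: assms bisubst_adic_1 bisubst_add bisubst_X_mult bisubst_Y_mult bisubst_const
      bisubst_mult bisubst_X bisubst_Y)

section \<open>Arcs: substitution of one-variable series\<close>

lemma fps_const_adic_1_iff: "fps_const a \<in> adic (Suc 0) \<longleftrightarrow> a $ 0 = 0"
  by (simp add: adic_1_iff bicoeff_simps)

lemma Y_adic_1 [simp]: "fps_X \<in> adic (Suc 0)" and X_adic_1 [simp]: "bi_X \<in> adic (Suc 0)"
  using adic_1_iff by (auto simp: bicoeff_simps)

lemma bisubst_const_arc_aux:
  assumes "T $ 0 = 0"
  shows "bisubst (fps_const a) (fps_const T) B = fps_const (fps_compose a T)"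
proof (rule bicoeff_eqI)
  fix k l
  have "bicoeff (bisubst (fps_const a) (fps_const T) B) k l =
      (\<Sum>i\<le>k+l. a $ i * (if l = 0 then (T ^ i) $ k else 0))"
    by (simp add: bisubst_def bicoeff_def [of "Abs_fps _"] bicoeff_simps if_distrib [of "\<lambda>x. x * _"]
        sum.delta cong: if_cong)
  then show "bicoeff (bisubst (fps_const a) (fps_const T) B) k l =
      bicoeff (fps_const (fps_compose a T)) k l"
    by (simp add: bicoeff_simps fps_compose_nth atLeast0AtMost)
qed

definition arc :: "bifps \<Rightarrow> complex fps \<Rightarrow> complex fps \<Rightarrow> complex fps" where
  "arc F a b = Abs_fps (\<lambda>k. \<Sum>i\<le>k. \<Sum>j\<le>k. bicoeff F i j * (a ^ i * b ^ j) $ k)"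

lemma subst_arc_eq_arc: "subst_arc f a b = arc (fps_of_cps f) a b"
  by (simp add: subst_arc_def arc_def cps_coeff_def)

text \<open>A one-variable series is regarded as a two-variable series constant in \<open>y\<close>.
  This embedding is injective, so arcs inherit every law of \<open>bisubst\<close>.\<close>

lemma fps_const_arc: "fps_const (arc F a b) = bisubst F (fps_const a) (fps_const b)"
  by (rule bicoeff_eqI)
    (simp add: bisubst_def bicoeff_def [of "Abs_fps _"] arc_def bicoeff_simps)

context
  fixes a b :: "complex fps"
  assumes a: "a $ 0 = 0" and b: "b $ 0 = 0"
begin

private lemma const: "fps_const a \<in> adic (Suc 0)" "fps_const b \<in> adic (Suc 0)"
  using a b by (simp_all add: fps_const_adic_1_iff)

lemma arc_add: "arc (F + G) a b = arc F a b + arc G a b"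
  and arc_diff: "arc (F - G) a b = arc F a b - arc G a b"
  and arc_mult: "arc (F * G) a b = arc F a b * arc G a b"
  and arc_power: "arc (F ^ n) a b = arc F a b ^ n"
  by (rule fps_const_injectD, simp only: fps_const_arc bisubst_add [OF const]
      bisubst_diff [OF const] bisubst_mult [OF const] bisubst_power [OF const]
      fps_const_add [symmetric] fps_const_sub [symmetric] fps_const_mult [symmetric]
      fps_const_power [symmetric])+

lemma arc_Y: "arc fps_X a b = b"
  by (rule fps_const_injectD, simp only: fps_const_arc bisubst_Y [OF const])

lemma arc_const: "arc (fps_const c) a b = fps_compose c a"
  by (rule fps_const_injectD, simp only: fps_const_arc bisubst_const_arc_aux [OF a])

lemma arc_0: "arc 0 a b = 0" and arc_1: "arc 1 a b = 1"
  using arc_const[of 0] arc_const[of 1] by simp_all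

lemma arc_nth_0: "arc F a b $ 0 = bicoeff F 0 0"
  by (simp add: arc_def)

lemma arc_sum: "arc (sum F I) a b = (\<Sum>i\<in>I. arc (F i) a b)"
  by (induction I rule: infinite_finite_induct) (simp_all add: arc_0 arc_add)

lemma arc_bisubst:
  assumes "A \<in> adic (Suc 0)" "B \<in> adic (Suc 0)"
  shows "arc (bisubst F A B) a b = arc F (arc A a b) (arc B a b)"
  by (rule fps_const_injectD, simp only: fps_const_arc bisubst_bisubst [OF const assms])

lemma arc_compose:
  assumes "T $ 0 = 0"
  shows "fps_compose (arc F a b) T = arc F (fps_compose a T) (fps_compose b T)"
proof -
  have T: "fps_const T \<in> adic (Suc 0)" using assms by (simp add: fps_const_adic_1_iff)
  show ?thesis
    by (rule fps_const_injectD, simp only: fps_const_arc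
        bisubst_const_arc_aux [OF assms, of _ 0, symmetric]
        bisubst_bisubst [OF T zero_adic const])
qed

end

text \<open>The coefficientwise composition in the definition of \<open>ramify\<close> is a
  substitution that fixes \<open>y\<close>; it is thereby a ring homomorphism with known composition
  laws.\<close>

lemma Abs_fps_compose_eq_bisubst:
  assumes "T $ 0 = 0"
  shows "Abs_fps (\<lambda>j. fps_compose (F $ j) T) = bisubst F (fps_const T) fps_X"
proof -
  have T: "fps_const T \<in> adic (Suc 0)" using assms by (simp add: fps_const_adic_1_iff)
  have Y: "fps_X \<in> adic (Suc 0)" by simp
  show ?thesis
  proof (rule adic_induct_eq[OF T Y, where P = "\<lambda>F. Abs_fps (\<lambda>j. fps_compose (F $ j) T)"])
    show "Abs_fps (\<lambda>j. fps_compose ((bi_X * F) $ j) T) =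
        fps_const T * Abs_fps (\<lambda>j. fps_compose (F $ j) T)" for F
      using assms by (simp add: fps_eq_iff fps_compose_mult_distrib)
    show "Abs_fps (\<lambda>j. fps_compose ((fps_X * F) $ j) T) =
        fps_X * Abs_fps (\<lambda>j. fps_compose (F $ j) T)" for F
      by (rule fps_ext) (simp add: fps_compose_0)
    show "Abs_fps (\<lambda>j. fps_compose (bi_const c $ j) T) = bisubst (bi_const c) (fps_const T) fps_X" for c
      unfolding bisubst_const[OF T Y] by (rule fps_ext) simp
  qed (simp_all add: bisubst_add[OF T Y] bisubst_X_mult[OF T Y] bisubst_Y_mult[OF T Y]
      fps_eq_iff fps_compose_add_distrib)
qed

lemma ramify_eq_bisubst:
  "N \<ge> 1 \<Longrightarrow> ramify N f = bisubst (fps_of_cps f) (fps_const (fps_X ^ N)) fps_X"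
  unfolding ramify_def by (rule Abs_fps_compose_eq_bisubst) simp

lemma fps_of_cps_power: "fps_of_cps (A ^ n) = fps_of_cps A ^ n"
  by (induction n) (simp_all add: one_cps.rep_eq times_cps.rep_eq)

lemma subst_coords_eq_bisubst:
  "subst_coords f A B = bisubst (fps_of_cps f) (fps_of_cps A) (fps_of_cps B)"
  by (simp add: subst_coords_def bisubst_def cps_coeff_def times_cps.rep_eq fps_of_cps_power)

section \<open>Convergence and Weierstrass division\<close>

text \<open>A bound for the weighted l1-norm of the coefficients, expressed through partial sums so
  that no summability has to be carried along. The radii for x and y are independent, because
  division needs the x-radius to be small compared with the y-radius.\<close>

definition wnorm_le :: "real \<Rightarrow> real \<Rightarrow> bifps \<Rightarrow> real \<Rightarrow> bool" where
  "wnorm_le \<rho> \<sigma> F M \<longleftrightarrow> (\<forall>m. (\<Sum>i\<le>m. \<Sum>j\<le>m. norm (bicoeff F i j) * \<rho> ^ i * \<sigma> ^ j) \<le> M)"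

lemma wnorm_leD: "wnorm_le \<rho> \<sigma> F M \<Longrightarrow> (\<Sum>i\<le>m. \<Sum>j\<le>m. norm (bicoeff F i j) * \<rho> ^ i * \<sigma> ^ j) \<le> M"
  by (simp add: wnorm_le_def)

lemma wnorm_le_mono_bound: "wnorm_le \<rho> \<sigma> F M \<Longrightarrow> M \<le> N \<Longrightarrow> wnorm_le \<rho> \<sigma> F N"
  unfolding wnorm_le_def by (meson order_trans)

lemma sum_triangle_le:
  fixes a :: "nat \<Rightarrow> nat \<Rightarrow> real"
  assumes "\<And>k l. 0 \<le> a k l"
  shows "(\<Sum>i\<le>m. \<Sum>k\<le>i. a k (i - k)) \<le> (\<Sum>k\<le>m. \<Sum>l\<le>m. a k l)"
proof -
  have "(\<Sum>i\<le>m. \<Sum>k\<le>i. a k (i - k)) = (\<Sum>(k, l)\<in>{(k, l). k + l \<le> m}. a k l)"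
    by (simp add: sum.triangle_reindex_eq)
  also have "\<dots> \<le> (\<Sum>(k, l)\<in>{..m} \<times> {..m}. a k l)"
    using assms by (intro sum_mono2) auto
  finally show ?thesis by (simp add: sum.cartesian_product)
qed

lemma bicoeff_fps_shift: "bicoeff (fps_shift n F) i j = bicoeff F i (j + n)"
  by (simp add: bicoeff_def)

context
  fixes \<rho> \<sigma> :: real
  assumes rho: "\<rho> \<ge> 0" and sigma: "\<sigma> \<ge> 0"
begin

lemma wnorm_le_nonneg:
  assumes "wnorm_le \<rho> \<sigma> F M"
  shows "M \<ge> 0"
proof -
  have "0 \<le> norm (bicoeff F 0 0)" by simp
  also have "\<dots> \<le> M" using wnorm_leD[OF assms, of 0] by simp
  finally show ?thesis .
qed

lemma wnorm_le_term:
  assumes "wnorm_le \<rho> \<sigma> F M"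
  shows "norm (bicoeff F i j) * \<rho> ^ i * \<sigma> ^ j \<le> M"
proof -
  let ?m = "max i j" and ?t = "\<lambda>i j. norm (bicoeff F i j) * \<rho> ^ i * \<sigma> ^ j"
  have "?t i j \<le> (\<Sum>j\<le>?m. ?t i j)"
    using rho sigma by (intro member_le_sum) auto
  also have "\<dots> \<le> (\<Sum>i\<le>?m. \<Sum>j\<le>?m. ?t i j)"
    using rho sigma by (intro member_le_sum [of i _ "\<lambda>i. \<Sum>j\<le>?m. ?t i j"] sum_nonneg) auto
  also have "\<dots> \<le> M" by (rule wnorm_leD[OF assms])
  finally show ?thesis .
qed

lemma wnorm_le_const: "wnorm_le \<rho> \<sigma> (bi_const c) (norm c)"
  unfolding wnorm_le_def
proof
  fix m
  have "norm (bicoeff (bi_const c) i j) * \<rho> ^ i * \<sigma> ^ j = (if i = 0 then if j = 0 then norm c else 0 else 0)"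
    for i j by (simp add: bicoeff_simps)
  then show "(\<Sum>i\<le>m. \<Sum>j\<le>m. norm (bicoeff (bi_const c) i j) * \<rho> ^ i * \<sigma> ^ j) \<le> norm c"
    by (simp add: sum.If_cases)
qed

lemma wnorm_le_add:
  assumes "wnorm_le \<rho> \<sigma> F M" "wnorm_le \<rho> \<sigma> G N"
  shows "wnorm_le \<rho> \<sigma> (F + G) (M + N)"
  unfolding wnorm_le_def
proof
  fix m
  have "(\<Sum>i\<le>m. \<Sum>j\<le>m. norm (bicoeff (F + G) i j) * \<rho> ^ i * \<sigma> ^ j) \<le>
      (\<Sum>i\<le>m. \<Sum>j\<le>m. norm (bicoeff F i j) * \<rho> ^ i * \<sigma> ^ j + norm (bicoeff G i j) * \<rho> ^ i * \<sigma> ^ j)"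
    unfolding bicoeff_simps distrib_right [symmetric]
    using rho sigma by (intro sum_mono mult_right_mono norm_triangle_ineq) auto
  also have "\<dots> \<le> M + N"
    using wnorm_leD[OF assms(1), of m] wnorm_leD[OF assms(2), of m] by (simp add: sum.distrib)
  finally show "(\<Sum>i\<le>m. \<Sum>j\<le>m. norm (bicoeff (F + G) i j) * \<rho> ^ i * \<sigma> ^ j) \<le> M + N" .
qed

lemma wnorm_le_sum:
  "(\<And>k. k \<in> I \<Longrightarrow> wnorm_le \<rho> \<sigma> (F k) (M k)) \<Longrightarrow> wnorm_le \<rho> \<sigma> (sum F I) (sum M I)"
  using wnorm_le_const[of 0]
  by (induction I rule: infinite_finite_induct) (auto intro: wnorm_le_add)

text \<open>Submultiplicativity of the l1-norm: the Cauchy product is summed over triangles, which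
  are contained in squares.\<close>

lemma wnorm_le_mult:
  assumes "wnorm_le \<rho> \<sigma> F M" "wnorm_le \<rho> \<sigma> G N"
  shows "wnorm_le \<rho> \<sigma> (F * G) (M * N)"
  unfolding wnorm_le_def
proof
  fix m
  define f where "f i j = norm (bicoeff F i j) * \<rho> ^ i * \<sigma> ^ j" for i j
  define g where "g i j = norm (bicoeff G i j) * \<rho> ^ i * \<sigma> ^ j" for i j
  have nn: "f i j \<ge> 0" "g i j \<ge> 0" for i j
    using rho sigma by (simp_all add: f_def g_def)
  have "norm (bicoeff (F * G) i j) * \<rho> ^ i * \<sigma> ^ j \<le>
      (\<Sum>l\<le>j. \<Sum>k\<le>i. f k l * g (i - k) (j - l))" for i j
  proof -
    have "norm (bicoeff (F * G) i j) * (\<rho> ^ i * \<sigma> ^ j) \<le>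
        (\<Sum>l\<le>j. \<Sum>k\<le>i. norm (bicoeff F k l * bicoeff G (i - k) (j - l))) * (\<rho> ^ i * \<sigma> ^ j)"
      unfolding bicoeff_mult using rho sigma
      by (intro mult_right_mono) (auto intro!: sum_norm_le)
    also have "\<dots> = (\<Sum>l\<le>j. \<Sum>k\<le>i. f k l * g (i - k) (j - l))"
      unfolding sum_distrib_right
    proof (intro sum.cong refl)
      fix k l assume "l \<in> {..j}" "k \<in> {..i}"
      then have "\<rho> ^ i = \<rho> ^ k * \<rho> ^ (i - k)" "\<sigma> ^ j = \<sigma> ^ l * \<sigma> ^ (j - l)"
        by (simp_all flip: power_add)
      then show "norm (bicoeff F k l * bicoeff G (i - k) (j - l)) * (\<rho> ^ i * \<sigma> ^ j) =
          f k l * g (i - k) (j - l)"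
        by (simp add: f_def g_def norm_mult)
    qed
    finally show ?thesis by (simp add: mult.assoc)
  qed
  then have "(\<Sum>i\<le>m. \<Sum>j\<le>m. norm (bicoeff (F * G) i j) * \<rho> ^ i * \<sigma> ^ j) \<le>
      (\<Sum>i\<le>m. \<Sum>j\<le>m. \<Sum>l\<le>j. \<Sum>k\<le>i. f k l * g (i - k) (j - l))"
    by (intro sum_mono)
  also have "\<dots> = (\<Sum>i\<le>m. \<Sum>j\<le>m. \<Sum>k\<le>i. \<Sum>l\<le>j. f k l * g (i - k) (j - l))"
    by (rule sum.cong[OF refl], rule sum.cong[OF refl], rule sum.swap)
  also have "\<dots> = (\<Sum>i\<le>m. \<Sum>k\<le>i. \<Sum>j\<le>m. \<Sum>l\<le>j. f k l * g (i - k) (j - l))"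
    by (rule sum.cong[OF refl], rule sum.swap)
  also have "\<dots> \<le> (\<Sum>i\<le>m. \<Sum>k\<le>i. \<Sum>l\<le>m. \<Sum>l'\<le>m. f k l * g (i - k) l')"
    using nn by (intro sum_mono sum_triangle_le) auto
  also have "\<dots> \<le> (\<Sum>k\<le>m. \<Sum>k'\<le>m. \<Sum>l\<le>m. \<Sum>l'\<le>m. f k l * g k' l')"
    using nn sum_triangle_le[of "\<lambda>k k'. \<Sum>l\<le>m. \<Sum>l'\<le>m. f k l * g k' l'" m]
    by (simp add: sum_nonneg)
  also have "\<dots> = (\<Sum>k\<le>m. \<Sum>l\<le>m. f k l) * (\<Sum>k\<le>m. \<Sum>l\<le>m. g k l)"
    by (simp only: sum_product)
  also have "\<dots> \<le> M * N"
    using wnorm_leD[OF assms(1), of m] wnorm_leD[OF assms(2), of m] nn wnorm_le_nonneg[OF assms(1)]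
    by (intro mult_mono) (auto simp: f_def g_def intro!: sum_nonneg)
  finally show "(\<Sum>i\<le>m. \<Sum>j\<le>m. norm (bicoeff (F * G) i j) * \<rho> ^ i * \<sigma> ^ j) \<le> M * N" .
qed

lemma wnorm_le_power: "wnorm_le \<rho> \<sigma> F M \<Longrightarrow> wnorm_le \<rho> \<sigma> (F ^ n) (M ^ n)"
proof (induction n)
  case 0
  then show ?case using wnorm_le_const[of 1] by simp
qed (simp add: wnorm_le_mult)

text \<open>Weights are compared only on the support of \<open>F\<close>, so that vanishing
  low-order coefficients can be converted into smallness.\<close>

lemma wnorm_le_weight:
  assumes "wnorm_le \<rho>' \<sigma>' F M" "\<kappa> \<ge> 0"
    and "\<And>i j. bicoeff F i j \<noteq> 0 \<Longrightarrow> \<rho> ^ i * \<sigma> ^ j \<le> \<kappa> * (\<rho>' ^ i * \<sigma>' ^ j)"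
  shows "wnorm_le \<rho> \<sigma> F (\<kappa> * M)"
  unfolding wnorm_le_def
proof
  fix m
  have "(\<Sum>i\<le>m. \<Sum>j\<le>m. norm (bicoeff F i j) * \<rho> ^ i * \<sigma> ^ j) \<le>
      (\<Sum>i\<le>m. \<Sum>j\<le>m. \<kappa> * (norm (bicoeff F i j) * \<rho>' ^ i * \<sigma>' ^ j))"
  proof (intro sum_mono)
    fix i j
    show "norm (bicoeff F i j) * \<rho> ^ i * \<sigma> ^ j \<le> \<kappa> * (norm (bicoeff F i j) * \<rho>' ^ i * \<sigma>' ^ j)"
      using mult_left_mono[OF assms(3)[of i j], of "norm (bicoeff F i j)"]
      by (cases "bicoeff F i j = 0") (simp_all add: mult_ac)
  qed
  also have "\<dots> = \<kappa> * (\<Sum>i\<le>m. \<Sum>j\<le>m. norm (bicoeff F i j) * \<rho>' ^ i * \<sigma>' ^ j)"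
    by (simp add: sum_distrib_left)
  also have "\<dots> \<le> \<kappa> * M"
    using assms(2) wnorm_leD[OF assms(1)] by (rule mult_left_mono[rotated])
  finally show "(\<Sum>i\<le>m. \<Sum>j\<le>m. norm (bicoeff F i j) * \<rho> ^ i * \<sigma> ^ j) \<le> \<kappa> * M" .
qed

lemma wnorm_le_shift:
  assumes "wnorm_le \<rho> \<sigma> F M" "\<sigma> > 0"
  shows "wnorm_le \<rho> \<sigma> (fps_shift n F) (M / \<sigma> ^ n)"
  unfolding wnorm_le_def
proof
  fix m
  let ?t = "\<lambda>i j. norm (bicoeff F i j) * \<rho> ^ i * \<sigma> ^ j"
  have "(\<Sum>i\<le>m. \<Sum>j\<le>m. norm (bicoeff (fps_shift n F) i j) * \<rho> ^ i * \<sigma> ^ j) * \<sigma> ^ n =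
      (\<Sum>i\<le>m. \<Sum>j\<le>m. ?t i (j + n))"
    unfolding sum_distrib_right
    by (intro sum.cong refl) (simp add: bicoeff_fps_shift power_add)
  also have "\<dots> \<le> (\<Sum>i\<le>m. \<Sum>j\<le>m + n. ?t i j)"
  proof (rule sum_mono)
    fix i
    have "(\<Sum>j\<le>m. ?t i (j + n)) = (\<Sum>j\<in>(\<lambda>j. j + n) ` {..m}. ?t i j)"
      by (simp add: sum.reindex)
    also have "\<dots> \<le> (\<Sum>j\<le>m + n. ?t i j)"
      using rho sigma by (intro sum_mono2) auto
    finally show "(\<Sum>j\<le>m. ?t i (j + n)) \<le> (\<Sum>j\<le>m + n. ?t i j)" .
  qed
  also have "\<dots> \<le> (\<Sum>i\<le>m + n. \<Sum>j\<le>m + n. ?t i j)"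
    using rho sigma by (intro sum_mono2 sum_nonneg) auto
  also have "\<dots> \<le> M" by (rule wnorm_leD[OF assms(1)])
  finally show "(\<Sum>i\<le>m. \<Sum>j\<le>m. norm (bicoeff (fps_shift n F) i j) * \<rho> ^ i * \<sigma> ^ j) \<le> M / \<sigma> ^ n"
    using assms(2) by (simp add: field_simps)
qed

end

lemma wnorm_le_imp_biconvergent:
  assumes "wnorm_le \<rho> \<sigma> F M" "\<rho> > 0" "\<sigma> > 0"
  shows "biconvergent F"
  unfolding biconvergent_def
proof (intro exI conjI allI)
  fix i j
  have "norm (bicoeff F i j) * min \<rho> \<sigma> ^ (i + j) = norm (bicoeff F i j) * (min \<rho> \<sigma> ^ i * min \<rho> \<sigma> ^ j)"
    by (simp add: power_add)
  also have "\<dots> \<le> norm (bicoeff F i j) * (\<rho> ^ i * \<sigma> ^ j)"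
    using assms by (intro mult_left_mono mult_mono power_mono) auto
  also have "\<dots> \<le> M"
    using wnorm_le_term[OF _ _ assms(1), of i j] assms by (simp add: mult.assoc)
  finally show "norm (bicoeff F i j) * min \<rho> \<sigma> ^ (i + j) \<le> M" .
qed (use assms in auto)

lemma sum_half_powers_le: "(\<Sum>i\<le>m. (1 / 2) ^ i) \<le> (2 :: real)"
proof -
  have "(\<Sum>i\<le>m. (1 / 2) ^ i) = (2 :: real) - (1 / 2) ^ m"
    by (induction m) (auto simp: field_simps)
  then show ?thesis by simp
qed

lemma biconvergent_wnorm_leE:
  assumes "biconvergent F"
  obtains r M where "r > 0" "wnorm_le r r F M"
proof -
  obtain r M where r: "r > 0" and M: "M \<ge> 0"
    and F: "\<And>s i j. 0 \<le> s \<Longrightarrow> s \<le> r \<Longrightarrow> norm (bicoeff F i j) * s ^ (i + j) \<le> M"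
    using biconvergentE[OF assms] by metis
  \<comment> \<open>Halving the radius turns a uniform coefficient bound into a double geometric
    series, each factor of which is at most 2.\<close>
  have "wnorm_le (r / 2) (r / 2) F (M * (2 * 2))"
    unfolding wnorm_le_def
  proof
    fix m
    have "(\<Sum>i\<le>m. \<Sum>j\<le>m. norm (bicoeff F i j) * (r / 2) ^ i * (r / 2) ^ j) \<le>
        (\<Sum>i\<le>m. \<Sum>j\<le>m. M * ((1 / 2) ^ i * (1 / 2) ^ j))"
    proof (intro sum_mono)
      fix i j
      have "norm (bicoeff F i j) * (r / 2) ^ i * (r / 2) ^ j =
          (norm (bicoeff F i j) * r ^ (i + j)) * ((1 / 2) ^ i * (1 / 2) ^ j)"
        by (simp add: power_add power_divide)
      also have "\<dots> \<le> M * ((1 / 2) ^ i * (1 / 2) ^ j)"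
        using F[of r i j] r by (intro mult_right_mono) auto
      finally show "norm (bicoeff F i j) * (r / 2) ^ i * (r / 2) ^ j \<le> M * ((1 / 2) ^ i * (1 / 2) ^ j)" .
    qed
    also have "\<dots> = M * ((\<Sum>i\<le>m. (1 / 2) ^ i) * (\<Sum>j\<le>m. (1 / 2) ^ j))"
      unfolding sum_product by (simp only: sum_distrib_left)
    also have "\<dots> \<le> M * (2 * 2)"
      using M by (intro mult_left_mono mult_mono sum_half_powers_le sum_nonneg) auto
    finally show "(\<Sum>i\<le>m. \<Sum>j\<le>m. norm (bicoeff F i j) * (r / 2) ^ i * (r / 2) ^ j) \<le> M * (2 * 2)" .
  qed
  then show thesis using that r half_gt_zero by blast
qed

text \<open>Every monomial present has degree at least one, so shrinking the radius from
  \<open>r\<close> to \<rho> gains at least one factor \<rho> / r.\<close>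

lemma adic_1_wnorm_le_scale:
  assumes "wnorm_le r r A M" "A \<in> adic (Suc 0)" "0 < \<rho>" "\<rho> \<le> r"
  shows "wnorm_le \<rho> \<rho> A (\<rho> / r * M)"
proof (rule wnorm_le_weight[OF _ _ assms(1)])
  fix i j assume "bicoeff A i j \<noteq> 0"
  then have "i + j \<ge> 1" using assms(2) by (cases "i + j") (auto simp: adic_1_iff)
  then obtain l where l: "i + j = Suc l" by (cases "i + j") auto
  have "\<rho> ^ i * \<rho> ^ j = \<rho> * \<rho> ^ l" by (metis l power_Suc power_add)
  also have "\<dots> \<le> \<rho> * r ^ l" using assms by (intro mult_left_mono power_mono) auto
  also have "\<dots> = \<rho> / r * (r ^ i * r ^ j)"
    using assms l by (simp add: power_add [symmetric] field_simps)
  finally show "\<rho> ^ i * \<rho> ^ j \<le> \<rho> / r * (r ^ i * r ^ j)" .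
qed (use assms in auto)

lemma adic_1_wnorm_le_small:
  assumes "biconvergent A" "A \<in> adic (Suc 0)" "e > 0"
  obtains q where "q > 0" "\<And>\<rho>. 0 < \<rho> \<Longrightarrow> \<rho> \<le> q \<Longrightarrow> wnorm_le \<rho> \<rho> A e"
proof -
  obtain r M where r: "r > 0" and M: "wnorm_le r r A M"
    using biconvergent_wnorm_leE[OF assms(1)] .
  have "M \<ge> 0" using wnorm_le_nonneg[OF _ _ M] r by auto
  define q where "q = min r (e * r / (M + 1))"
  have "q > 0" using r assms(3) \<open>M \<ge> 0\<close> by (simp add: q_def)
  moreover have "wnorm_le \<rho> \<rho> A e" if "0 < \<rho>" "\<rho> \<le> q" for \<rho>
  proof (rule wnorm_le_mono_bound)
    show "wnorm_le \<rho> \<rho> A (\<rho> / r * M)"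
      using adic_1_wnorm_le_scale[OF M assms(2)] that by (simp add: q_def)
    have "\<rho> * (M + 1) \<le> e * r" using that \<open>M \<ge> 0\<close> by (simp add: q_def pos_le_divide_eq)
    then have "\<rho> * M \<le> e * r" using that by (simp add: algebra_simps)
    then show "\<rho> / r * M \<le> e" using r by (simp add: field_simps)
  qed
  ultimately show thesis using that by blast
qed

text \<open>Since \<open>A\<close> and \<open>B\<close> vanish at the origin, their norms fall below
  the radius \<open>r\<close> of \<open>F\<close> once \<rho> is small. By submultiplicativity the
  norm of the result is then at most that of \<open>F\<close> at \<open>r\<close>.\<close>

lemma biconvergent_bisubst:
  assumes F: "biconvergent F" and A: "biconvergent A" "A \<in> adic (Suc 0)"
    and B: "biconvergent B" "B \<in> adic (Suc 0)"
  shows "biconvergent (bisubst F A B)"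
proof -
  obtain r M where r: "r > 0" and M: "wnorm_le r r F M"
    using biconvergent_wnorm_leE[OF F] .
  obtain q1 where q1: "q1 > 0" "\<And>\<rho>. 0 < \<rho> \<Longrightarrow> \<rho> \<le> q1 \<Longrightarrow> wnorm_le \<rho> \<rho> A r"
    using adic_1_wnorm_le_small[OF A r] by metis
  obtain q2 where q2: "q2 > 0" "\<And>\<rho>. 0 < \<rho> \<Longrightarrow> \<rho> \<le> q2 \<Longrightarrow> wnorm_le \<rho> \<rho> B r"
    using adic_1_wnorm_le_small[OF B r] by metis
  define \<rho> where "\<rho> = min q1 q2"
  have \<rho>: "\<rho> > 0" and Ar: "wnorm_le \<rho> \<rho> A r" and Br: "wnorm_le \<rho> \<rho> B r"
    using q1 q2 by (auto simp: \<rho>_def)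
  have "wnorm_le \<rho> \<rho> (bisubst F A B) M"
    unfolding wnorm_le_def
  proof
    fix m :: nat
    \<comment> \<open>Coefficients with both indices at most \<open>m\<close> have total degree at
      most 2m, so this square contains all contributions to them.\<close>
    let ?I = "{..2*m} \<times> {..2*m}"
    let ?P = "partial_subst ?I F A B"
    have "bicoeff (bisubst F A B) k l = bicoeff ?P k l" if "k \<le> m" "l \<le> m" for k l
      using that by (intro bicoeff_bisubst[OF A(2) B(2)]) auto
    then have "(\<Sum>i\<le>m. \<Sum>j\<le>m. norm (bicoeff (bisubst F A B) i j) * \<rho> ^ i * \<rho> ^ j) =
        (\<Sum>i\<le>m. \<Sum>j\<le>m. norm (bicoeff ?P i j) * \<rho> ^ i * \<rho> ^ j)"
      by (intro sum.cong refl) auto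
    moreover have "wnorm_le \<rho> \<rho> ?P (\<Sum>(i,j)\<in>?I. norm (bicoeff F i j) * (r ^ i * r ^ j))"
      unfolding partial_subst_def
      using \<rho> by (auto intro!: wnorm_le_sum wnorm_le_mult wnorm_le_const wnorm_le_power Ar Br)
    ultimately have "(\<Sum>i\<le>m. \<Sum>j\<le>m. norm (bicoeff (bisubst F A B) i j) * \<rho> ^ i * \<rho> ^ j)
        \<le> (\<Sum>(i,j)\<in>?I. norm (bicoeff F i j) * (r ^ i * r ^ j))"
      by (simp add: wnorm_le_def)
    also have "\<dots> \<le> M"
      using wnorm_leD[OF M, of "2 * m"] by (simp add: sum.cartesian_product mult.assoc)
    finally show "(\<Sum>i\<le>m. \<Sum>j\<le>m. norm (bicoeff (bisubst F A B) i j) * \<rho> ^ i * \<rho> ^ j) \<le> M" .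
  qed
  then show ?thesis using \<rho> by (intro wnorm_le_imp_biconvergent)
qed

text \<open>The radius \<sigma> is fixed first and handles pure powers of y, whose degree exceeds
  \<open>n\<close> and hence beats \<sigma>^n. Then \<rho> is chosen small relative to \<sigma>^n,
  which suppresses every monomial containing x.\<close>

lemma weighted_wnorm_le_small:
  assumes "biconvergent H" and H: "\<And>j. j \<le> n \<Longrightarrow> bicoeff H 0 j = 0" and "e > 0"
  obtains \<rho> \<sigma> where "0 < \<rho>" "\<rho> \<le> e" "0 < \<sigma>" "\<sigma> \<le> e" "wnorm_le \<rho> \<sigma> H (\<sigma> ^ n / 2)"
proof -
  obtain r M where r: "r > 0" and M: "wnorm_le r r H M"
    using biconvergent_wnorm_leE[OF assms(1)] .
  have M0: "M \<ge> 0" using wnorm_le_nonneg[OF _ _ M] r by auto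
  define \<sigma> where "\<sigma> = min (min r e) (r ^ Suc n / (2 * (M + 1)))"
  have \<sigma>: "\<sigma> > 0" "\<sigma> \<le> r" "\<sigma> \<le> e" using r M0 assms(3) by (simp_all add: \<sigma>_def)
  define \<kappa> where "\<kappa> = \<sigma> ^ n / (2 * (M + 1))"
  have \<kappa>: "\<kappa> > 0" using \<sigma> M0 by (simp add: \<kappa>_def)
  define \<rho> where "\<rho> = min (min r e) (\<kappa> * r)"
  have \<rho>: "\<rho> > 0" "\<rho> \<le> r" "\<rho> \<le> e" "\<rho> \<le> \<kappa> * r" using r \<kappa> assms(3) by (simp_all add: \<rho>_def)
  have "wnorm_le \<rho> \<sigma> H (\<kappa> * M)"
  proof (rule wnorm_le_weight[OF _ _ M])
    fix i j assume nz: "bicoeff H i j \<noteq> 0"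
    show "\<rho> ^ i * \<sigma> ^ j \<le> \<kappa> * (r ^ i * r ^ j)"
    proof (cases i)
      case 0
      then have "j \<ge> Suc n" using nz H[of j] by (cases "j \<le> n") auto
      then obtain l where l: "j = Suc n + l" using le_iff_add by blast
      have "\<sigma> ^ j = \<sigma> ^ n * \<sigma> * \<sigma> ^ l" by (simp add: l power_add)
      also have "\<dots> \<le> \<sigma> ^ n * (r ^ Suc n / (2 * (M + 1))) * r ^ l"
        using \<sigma> M0 by (intro mult_mono power_mono mult_left_mono) (auto simp: \<sigma>_def)
      also have "\<dots> = \<kappa> * r ^ j" by (simp add: \<kappa>_def l power_add)
      finally show ?thesis using 0 by simp
    next
      case (Suc k)
      have "\<rho> ^ i * \<sigma> ^ j = \<rho> * \<rho> ^ k * \<sigma> ^ j" by (simp add: Suc)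
      also have "\<dots> \<le> (\<kappa> * r) * r ^ k * r ^ j"
        using \<rho> \<sigma> \<kappa> r by (intro mult_mono power_mono) auto
      finally show ?thesis by (simp add: Suc mult_ac)
    qed
  qed (use \<rho> \<sigma> \<kappa> in auto)
  moreover have "\<kappa> * M \<le> \<sigma> ^ n / 2"
    using M0 \<sigma> by (simp add: \<kappa>_def field_simps)
  ultimately have "wnorm_le \<rho> \<sigma> H (\<sigma> ^ n / 2)" by (rule wnorm_le_mono_bound)
  then show thesis using that \<rho> \<sigma> by blast
qed

text \<open>
  Writing \<open>v = v\<^sub>l\<^sub>o + y\<^sup>n v\<^sub>h\<^sub>i\<close> with \<open>v\<^sub>l\<^sub>o\<close> of degree less than \<open>n\<close> in \<open>y\<close>, division by \<open>F\<close> amounts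
  to solving \<open>v - (y\<^sup>n - F) v\<^sub>h\<^sub>i = G\<close>. The operator \<open>v \<mapsto> (y\<^sup>n - F) v\<^sub>h\<^sub>i\<close> raises the order for the
  weights \<open>(n + 1, 1)\<close>, so its Neumann series converges formally, and it has norm at most \<open>1/2\<close>
  for suitable radii.
\<close>

lemma weierstrass_division_aux:
  assumes F: "biconvergent F" "\<And>j. j < n \<Longrightarrow> bicoeff F 0 j = 0" "bicoeff F 0 n = 1"
    and G: "biconvergent G"
  shows "\<exists>V. biconvergent V \<and> G = V - (fps_X ^ n - F) * fps_shift n V"
proof -
  define H where "H = fps_X ^ n - F"
  define T where "T = (\<lambda>v. H * fps_shift n v)"
  define t where "t k = (T ^^ k) G" for k
  have t_Suc: "t (Suc k) = H * fps_shift n (t k)" for k by (simp add: t_def T_def)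
  define W :: "nat \<Rightarrow> bifps set"
    where "W k = {F. \<forall>i j. Suc n * i + j < k \<longrightarrow> bicoeff F i j = 0}" for k
  have Xn: "bicoeff (fps_X ^ n) i j = (if i = 0 \<and> j = n then 1 else 0)" for i j
    by (simp add: bicoeff_def fps_X_power_iff)
  have H0: "bicoeff H 0 j = 0" if "j \<le> n" for j
    using that F(2)[of j] F(3) by (auto simp: H_def bicoeff_simps Xn)
  \<comment> \<open>Each monomial of \<open>H\<close> contains x or has y-degree above
    \<open>n\<close>, so its weight is at least n + 1; removing y^n costs at most \<open>n\<close>.
    The net gain is at least one.\<close>
  have T_W: "T v \<in> W (Suc k)" if v: "v \<in> W k" for v k
    unfolding W_def
  proof (intro CollectI allI impI)
    fix i j assume ij: "Suc n * i + j < Suc k"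
    have "bicoeff H k' l * bicoeff (fps_shift n v) (i - k') (j - l) = 0" if kl: "k' \<le> i" "l \<le> j" for k' l
    proof (cases "k' = 0 \<and> l \<le> n")
      case True
      then show ?thesis using H0 by simp
    next
      case False
      obtain i' where i': "i = k' + i'" using kl(1) le_iff_add by blast
      obtain j' where j': "j = l + j'" using kl(2) le_iff_add by blast
      note e = i' j'
      have "Suc n * k' + l \<ge> Suc n" using False by (cases k') auto
      then have "Suc n * i' + (j' + n) < k" using ij by (simp add: e algebra_simps)
      then have "bicoeff (fps_shift n v) i' j' = 0"
        using v unfolding W_def bicoeff_fps_shift by blast
      then show ?thesis by (simp add: e)
    qed
    then show "bicoeff (T v) i j = 0"
      unfolding T_def bicoeff_mult by (intro sum.neutral ballI) auto
  qed
  have t_W: "t k \<in> W k" for k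
  proof (induction k)
    case 0
    show ?case by (simp add: W_def)
  next
    case (Suc k)
    then show ?case using T_W[OF Suc] by (simp add: t_Suc T_def)
  qed
  define V where "V = Abs_fps (\<lambda>j. Abs_fps (\<lambda>i. \<Sum>k\<le>Suc n * i + j. bicoeff (t k) i j))"
  have V: "bicoeff V i j = bicoeff (\<Sum>k\<le>K. t k) i j" if "Suc n * i + j \<le> K" for i j K
  proof -
    have "bicoeff V i j = (\<Sum>k\<le>Suc n * i + j. bicoeff (t k) i j)"
      by (simp add: V_def bicoeff_def [of "Abs_fps _"])
    also have "\<dots> = (\<Sum>k\<le>K. bicoeff (t k) i j)"
      using that t_W by (intro sum.mono_neutral_left) (auto simp: W_def not_le)
    finally show ?thesis by (simp add: bicoeff_sum)
  qed
  have "V - T V = G"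
  proof (rule bicoeff_eqI)
    fix i j
    define K where "K = Suc n * i + j"
    let ?S = "\<Sum>k\<le>K. t k"
    have "V - ?S \<in> W (Suc K)" using V by (auto simp: W_def bicoeff_simps)
    then have "T (V - ?S) \<in> W (Suc (Suc K))" by (rule T_W)
    moreover have "T (V - ?S) = T V - (\<Sum>k\<le>K. t (Suc k))"
    proof -
      have "T (\<Sum>k\<in>I. t k) = (\<Sum>k\<in>I. t (Suc k))" for I
        by (induction I rule: infinite_finite_induct)
          (auto simp: T_def t_Suc fps_shift_add distrib_left)
      then show ?thesis by (simp add: T_def fps_shift_diff right_diff_distrib)
    qed
    ultimately have "bicoeff (T V) i j = bicoeff (\<Sum>k\<le>K. t (Suc k)) i j"
      by (auto simp: W_def bicoeff_simps K_def)
    moreover have "bicoeff V i j = bicoeff ?S i j" using V[of i j K] by (simp add: K_def)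
    moreover have "?S = G + (\<Sum>k\<le>K. t (Suc k)) - t (Suc K)"
    proof -
      have "(\<Sum>k\<le>Suc K. t k) = t 0 + (\<Sum>k\<le>K. t (Suc k))" by (rule sum.atMost_Suc_shift)
      then show ?thesis by (simp add: t_def algebra_simps)
    qed
    moreover have "bicoeff (t (Suc K)) i j = 0"
      using t_W[of "Suc K"] by (auto simp: W_def K_def)
    ultimately show "bicoeff (V - T V) i j = bicoeff G i j" by (simp add: bicoeff_simps)
  qed
  moreover have "biconvergent V"
  proof -
    have "biconvergent (fps_X ^ n)"
      unfolding biconvergent_def by (intro exI[of _ 1] exI[of _ 1]) (auto simp: Xn)
    then have "biconvergent H" unfolding H_def diff_conv_add_uminus
      by (intro biconvergent_add biconvergent_uminus F)
    obtain r M where r: "r > 0" and M: "wnorm_le r r G M"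
      using biconvergent_wnorm_leE[OF G] .
    obtain \<rho> \<sigma> where \<rho>: "0 < \<rho>" "\<rho> \<le> r" and \<sigma>: "0 < \<sigma>" "\<sigma> \<le> r" and HH: "wnorm_le \<rho> \<sigma> H (\<sigma> ^ n / 2)"
      using weighted_wnorm_le_small[OF \<open>biconvergent H\<close> H0 r] by metis
    have M': "wnorm_le \<rho> \<sigma> G (1 * M)"
      by (rule wnorm_le_weight[OF _ _ M]) (use \<rho> \<sigma> in \<open>simp_all add: mult_mono power_mono\<close>)
    have M0: "M \<ge> 0" using wnorm_le_nonneg[OF _ _ M] r by auto
    have t: "wnorm_le \<rho> \<sigma> (t k) (M * (1 / 2) ^ k)" for k
    proof (induction k)
      case 0
      then show ?case using M' by (simp add: t_def)
    next
      case (Suc k)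
      \<comment> \<open>The factor \<sigma>^n in the bound for \<open>H\<close> cancels the loss
        caused by dividing by y^n, which leaves the ratio 1/2.\<close>
      have "wnorm_le \<rho> \<sigma> (t (Suc k)) (\<sigma> ^ n / 2 * (M * (1 / 2) ^ k / \<sigma> ^ n))"
        unfolding t_Suc
        by (rule wnorm_le_mult[OF _ _ HH wnorm_le_shift[OF _ _ Suc]]) (use \<rho> \<sigma> in simp_all)
      then show ?case using \<sigma> by simp
    qed
    have "wnorm_le \<rho> \<sigma> V (M * 2)"
      unfolding wnorm_le_def
    proof
      fix m
      let ?S = "\<Sum>k\<le>Suc n * m + m. t k"
      have "bicoeff V i j = bicoeff ?S i j" if "i \<le> m" "j \<le> m" for i j
        by (rule V, rule add_mono, rule mult_le_mono) (use that in simp_all)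
      then have "(\<Sum>i\<le>m. \<Sum>j\<le>m. norm (bicoeff V i j) * \<rho> ^ i * \<sigma> ^ j) =
          (\<Sum>i\<le>m. \<Sum>j\<le>m. norm (bicoeff ?S i j) * \<rho> ^ i * \<sigma> ^ j)"
        by (intro sum.cong refl) auto
      moreover have "wnorm_le \<rho> \<sigma> ?S (\<Sum>k\<le>Suc n * m + m. M * (1 / 2) ^ k)"
        by (rule wnorm_le_sum) (use \<rho> \<sigma> t in simp_all)
      ultimately have "(\<Sum>i\<le>m. \<Sum>j\<le>m. norm (bicoeff V i j) * \<rho> ^ i * \<sigma> ^ j) \<le>
          M * (\<Sum>k\<le>Suc n * m + m. (1 / 2) ^ k)"
        by (simp only: wnorm_le_def sum_distrib_left)
      also have "\<dots> \<le> M * 2" using M0 by (intro mult_left_mono sum_half_powers_le)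
      finally show "(\<Sum>i\<le>m. \<Sum>j\<le>m. norm (bicoeff V i j) * \<rho> ^ i * \<sigma> ^ j) \<le> M * 2" .
    qed
    then show ?thesis using \<rho> \<sigma> by (intro wnorm_le_imp_biconvergent)
  qed
  ultimately show ?thesis by (auto simp: T_def H_def)
qed

lemma bicoeff_fps_const_mult_Xpow:
  "bicoeff (fps_const a * fps_X ^ n) i j = (if j = n then a $ i else 0)"
  by (simp add: bicoeff_def fps_X_power_iff)

section \<open>Convergent series in one variable\<close>

abbreviation conv :: "complex fps \<Rightarrow> bool" where
  "conv a \<equiv> fps_conv_radius a > 0"

lemma biconvergent_nth:
  assumes "biconvergent F"
  shows "conv (F $ j)"
proof -
  obtain r M where r: "r > 0" and M: "wnorm_le r r F M"
    using biconvergent_wnorm_leE[OF assms] .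
  have *: "norm (bicoeff F i j) * r ^ i * r ^ j \<le> M" for i
    using wnorm_le_term[OF _ _ M, of i j] r by auto
  have "summable (\<lambda>i. fps_nth (F $ j) i * of_real (r / 2) ^ i)"
  proof (rule summable_comparison_test_ev)
    show "summable (\<lambda>i. M / r ^ j * (1 / 2) ^ i)"
      by (intro summable_mult summable_geometric) simp
    show "\<forall>\<^sub>F i in sequentially.
        norm (fps_nth (F $ j) i * of_real (r / 2) ^ i) \<le> M / r ^ j * (1 / 2) ^ i"
    proof (intro always_eventually allI)
      fix i
      have "norm (fps_nth (F $ j) i * of_real (r / 2) ^ i) =
          (norm (bicoeff F i j) * r ^ i * r ^ j) / r ^ j * (1 / 2) ^ i"
        using r by (simp add: bicoeff_def norm_mult norm_power power_divide norm_divide)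
      also have "\<dots> \<le> M / r ^ j * (1 / 2) ^ i"
        using * r by (intro mult_right_mono divide_right_mono) auto
      finally show "norm (fps_nth (F $ j) i * of_real (r / 2) ^ i) \<le> M / r ^ j * (1 / 2) ^ i" .
    qed
  qed
  then have "conv_radius (fps_nth (F $ j)) \<ge> ereal (norm (of_real (r / 2) :: complex))"
    by (rule conv_radius_geI)
  then have "ereal (r / 2) \<le> conv_radius (fps_nth (F $ j))" using r by simp
  moreover have "0 < ereal (r / 2)" using r by simp
  ultimately show ?thesis unfolding fps_conv_radius_def by (rule less_le_trans[rotated])
qed

lemma biconvergent_fps_const:
  assumes "conv a"
  shows "biconvergent (fps_const a)"
proof -
  obtain r where r: "0 < r" "ereal r < conv_radius (fps_nth a)"
    using ereal_dense2[of 0 "conv_radius (fps_nth a)"] assms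
    by (auto simp: fps_conv_radius_def)
  then have "summable (\<lambda>n. a $ n * of_real r ^ n)"
    by (intro summable_in_conv_radius) auto
  then have "Bseq (\<lambda>n. a $ n * of_real r ^ n)"
    using summable_LIMSEQ_zero convergentI convergent_imp_Bseq by blast
  then obtain M where M: "M > 0" "\<And>n. norm (a $ n * of_real r ^ n) \<le> M"
    unfolding Bseq_def by blast
  have "norm (bicoeff (fps_const a) i j) * r ^ (i + j) \<le> M" for i j
    using M(2)[of i] M(1) r by (simp add: bicoeff_simps norm_mult norm_power)
  then show ?thesis unfolding biconvergent_def using r by blast
qed

lemma biconvergent_fps_const_iff: "biconvergent (fps_const a) \<longleftrightarrow> conv a"
  using biconvergent_nth[of "fps_const a" 0] biconvergent_fps_const[of a] by (intro iffI) simp_all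

lemma biconvergent_0 [simp]: "biconvergent 0" and biconvergent_1 [simp]: "biconvergent 1"
  and biconvergent_Y [simp]: "biconvergent fps_X"
  by (rule biconvergent_finite; auto simp: bicoeff_simps)+

lemma biconvergent_diff: "biconvergent F \<Longrightarrow> biconvergent G \<Longrightarrow> biconvergent (F - G)"
  using biconvergent_add biconvergent_uminus by fastforce

lemma biconvergent_power: "biconvergent F \<Longrightarrow> biconvergent (F ^ n)"
  by (induction n) (auto intro: biconvergent_mult)

lemma biconvergent_sum: "(\<And>i. i \<in> I \<Longrightarrow> biconvergent (F i)) \<Longrightarrow> biconvergent (sum F I)"
  by (induction I rule: infinite_finite_induct) (auto intro: biconvergent_add)

lemma biconvergent_arc_iff:
  assumes "conv a" "conv b" "a $ 0 = 0" "b $ 0 = 0" "biconvergent F"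
  shows "conv (arc F a b)"
  using assms unfolding biconvergent_fps_const_iff [symmetric] fps_const_arc
  by (intro biconvergent_bisubst) (simp_all add: fps_const_adic_1_iff)

lemma conv_numeral [simp]: "conv (numeral n)"
  by (simp add: fps_conv_radius_numeral)

lemma conv_add: "conv a \<Longrightarrow> conv b \<Longrightarrow> conv (a + b)"
  by (rule less_le_trans[OF _ fps_conv_radius_add]) simp

lemma conv_diff: "conv a \<Longrightarrow> conv b \<Longrightarrow> conv (a - b)"
  by (rule less_le_trans[OF _ fps_conv_radius_diff]) simp

lemma conv_mult: "conv a \<Longrightarrow> conv b \<Longrightarrow> conv (a * b)"
  by (rule less_le_trans[OF _ fps_conv_radius_mult]) simp

lemma conv_power: "conv a \<Longrightarrow> conv (a ^ n)"
  by (rule less_le_trans[OF _ fps_conv_radius_power])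

lemma conv_uminus: "conv a \<Longrightarrow> conv (- a)"
  by simp

lemma conv_inverse: "conv a \<Longrightarrow> a $ 0 \<noteq> 0 \<Longrightarrow> conv (inverse a)"
  by (rule fps_conv_radius_inverse_pos)

lemma conv_shift: "conv a \<Longrightarrow> conv (fps_shift n a)"
  by simp

lemma conv_deriv: "conv a \<Longrightarrow> conv (fps_deriv a)"
  by (rule less_le_trans[OF _ fps_conv_radius_deriv])

lemma conv_const [simp]: "conv (fps_const c)"
  and conv_X [simp]: "conv fps_X"
  and conv_0 [simp]: "conv 0"
  and conv_1 [simp]: "conv 1"
  by simp_all

text \<open>A composition is the arc of a series constant in \<open>y\<close>, so convergence is
  inherited from two-variable substitution.\<close>

lemma conv_compose:
  assumes "conv a" "conv T" "T $ 0 = 0"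
  shows "conv (fps_compose a T)"
  using biconvergent_arc_iff[of T 0 "fps_const a"] assms arc_const[of T 0 a]
  by (simp add: biconvergent_fps_const)

lemmas conv_intros =
  conv_add conv_diff conv_mult conv_power conv_uminus conv_inverse conv_shift conv_deriv
  conv_const conv_X conv_0 conv_1 conv_compose biconvergent_arc_iff biconvergent_nth

lemmas biconv_intros =
  biconvergent_add biconvergent_diff biconvergent_mult biconvergent_power biconvergent_uminus
  biconvergent_deriv biconvergent_0 biconvergent_1 biconvergent_Y biconvergent_sum
  biconvergent_fps_const

text \<open>Scaling by \<open>c\<close> makes the coefficient of y^n on x = 0 equal to 1. In the
  solution \<open>V\<close> of the operator equation, the part of y-degree below \<open>n\<close> is
  the remainder, and the rest, divided by y^n and multiplied by \<open>c\<close>, is the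
  quotient.\<close>

theorem weierstrass_division:
  assumes F: "biconvergent F" "\<And>j. j < n \<Longrightarrow> bicoeff F 0 j = 0" "bicoeff F 0 n \<noteq> 0"
    and G: "biconvergent G"
  obtains Q r where "biconvergent Q" "\<And>j. conv (r j)"
    "G = Q * F + (\<Sum>j<n. fps_const (r j) * fps_X ^ j)"
proof -
  define c where "c = bi_const (1 / bicoeff F 0 n)"
  have c: "biconvergent c" by (simp add: c_def biconvergent_fps_const)
  have "biconvergent (c * F)" using c F(1) by (rule biconvergent_mult)
  then obtain V where V: "biconvergent V" "G = V - (fps_X ^ n - c * F) * fps_shift n V"
    using weierstrass_division_aux[of "c * F" n G] F G by (auto simp: c_def bicoeff_const_mult)
  have V_eq: "V = fps_shift n V * fps_X ^ n + fps_cutoff n V"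
    by (simp add: fps_shift_cutoff)
  have "fps_cutoff n V = (\<Sum>j<n. fps_const (V $ j) * fps_X ^ j)"
    by (rule fps_ext) (simp add: fps_sum_nth fps_X_power_iff if_distrib sum.delta cong: if_cong)
  moreover have "G = (fps_shift n V * c) * F + fps_cutoff n V"
    using V_eq by (subst V(2)) (simp add: algebra_simps)
  moreover have "biconvergent (fps_shift n V)"
  proof -
    obtain r M where "r > 0" "wnorm_le r r V M" using biconvergent_wnorm_leE[OF V(1)] .
    then show ?thesis using wnorm_le_shift[of r r V M n] wnorm_le_imp_biconvergent by auto
  qed
  ultimately show thesis
    using that[of "fps_shift n V * c" "\<lambda>j. V $ j"] biconvergent_mult[OF _ c] biconvergent_nth[OF V(1)]
    by auto
qed

text \<open>Horner's scheme: the highest coefficients are rewritten first, and the outer factor y is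
  replaced by (y - \<sigma>) + \<sigma>.\<close>

lemma poly_in_shifted_Y:
  assumes "\<And>j. conv (r j)" "conv \<sigma>"
  shows "\<exists>r'. (\<forall>j. conv (r' j)) \<and>
    (\<Sum>j<n. fps_const (r j) * fps_X ^ j) = (\<Sum>j<n. fps_const (r' j) * (fps_X - fps_const \<sigma>) ^ j)"
  using assms(1)
proof (induction n arbitrary: r)
  case 0
  then show ?case by auto
next
  case (Suc n)
  let ?Y = "fps_X - fps_const \<sigma> :: bifps"
  obtain r' where r': "\<And>j. conv (r' j)"
    "(\<Sum>j<n. fps_const (r (Suc j)) * fps_X ^ j) = (\<Sum>j<n. fps_const (r' j) * ?Y ^ j)"
    using Suc.IH[of "\<lambda>j. r (Suc j)"] Suc.prems by blast
  define r'' where "r'' j = (if j = 0 then r 0 else r' (j - 1)) + (if j < n then \<sigma> * r' j else 0)" for j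
  have "(\<Sum>j<Suc n. fps_const (r j) * fps_X ^ j) =
      fps_const (r 0) + (\<Sum>j<n. fps_const (r (Suc j)) * fps_X ^ j) * fps_X"
    by (subst sum.lessThan_Suc_shift) (simp add: sum_distrib_right power_Suc2 mult.assoc del: power_Suc)
  also have "\<dots> = fps_const (r 0) + (\<Sum>j<n. fps_const (r' j) * ?Y ^ j) * (?Y + fps_const \<sigma>)"
    by (simp add: r')
  also have "\<dots> = (fps_const (r 0) + (\<Sum>j<n. fps_const (r' j) * ?Y ^ Suc j)) +
      (\<Sum>j<n. fps_const (\<sigma> * r' j) * ?Y ^ j)"
  proof -
    have "(\<Sum>j<n. fps_const (r' j) * ?Y ^ j) * fps_const \<sigma> = (\<Sum>j<n. fps_const (\<sigma> * r' j) * ?Y ^ j)"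
      unfolding sum_distrib_right
      by (intro sum.cong refl) (simp only: fps_const_mult [symmetric] mult_ac)
    moreover have "(\<Sum>j<n. fps_const (r' j) * ?Y ^ j) * ?Y = (\<Sum>j<n. fps_const (r' j) * ?Y ^ Suc j)"
      unfolding sum_distrib_right by (intro sum.cong refl) (simp only: power_Suc2 mult.assoc)
    ultimately show ?thesis by (simp only: distrib_left add.assoc)
  qed
  also have "fps_const (r 0) + (\<Sum>j<n. fps_const (r' j) * ?Y ^ Suc j) =
      (\<Sum>j<Suc n. fps_const (if j = 0 then r 0 else r' (j - 1)) * ?Y ^ j)"
    by (subst sum.lessThan_Suc_shift) simp
  also have "(\<Sum>j<n. fps_const (\<sigma> * r' j) * ?Y ^ j) =
      (\<Sum>j<Suc n. fps_const (if j < n then \<sigma> * r' j else 0) * ?Y ^ j)"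
    by simp
  also have "(\<Sum>j<Suc n. fps_const (if j = 0 then r 0 else r' (j - 1)) * ?Y ^ j) + \<dots> =
      (\<Sum>j<Suc n. fps_const (r'' j) * ?Y ^ j)"
    by (simp only: r''_def fps_const_add [symmetric] distrib_right sum.distrib)
  finally have "(\<Sum>j<Suc n. fps_const (r j) * fps_X ^ j) = (\<Sum>j<Suc n. fps_const (r'' j) * ?Y ^ j)" .
  moreover have "conv (r'' j)" for j
    using Suc.prems r'(1) assms(2) by (auto simp: r''_def intro!: conv_intros)
  ultimately show ?case by blast
qed

text \<open>Remainders are wanted in powers of y - \<sigma> because this function, unlike y itself,
  will have a controlled order along the parametrized branch.\<close>

corollary weierstrass_division_shifted:
  assumes "biconvergent F" "\<And>j. j < n \<Longrightarrow> bicoeff F 0 j = 0" "bicoeff F 0 n \<noteq> 0"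
    and "biconvergent G" "conv \<sigma>"
  obtains Q r where "biconvergent Q" "\<And>j. conv (r j)"
    "G = Q * F + (\<Sum>j<n. fps_const (r j) * (fps_X - fps_const \<sigma>) ^ j)"
proof -
  obtain Q r where *: "biconvergent Q" "\<And>j. conv (r j)"
    "G = Q * F + (\<Sum>j<n. fps_const (r j) * fps_X ^ j)"
    using weierstrass_division[OF assms(1-4)] by blast
  obtain r' where r': "\<forall>j. conv (r' j)"
    "(\<Sum>j<n. fps_const (r j) * fps_X ^ j) = (\<Sum>j<n. fps_const (r' j) * (fps_X - fps_const \<sigma>) ^ j)"
    using poly_in_shifted_Y[of r \<sigma> n, OF *(2) assms(5)] by blast
  show thesis by (rule that[OF *(1), of r']) (use r' *(3) in simp_all)
qed

section \<open>Inverses, implicit functions and roots\<close>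

lemma bi_inverse:
  assumes "biconvergent F" "bicoeff F 0 0 \<noteq> 0"
  obtains G where "biconvergent G" "F * G = 1"
proof -
  \<comment> \<open>Division of 1 with n = 0 leaves no remainder, so the quotient is the
    inverse.\<close>
  obtain Q r where "biconvergent Q" "1 = Q * F + (\<Sum>j<0. fps_const (r j) * fps_X ^ j)"
    using weierstrass_division[OF assms(1) _ assms(2) biconvergent_1] by blast
  then show thesis using that[of Q] by (simp add: mult.commute)
qed

text \<open>Dividing y by \<open>F\<close> with n = 1 leaves a series \<open>r 0\<close> in x alone.
  Along y = \<open>r 0\<close> the identity becomes \<open>Q\<close> times \<open>F\<close> equal to
  zero, and \<open>Q\<close> is a unit, so the remainder itself is the solution.\<close>

lemma implicit_function:
  assumes F: "biconvergent F" "bicoeff F 0 0 = 0" "bicoeff F 0 1 \<noteq> 0"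
  obtains \<alpha> where "conv \<alpha>" "\<alpha> $ 0 = 0" "arc F fps_X \<alpha> = 0"
proof -
  obtain Q r where Q: "biconvergent Q" "\<And>j. conv (r j)"
    and eq: "fps_X = Q * F + (\<Sum>j<1. fps_const (r j) * fps_X ^ j)"
    using weierstrass_division[OF F(1) _ F(3) biconvergent_Y] F(2) by (metis less_one)
  have eq: "fps_X = Q * F + fps_const (r 0)" using eq by simp
  have "bicoeff fps_X 0 0 = bicoeff (Q * F + fps_const (r 0)) 0 0" using eq by simp
  then have r0: "r 0 $ 0 = 0" using F(2) by (simp add: bicoeff_simps bicoeff_00_mult)
  have "bicoeff fps_X 0 1 = bicoeff (Q * F + fps_const (r 0)) 0 1" using eq by simp
  then have Q0: "bicoeff Q 0 0 \<noteq> 0"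
    using F(2) by (auto simp: bicoeff_simps bicoeff_mult)
  have "arc fps_X fps_X (r 0) = arc (Q * F + fps_const (r 0)) fps_X (r 0)" using eq by simp
  then have "arc Q fps_X (r 0) * arc F fps_X (r 0) = 0"
    using r0 by (simp add: arc_Y arc_add arc_mult arc_const)
  moreover have "arc Q fps_X (r 0) $ 0 \<noteq> 0" using Q0 r0 by (simp add: arc_nth_0)
  then have "arc Q fps_X (r 0) \<noteq> 0" by auto
  ultimately show thesis using that[of "r 0"] Q r0 by simp
qed

text \<open>With c^n the constant term of \<open>e\<close>, the implicit equation (c + y)^n =
  \<open>e\<close> has y-derivative n c^(n-1) at the origin, which is nonzero.\<close>

lemma conv_root:
  assumes "conv e" "e $ 0 \<noteq> 0" "n > 0"
  obtains d where "conv d" "d ^ n = e" "d $ 0 \<noteq> 0"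
proof -
  obtain c where c: "e $ 0 = c ^ n" using exists_complex_root[of n "e $ 0"] assms(3) by blast
  with assms have c0: "c \<noteq> 0" by (auto simp: power_0_left)
  let ?F = "(bi_const c + fps_X) ^ n - fps_const e"
  have nth0: "?F $ 0 = fps_const (c ^ n) - e"
    by (simp add: fps_power_zeroth)
  have nth1: "?F $ Suc 0 = of_nat n * fps_const c ^ (n - 1)"
    using fps_power_first[of "bi_const c + fps_X" n] by simp
  have "biconvergent ?F" using assms(1) by (intro biconv_intros) auto
  moreover have "bicoeff ?F 0 0 = 0" unfolding bicoeff_def nth0 by (simp add: c)
  moreover have "bicoeff ?F 0 1 \<noteq> 0"
    using c0 assms(3) unfolding bicoeff_def One_nat_def nth1
    by (simp add: fps_power_zeroth fps_of_nat [symmetric])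
  ultimately obtain \<alpha> where \<alpha>: "conv \<alpha>" "\<alpha> $ 0 = 0" "arc ?F fps_X \<alpha> = 0"
    by (rule implicit_function)
  have "(fps_const c + \<alpha>) ^ n = e"
    using \<alpha> by (simp add: arc_diff arc_power arc_add arc_const arc_Y)
  moreover have "(fps_const c + \<alpha>) $ 0 \<noteq> 0" using c0 \<alpha>(2) by simp
  moreover have "conv (fps_const c + \<alpha>)" using \<alpha>(1) by (intro conv_intros)
  ultimately show thesis using that by blast
qed

section \<open>Normal form of a cubic branch\<close>

lemma fps_of_cps_Abs: "biconvergent F \<Longrightarrow> fps_of_cps (Abs_cps F) = F"
  by (simp add: Abs_cps_inverse)

lemma biconvergent_fps_of_cps [simp]: "biconvergent (fps_of_cps f)"
  using fps_of_cps by auto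

lemma cps_eq_iff: "f = g \<longleftrightarrow> fps_of_cps f = fps_of_cps g"
  by (simp add: fps_of_cps_inject)

lemma cps_dvd_iff: "f dvd g \<longleftrightarrow> (\<exists>H. biconvergent H \<and> fps_of_cps g = H * fps_of_cps f)"
proof
  assume "f dvd g"
  then obtain h where "g = f * h" by (elim dvdE)
  then show "\<exists>H. biconvergent H \<and> fps_of_cps g = H * fps_of_cps f"
    by (intro exI[of _ "fps_of_cps h"]) (simp add: times_cps.rep_eq mult.commute)
next
  assume "\<exists>H. biconvergent H \<and> fps_of_cps g = H * fps_of_cps f"
  then obtain H where "biconvergent H" "fps_of_cps g = H * fps_of_cps f" by blast
  then have "g = f * Abs_cps H"
    by (simp add: cps_eq_iff times_cps.rep_eq fps_of_cps_Abs mult.commute)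
  then show "f dvd g" by simp
qed

lemma cps_unit_iff: "w dvd 1 \<longleftrightarrow> bicoeff (fps_of_cps w) 0 0 \<noteq> 0"
proof
  assume "w dvd 1"
  then obtain H where H: "1 = H * fps_of_cps w" by (auto simp: cps_dvd_iff one_cps.rep_eq)
  have "bicoeff (1 :: bifps) 0 0 = bicoeff H 0 0 * bicoeff (fps_of_cps w) 0 0"
    unfolding H by (rule bicoeff_00_mult)
  then show "bicoeff (fps_of_cps w) 0 0 \<noteq> 0" by (auto simp: bicoeff_simps)
next
  assume "bicoeff (fps_of_cps w) 0 0 \<noteq> 0"
  then obtain G where "biconvergent G" "fps_of_cps w * G = 1"
    by (rule bi_inverse[OF biconvergent_fps_of_cps])
  then show "w dvd 1" by (auto simp: cps_dvd_iff one_cps.rep_eq mult.commute intro!: exI[of _ G])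
qed

lemma irreducible_cps_factor:
  assumes "irreducible f" "fps_of_cps f = G * H" "biconvergent G" "biconvergent H"
  shows "bicoeff G 0 0 \<noteq> 0 \<or> bicoeff H 0 0 \<noteq> 0"
proof -
  have "f = Abs_cps G * Abs_cps H"
    using assms by (simp add: cps_eq_iff times_cps.rep_eq fps_of_cps_Abs)
  then have "Abs_cps G dvd 1 \<or> Abs_cps H dvd 1" using assms(1) by (rule irreducibleD[rotated])
  then show ?thesis using assms by (simp add: cps_unit_iff fps_of_cps_Abs)
qed

lemma mult0_adic: "fps_of_cps f \<in> adic (mult0 f)"
  unfolding adic_def
proof (intro CollectI allI impI)
  fix i j assume "i + j < mult0 f"
  then have "\<not> (\<exists>i' j'. i' + j' = i + j \<and> cps_coeff f i' j' \<noteq> 0)"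
    unfolding mult0_def by (rule not_less_Least)
  then show "bicoeff (fps_of_cps f) i j = 0" by (auto simp: cps_coeff_def)
qed

lemma arc_nth_eq_0:
  assumes "F \<in> adic m" "a $ 0 = 0" "b $ 0 = 0" "k < m"
  shows "arc F a b $ k = 0"
proof -
  have c: "fps_const a \<in> adic (Suc 0)" "fps_const b \<in> adic (Suc 0)"
    using assms by (simp_all add: fps_const_adic_1_iff)
  have *: "bicoeff F i j * (a ^ i * b ^ j) $ k = 0" for i j
  proof (cases "i + j < m")
    case True
    then show ?thesis using assms(1) by (simp add: adic_def)
  next
    case False
    have "bicoeff (fps_const a ^ i * fps_const b ^ j) k 0 = (a ^ i * b ^ j) $ k"
      by (simp add: bicoeff_simps)
    moreover have "bicoeff (fps_const a ^ i * fps_const b ^ j) k 0 = 0"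
      using False assms(4) by (intro bicoeff_power_mult_eq_0[OF c]) auto
    ultimately show ?thesis by simp
  qed
  show ?thesis unfolding arc_def fps_nth_Abs_fps by (intro sum.neutral ballI *)
qed

section \<open>Weierstrass preparation and cubic equations\<close>

lemma fps_order_decompose:
  fixes a :: "complex fps"
  assumes "a \<noteq> 0" "conv a"
  obtains k b where "a = fps_X ^ k * b" "b $ 0 \<noteq> 0" "subdegree a = k" "conv b"
proof
  show "a = fps_X ^ subdegree a * fps_shift (subdegree a) a"
    using subdegree_decompose[of a] by (simp add: mult.commute)
qed (use assms in auto)

text \<open>Divide y^n by \<open>F\<close> and compare coefficients on x = 0: the remainder
  coefficients vanish at 0 and the quotient is a unit, whose inverse is \<open>W\<close>. The last
  clause holds since the Weierstrass polynomial is a multiple of \<open>F\<close>; it later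
  transfers multiplicity 3 to the cubic.\<close>

lemma weierstrass_preparation:
  assumes F: "biconvergent F" "\<And>j. j < n \<Longrightarrow> bicoeff F 0 j = 0" "bicoeff F 0 n \<noteq> 0"
  obtains W r where "biconvergent W" "bicoeff W 0 0 \<noteq> 0" "\<And>j. conv (r j)"
    "\<And>j. j < n \<Longrightarrow> r j $ 0 = 0" "F = W * (fps_X ^ n + (\<Sum>j<n. fps_const (r j) * fps_X ^ j))"
    "F \<in> adic k \<longrightarrow> fps_X ^ n + (\<Sum>j<n. fps_const (r j) * fps_X ^ j) \<in> adic k"
proof -
  have Xn: "biconvergent (fps_X ^ n)" by (intro biconv_intros)
  obtain Q r where Q: "biconvergent Q" and r: "\<And>j. conv (r j)"
    and eq: "fps_X ^ n = Q * F + (\<Sum>j<n. fps_const (r j) * fps_X ^ j)"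
    using weierstrass_division[OF F Xn] by metis
  let ?P = "fps_X ^ n + (\<Sum>j<n. fps_const (- r j) * fps_X ^ j)"
  have P: "?P = Q * F" using eq by (simp add: sum_negf flip: fps_const_neg)
  have R: "bicoeff (\<Sum>j<n. fps_const (r j) * fps_X ^ j) 0 l = (if l < n then r l $ 0 else 0)" for l
    by (simp add: bicoeff_sum bicoeff_fps_const_mult_Xpow)
  have c: "bicoeff (fps_X ^ n) 0 l = bicoeff (Q * F) 0 l + (if l < n then r l $ 0 else 0)" for l
    by (subst eq) (simp add: bicoeff_simps R)
  have QF: "bicoeff (Q * F) 0 l = (\<Sum>k\<le>l. bicoeff Q 0 k * bicoeff F 0 (l - k))" for l
    by (simp add: bicoeff_mult)
  have r0: "r l $ 0 = 0" if "l < n" for l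
  proof -
    have "bicoeff (Q * F) 0 l = 0" unfolding QF using that F(2) by (intro sum.neutral) auto
    moreover have "bicoeff (fps_X ^ n) 0 l = 0" using that by (simp add: bicoeff_def fps_X_power_iff)
    ultimately show ?thesis using c[of l] that by simp
  qed
  have "bicoeff (Q * F) 0 n = (\<Sum>k\<in>{0}. bicoeff Q 0 k * bicoeff F 0 (n - k))"
    unfolding QF using F(2) by (intro sum.mono_neutral_right) auto
  moreover have "bicoeff (fps_X ^ n) 0 n = 1" by (simp add: bicoeff_def fps_X_power_iff)
  ultimately have "bicoeff Q 0 0 \<noteq> 0" using c[of n] by auto
  then obtain W where W: "biconvergent W" "Q * W = 1" by (rule bi_inverse[OF Q])
  show thesis
  proof (rule that[of W "\<lambda>j. - r j"])
    have "bicoeff Q 0 0 * bicoeff W 0 0 = 1"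
      using W(2) by (simp add: bicoeff_simps flip: bicoeff_00_mult)
    then show "bicoeff W 0 0 \<noteq> 0" by auto
    show "F = W * ?P" unfolding P using W(2) by (simp add: mult.assoc[symmetric] mult.commute[of W])
    show "F \<in> adic k \<longrightarrow> ?P \<in> adic k" unfolding P by (blast intro: adic_mult_left)
  qed (use W r r0 in auto)
qed

text \<open>The cube E = A^3 solves the quadratic resolvent 27 (E^2 + q1 E) = x^k p1^3. At x = 0 its
  roots are -q1(0) and 0, which differ, so the nonzero one extends by the implicit function theorem;
  \<open>B\<close> is then forced to be -p1 / (3 A).\<close>

lemma cardano_factors:
  fixes p1 q1 :: "complex fps"
  assumes "conv p1" "conv q1" "q1 $ 0 \<noteq> 0" "k > 0"
  obtains A B where "conv A" "conv B" "A $ 0 \<noteq> 0" "3 * A * B = - p1"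
    "A ^ 3 + fps_X ^ k * B ^ 3 = - q1"
proof -
  define h where "h = fps_X ^ k * p1 ^ 3"
  define e where "e = - (q1 $ 0)"
  have e: "e \<noteq> 0" "q1 $ 0 = - e" using assms by (simp_all add: e_def)
  have h: "conv h" "h $ 0 = 0" using assms by (simp_all add: h_def conv_intros)
  let ?F = "bi_const 27 * ((bi_const e + fps_X) ^ 2 + fps_const q1 * (bi_const e + fps_X)) - fps_const h"
  have "biconvergent ?F"
    using assms h by (intro biconv_intros) auto
  moreover have "bicoeff ?F 0 0 = 0"
    using e h by (simp add: bicoeff_def fps_power_zeroth power2_eq_square)
  moreover have "bicoeff ?F 0 1 \<noteq> 0"
    using e h fps_power_first[of "bi_const e + fps_X" 2] by (simp add: bicoeff_def)
  ultimately obtain \<alpha> where \<alpha>: "conv \<alpha>" "\<alpha> $ 0 = 0" "arc ?F fps_X \<alpha> = 0"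
    by (rule implicit_function)
  define E where "E = fps_const e + \<alpha>"
  have "fps_const 27 * (E ^ 2 + q1 * E) = h"
    using \<alpha> by (simp add: arc_diff arc_power arc_add arc_const arc_Y arc_mult E_def)
  then have E_eq: "27 * (E ^ 2 + q1 * E) = h" by (simp add: numeral_fps_const)
  have "conv E" "E $ 0 \<noteq> 0" using \<alpha> e by (auto simp: E_def intro!: conv_intros)
  then obtain A where A: "conv A" "A ^ 3 = E" "A $ 0 \<noteq> 0"
    using conv_root[of E 3] by auto
  define B where "B = fps_const (- 1 / 3) * p1 * inverse A"
  have three: "(3 :: complex fps) = fps_const 3" by (simp add: numeral_fps_const)
  have AB: "3 * A * B = - p1"
  proof -
    have "3 * A * B = (fps_const 3 * fps_const (- 1 / 3)) * p1 * (A * inverse A)"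
      unfolding B_def three by (simp only: mult_ac)
    also have "\<dots> = fps_const (- 1) * p1" using A(3) by (simp add: inverse_mult_eq_1')
    finally show ?thesis by (simp flip: fps_const_neg)
  qed
  have "27 * A ^ 3 * (A ^ 3 + fps_X ^ k * B ^ 3) = 27 * E ^ 2 + fps_X ^ k * (3 * A * B) ^ 3"
    unfolding A(2)[symmetric] by algebra
  also have "\<dots> = 27 * E ^ 2 - h" unfolding AB h_def by simp
  also have "\<dots> = 27 * A ^ 3 * (- q1)" unfolding E_eq[symmetric] A(2) by algebra
  finally have "A ^ 3 + fps_X ^ k * B ^ 3 = - q1"
    using A(3) by (subst (asm) mult_cancel_left) auto
  moreover have "conv B" using A assms by (auto simp: B_def intro!: conv_intros)
  ultimately show thesis using that A AB by blast
qed

lemma cardano_identity: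
  fixes u v p q :: "'a::comm_ring_1"
  assumes "3 * u * v = - p" "u ^ 3 + v ^ 3 = - q"
  shows "(u + v) ^ 3 + p * (u + v) + q = 0"
proof -
  have "(u + v) ^ 3 + p * (u + v) + q = (u ^ 3 + v ^ 3 + q) + (3 * u * v + p) * (u + v)"
    by (simp add: power3_eq_cube algebra_simps)
  then show ?thesis using assms by simp
qed

text \<open>A simple root is required for lifting to a power series. A double root can only occur at
  -3/2 with k = -4/27, and then 3 is a simple root.\<close>

lemma cubic_simple_root:
  fixes k :: complex
  obtains z where "k * z ^ 3 + z + 1 = 0" "3 * k * z ^ 2 + 1 \<noteq> 0"
proof (cases "k = 0")
  case True
  then show thesis using that[of "-1"] by simp
next
  case False
  have "\<not> constant (poly [:1, 1, 0, k:])"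
    using False by (subst constant_degree) simp
  then obtain z where "poly [:1, 1, 0, k:] z = 0" using fundamental_theorem_of_algebra by blast
  then have z: "k * z ^ 3 + z + 1 = 0" by (simp add: power3_eq_cube algebra_simps)
  show thesis
  proof (cases "3 * k * z ^ 2 + 1 = 0")
    case True
    \<comment> \<open>Three times the polynomial minus \<open>z\<close> times its derivative
      eliminates the cubic term.\<close>
    have "2 * z + 3 = 3 * (k * z ^ 3 + z + 1) - z * (3 * k * z ^ 2 + 1)"
      by (simp add: power2_eq_square power3_eq_cube algebra_simps)
    then have "2 * z + 3 = 0" using z True by simp
    moreover have "z = (2 * z + 3) / 2 - 3 / 2" by (simp add: field_simps)
    ultimately have "z = - 3 / 2" by simp
    with True have k: "k = - 4 / 27" by (simp add: power2_eq_square field_simps add_eq_0_iff)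
    show thesis by (rule that[of 3]) (simp_all add: k)
  next
    case False
    then show thesis using that z by blast
  qed
qed

text \<open>The rescaling \<beta> = x^(s-m) (q1 / p1) Z turns the equation into \<kappa> Z^3 + Z + 1
  = 0, with \<kappa> = x^(2s-3m) q1^2 / p1^3 a power series exactly because 3m is at most 2s. A
  simple root at x = 0 lifts. For an irreducible cubic this excludes the range 3m <= 2s.\<close>

lemma degenerate_cubic_root:
  fixes p q :: "complex fps"
  assumes "conv p" "conv q" "p \<noteq> 0" "p $ 0 = 0" "q \<noteq> 0" "3 * subdegree p \<le> 2 * subdegree q"
  obtains \<beta> where "conv \<beta>" "\<beta> $ 0 = 0" "\<beta> ^ 3 + p * \<beta> + q = 0"
proof -
  obtain m p1 where p: "p = fps_X ^ m * p1" "p1 $ 0 \<noteq> 0" "subdegree p = m" "conv p1"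
    by (rule fps_order_decompose[OF \<open>p \<noteq> 0\<close> assms(1)])
  obtain s q1 where q: "q = fps_X ^ s * q1" "q1 $ 0 \<noteq> 0" "subdegree q = s" "conv q1"
    by (rule fps_order_decompose[OF \<open>q \<noteq> 0\<close> assms(2)])
  have ms: "3 * m \<le> 2 * s" using assms(6) p(3) q(3) by simp
  have "m > 0" using assms(4) p(1,2) by (cases m) auto
  then have sm: "s > m" using ms by linarith
  define i where "i = inverse p1"
  have i: "p1 * i = 1" "conv i" using p(2,4) by (auto simp: i_def inverse_mult_eq_1' intro!: conv_intros)
  define \<kappa> where "\<kappa> = fps_X ^ (2 * s - 3 * m) * q1 ^ 2 * i ^ 3"
  have \<kappa>: "conv \<kappa>" using q(4) i(2) by (auto simp: \<kappa>_def intro!: conv_intros)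
  obtain z where z: "\<kappa> $ 0 * z ^ 3 + z + 1 = 0" "3 * \<kappa> $ 0 * z ^ 2 + 1 \<noteq> 0"
    using cubic_simple_root by metis
  let ?Z = "bi_const z + fps_X"
  let ?F = "fps_const \<kappa> * ?Z ^ 3 + ?Z + 1"
  have "biconvergent ?F" using \<kappa> by (intro biconv_intros) auto
  moreover have "bicoeff ?F 0 0 = 0"
    using z by (simp add: bicoeff_def fps_power_zeroth)
  moreover have "bicoeff ?F 0 1 \<noteq> 0"
    using z fps_power_first[of ?Z 3] by (simp add: bicoeff_def mult_ac fps_power_zeroth)
  ultimately obtain \<alpha> where \<alpha>: "conv \<alpha>" "\<alpha> $ 0 = 0" "arc ?F fps_X \<alpha> = 0"
    by (rule implicit_function)
  define Z where "Z = fps_const z + \<alpha>"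
  have Z: "\<kappa> * Z ^ 3 + Z + 1 = 0"
    using \<alpha> by (simp add: arc_power arc_add arc_const arc_Y arc_mult arc_1 Z_def)
  define \<beta> where "\<beta> = fps_X ^ (s - m) * q1 * i * Z"
  have "conv \<beta>" unfolding \<beta>_def Z_def by (intro conv_intros q(4) i(2) \<alpha>(1))
  moreover have "\<beta> $ 0 = 0" using sm by (simp add: \<beta>_def)
  moreover have "\<beta> ^ 3 + p * \<beta> + q = 0"
  proof -
    have e1: "\<beta> ^ 3 = fps_X ^ (3 * (s - m)) * q1 ^ 3 * i ^ 3 * Z ^ 3"
      by (simp add: \<beta>_def power_mult_distrib mult.commute[of 3] power_mult)
    also have "3 * (s - m) = s + (2 * s - 3 * m)" using ms sm by linarith
    finally have e1: "\<beta> ^ 3 = fps_X ^ s * q1 * (\<kappa> * Z ^ 3)"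
      by (simp add: power_add \<kappa>_def power2_eq_square power3_eq_cube mult_ac)
    have "p * \<beta> = fps_X ^ (m + (s - m)) * q1 * (p1 * i) * Z"
      by (simp add: p(1) \<beta>_def power_add mult_ac)
    then have e2: "p * \<beta> = fps_X ^ s * q1 * Z" using sm i by simp
    have "\<beta> ^ 3 + p * \<beta> + q = fps_X ^ s * q1 * (\<kappa> * Z ^ 3 + Z + 1)"
      unfolding e1 e2 q(1) by (simp add: algebra_simps)
    then show ?thesis using Z by simp
  qed
  ultimately show thesis using that by blast
qed

text \<open>
  The cubic equation of a branch after Weierstrass preparation and completing the cube; \<open>A\<close> and \<open>B\<close>
  come from Cardano's formula, whose two summands at \<open>x = t\<^sup>3\<close> are \<open>t\<^sup>s A(t\<^sup>3)\<close> and
  \<open>t\<^bsup>3m-s\<^esup> B(t\<^sup>3)\<close>.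
\<close>

locale cubic_branch =
  fixes f :: cps and W :: bifps and \<sigma> p1 q1 A B :: "complex fps" and s m :: nat
  assumes f_eq: "fps_of_cps f = W * ((fps_X - fps_const \<sigma>) ^ 3 +
      fps_const (fps_X ^ m * p1) * (fps_X - fps_const \<sigma>) + fps_const (fps_X ^ s * q1))"
    and W: "biconvergent W" "bicoeff W 0 0 \<noteq> 0"
    and sigma: "conv \<sigma>" "\<sigma> $ 0 = 0"
    and p1: "conv p1" "p1 = 0 \<or> p1 $ 0 \<noteq> 0"
    and q1: "conv q1" "q1 $ 0 \<noteq> 0"
    and A: "conv A" "A $ 0 \<noteq> 0"
    and B: "conv B"
    and AB: "3 * A * B = - p1" "A ^ 3 + fps_X ^ (3 * m - 2 * s) * B ^ 3 = - q1"
    and s: "s \<ge> 4" "\<not> 3 dvd s"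
    and ms: "3 * m > 2 * s"

lemma cubic_branch_exists:
  assumes "branch f" "x_transversal f" "mult0 f = 3"
  obtains W \<sigma> p1 q1 A B s m where "cubic_branch f W \<sigma> p1 q1 A B s m"
proof -
  let ?F = "fps_of_cps f"
  have F: "?F \<in> adic 3" using mult0_adic[of f] assms(3) by simp
  have F3: "bicoeff ?F 0 3 \<noteq> 0" using assms(2,3) by (simp add: x_transversal_def cps_coeff_def)
  have F0: "bicoeff ?F 0 j = 0" if "j < 3" for j using F that by (simp add: adic_def)
  obtain W r where W: "biconvergent W" "bicoeff W 0 0 \<noteq> 0" and r: "\<And>j. conv (r j)"
    "\<And>j. j < 3 \<Longrightarrow> r j $ 0 = 0"
    and FW: "?F = W * (fps_X ^ 3 + (\<Sum>j<3. fps_const (r j) * fps_X ^ j))"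
    and P3: "?F \<in> adic 3 \<longrightarrow> fps_X ^ 3 + (\<Sum>j<3. fps_const (r j) * fps_X ^ j) \<in> adic 3"
    using weierstrass_preparation[OF biconvergent_fps_of_cps F0 F3, where k = 3] by blast
  define \<sigma> where "\<sigma> = fps_const (- 1 / 3) * r 2"
  define p where "p = r 1 - 3 * \<sigma> ^ 2"
  define q where "q = r 0 + r 1 * \<sigma> - 2 * \<sigma> ^ 3"
  have \<sigma>: "conv \<sigma>" "\<sigma> $ 0 = 0" using r(1,2)[of 2] by (auto simp: \<sigma>_def intro!: conv_intros)
  have conv_num: "conv (numeral n)" for n by simp
  have p: "conv p" "p $ 0 = 0" using r(2)[of 1] \<sigma>
    by (auto simp: p_def power2_eq_square intro!: conv_intros r conv_num)
  have q: "conv q" using \<sigma> by (auto simp: q_def intro!: conv_intros r conv_num)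
  define Y where "Y = (fps_X - fps_const \<sigma> :: bifps)"
  define P where "P = Y ^ 3 + fps_const p * Y + fps_const q"
  have "3 * \<sigma> = (fps_const 3 * fps_const (- 1 / 3)) * r 2"
    by (simp only: \<sigma>_def numeral_fps_const mult.assoc)
  also have "\<dots> = fps_const (- 1) * r 2" by simp
  finally have r2: "r 2 = - (3 * \<sigma>)" by (simp flip: fps_const_neg)
  have P_eq: "fps_X ^ 3 + (\<Sum>j<3. fps_const (r j) * fps_X ^ j) = P"
  proof -
    have "(\<Sum>j<3. fps_const (r j) * fps_X ^ j) =
        fps_const (r 0) + fps_const (r 1) * fps_X + fps_const (r 2) * fps_X ^ 2"
      by (simp add: eval_nat_numeral)
    also have "fps_const (r 2) = - (3 * fps_const \<sigma>)"
      unfolding r2 by (simp only: fps_const_neg [symmetric] fps_const_mult [symmetric]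
          numeral_fps_const [symmetric])
    finally have "(\<Sum>j<3. fps_const (r j) * fps_X ^ j) =
        fps_const (r 0) + fps_const (r 1) * fps_X - 3 * fps_const \<sigma> * fps_X ^ 2" by simp
    moreover have "fps_const p = fps_const (r 1) - 3 * fps_const \<sigma> ^ 2"
      "fps_const q = fps_const (r 0) + fps_const (r 1) * fps_const \<sigma> - 2 * fps_const \<sigma> ^ 3"
      by (simp_all only: p_def q_def fps_const_add [symmetric] fps_const_sub [symmetric]
          fps_const_mult [symmetric] fps_const_power [symmetric] numeral_fps_const [symmetric])
    ultimately show ?thesis unfolding P_def Y_def by algebra
  qed
  have FP: "?F = W * P" using FW P_eq by simp
  \<comment> \<open>Since \<open>q\<close> is the value of \<open>P\<close> at y = \<sigma>, and
    \<sigma> has no constant term, order 3 of \<open>P\<close> forces order at least 3 of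
    \<open>q\<close>.\<close>
  have "P \<in> adic 3" using P3 F P_eq by simp
  moreover have "arc P fps_X \<sigma> = q"
    using \<sigma>(2) by (simp add: P_def Y_def arc_add arc_diff arc_mult arc_power arc_Y arc_const)
  ultimately have q_nth: "q $ k = 0" if "k < 3" for k
    using arc_nth_eq_0[of P 3 fps_X \<sigma> k] that \<sigma>(2) by simp
  \<comment> \<open>A convergent root without constant term splits off a linear non-unit factor and
    leaves a quadratic non-unit, contradicting irreducibility.\<close>
  have no_root: False if \<beta>: "conv \<beta>" "\<beta> $ 0 = 0" "\<beta> ^ 3 + p * \<beta> + q = 0" for \<beta>
  proof -
    have "fps_const \<beta> ^ 3 + fps_const p * fps_const \<beta> + fps_const q = fps_const (\<beta> ^ 3 + p * \<beta> + q)"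
      by simp
    then have "fps_const \<beta> ^ 3 + fps_const p * fps_const \<beta> + fps_const q = 0" using \<beta>(3) by simp
    then have "P = (Y - fps_const \<beta>) * (Y ^ 2 + fps_const \<beta> * Y + (fps_const p + fps_const \<beta> ^ 2))"
      unfolding P_def by algebra
    then have "?F = (W * (Y - fps_const \<beta>)) * (Y ^ 2 + fps_const \<beta> * Y + (fps_const p + fps_const \<beta> ^ 2))"
      using FP by (simp only: mult.assoc)
    moreover have "biconvergent (W * (Y - fps_const \<beta>))"
      unfolding Y_def by (intro biconv_intros W \<beta> \<sigma>)
    moreover have "biconvergent (Y ^ 2 + fps_const \<beta> * Y + (fps_const p + fps_const \<beta> ^ 2))"
      unfolding Y_def by (intro biconv_intros W \<beta> \<sigma> p)
    moreover have "bicoeff (W * (Y - fps_const \<beta>)) 0 0 = 0"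
      using \<beta>(2) \<sigma>(2) by (simp add: bicoeff_00_mult bicoeff_simps Y_def)
    moreover have "bicoeff (Y ^ 2 + fps_const \<beta> * Y + (fps_const p + fps_const \<beta> ^ 2)) 0 0 = 0"
      unfolding Y_def power2_eq_square bicoeff_simps(2,3) bicoeff_00_mult
      using \<beta>(2) \<sigma>(2) p(2) by (simp add: bicoeff_simps)
    ultimately show False
      using irreducible_cps_factor[of f] assms(1) unfolding branch_def by blast
  qed
  have "q \<noteq> 0" using no_root[of 0] by auto
  then obtain s q1 where q_eq: "q = fps_X ^ s * q1" "subdegree q = s" and q1: "conv q1" "q1 $ 0 \<noteq> 0"
    using fps_order_decompose[of q] q by blast
  have "s \<ge> 3" using q_nth \<open>q \<noteq> 0\<close> unfolding q_eq(2)[symmetric] by (intro subdegree_geI) auto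
  obtain m p1 where p_eq: "p = fps_X ^ m * p1" and p1: "conv p1" "p1 = 0 \<or> p1 $ 0 \<noteq> 0" and ms: "3 * m > 2 * s"
  proof (cases "p = 0")
    case True
    \<comment> \<open>If \<open>p\<close> vanishes, \<open>m\<close> carries no information; the
      value 2s is chosen so that the inequality 3m > 2s of the locale holds.\<close>
    then show thesis using that[of "2 * s" 0] \<open>s \<ge> 3\<close> by simp
  next
    case False
    then obtain m p1 where *: "p = fps_X ^ m * p1" "subdegree p = m" "conv p1" "p1 $ 0 \<noteq> 0"
      using fps_order_decompose[of p] p by blast
    have "\<not> 3 * m \<le> 2 * s"
      using degenerate_cubic_root[OF p(1) q False p(2) \<open>q \<noteq> 0\<close>] no_root *(2) q_eq(2) by metis
    then show thesis using that[of m p1] *(1,3,4) by simp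
  qed
  obtain A B where AB: "conv A" "conv B" "A $ 0 \<noteq> 0" "3 * A * B = - p1"
    "A ^ 3 + fps_X ^ (3 * m - 2 * s) * B ^ 3 = - q1"
    using cardano_factors[OF p1(1) q1, of "3 * m - 2 * s"] ms by auto
  \<comment> \<open>If 3 divided \<open>s\<close>, both summands in Cardano's formula would be power
    series in x itself, and their sum would be a forbidden root.\<close>
  have "\<not> 3 dvd s"
  proof
    assume "3 dvd s"
    then obtain k where k: "s = 3 * k" by auto
    then have "k > 0" "m > k + k" using \<open>s \<ge> 3\<close> ms by linarith+
    define u where "u = fps_X ^ k * A"
    define v where "v = fps_X ^ (m - k) * B"
    have "3 * u * v = fps_X ^ (k + (m - k)) * (3 * A * B)"
      unfolding u_def v_def power_add by (simp only: mult_ac)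
    also have "\<dots> = - p" using \<open>m > k + k\<close> by (simp add: AB p_eq)
    finally have uv: "3 * u * v = - p" .
    have "u ^ 3 = fps_X ^ s * A ^ 3" by (simp add: u_def power_mult_distrib k mult.commute[of 3] power_mult)
    moreover have "v ^ 3 = fps_X ^ (s + (3 * m - 2 * s)) * B ^ 3"
    proof -
      have "s + (3 * m - 2 * s) = (m - k) * 3" using k \<open>m > k + k\<close> by simp
      then show ?thesis by (simp only: v_def power_mult_distrib power_mult)
    qed
    ultimately have "u ^ 3 + v ^ 3 = fps_X ^ s * (A ^ 3 + fps_X ^ (3 * m - 2 * s) * B ^ 3)"
      by (simp add: power_add algebra_simps)
    then have "u ^ 3 + v ^ 3 = - q" by (simp add: AB q_eq(1))
    from cardano_identity[OF uv this] have "(u + v) ^ 3 + p * (u + v) + q = 0" .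
    moreover have "conv (u + v)" unfolding u_def v_def using AB by (intro conv_intros)
    moreover have "(u + v) $ 0 = 0" using \<open>k > 0\<close> \<open>m > k + k\<close> by (simp add: u_def v_def)
    ultimately show False using no_root by blast
  qed
  moreover from this have "s \<noteq> 3" by auto
  then have "s \<ge> 4" using \<open>s \<ge> 3\<close> by simp
  ultimately have "cubic_branch f W \<sigma> p1 q1 A B s m"
    using FP W \<sigma> p1 q1 AB ms unfolding P_def Y_def p_eq q_eq(1) by unfold_locales
  then show thesis by (rule that)
qed

section \<open>Intersection numbers along a parametrization\<close>

lemma fps_of_cps_const: "fps_of_cps (cps_const c) = bi_const c"
  by (simp add: cps_const.rep_eq)

lemmas cps_rep = plus_cps.rep_eq minus_cps.rep_eq uminus_cps.rep_eq times_cps.rep_eq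
  zero_cps.rep_eq one_cps.rep_eq fps_of_cps_const cps_X.rep_eq cps_Y.rep_eq fps_of_cps_power
  cps_dy.rep_eq

lemma cps_const_0: "cps_const 0 = 0"
  and cps_const_1: "cps_const 1 = 1"
  and cps_const_add: "cps_const (c + d) = cps_const c + cps_const d"
  and cps_const_diff: "cps_const (c - d) = cps_const c - cps_const d"
  and cps_const_mult: "cps_const (c * d) = cps_const c * cps_const d"
  by (simp_all add: cps_eq_iff cps_rep)

lemma cps_const_sum: "cps_const (sum c I) = (\<Sum>i\<in>I. cps_const (c i))"
  by (induction I rule: infinite_finite_induct) (simp_all add: cps_const_0 cps_const_add)

text \<open>Gaussian elimination by induction on the equations: a pivot \<open>p\<close> for one
  equation removes it together with one unknown, and the value \<open>t\<close> of that unknown is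
  restored afterwards.\<close>

lemma homogeneous_system_nontrivial:
  fixes M :: "'a \<Rightarrow> 'b \<Rightarrow> complex"
  assumes "finite B'" "finite B" "card B' < card B"
  shows "\<exists>c. (\<exists>b\<in>B. c b \<noteq> 0) \<and> (\<forall>b'\<in>B'. (\<Sum>b\<in>B. c b * M b b') = 0)"
  using assms
proof (induction B' arbitrary: B M rule: finite_induct)
  case empty
  then have "B \<noteq> {}" by auto
  then show ?case by (intro exI[of _ "\<lambda>_. 1"]) auto
next
  case (insert b0 B')
  show ?case
  proof (cases "\<forall>b\<in>B. M b b0 = 0")
    case True
    obtain c where "\<exists>b\<in>B. c b \<noteq> 0" "\<forall>b'\<in>B'. (\<Sum>b\<in>B. c b * M b b') = 0"
      using insert.IH[of B M] insert.prems insert.hyps by auto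
    moreover have "(\<Sum>b\<in>B. c b * M b b0) = 0" using True by (intro sum.neutral) auto
    ultimately show ?thesis by auto
  next
    case False
    then obtain p where p: "p \<in> B" "M p b0 \<noteq> 0" by blast
    define B1 where "B1 = B - {p}"
    define M1 where "M1 b b' = M b b' - M b b0 / M p b0 * M p b'" for b b'
    have B1: "finite B1" "p \<notin> B1" "B = insert p B1" "card B' < card B1"
      using insert.prems insert.hyps p by (auto simp: B1_def)
    obtain c where c: "\<exists>b\<in>B1. c b \<noteq> 0" "\<forall>b'\<in>B'. (\<Sum>b\<in>B1. c b * M1 b b') = 0"
      using insert.IH[of B1 M1] B1 by auto
    define t where "t = - (\<Sum>b\<in>B1. c b * M b b0) / M p b0"
    define c' where "c' = c(p := t)"
    have sum: "(\<Sum>b\<in>B. c' b * M b b') = t * M p b' + (\<Sum>b\<in>B1. c b * M b b')" for b'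
    proof -
      have "(\<Sum>b\<in>B. c' b * M b b') = t * M p b' + (\<Sum>b\<in>B1. c' b * M b b')"
        using B1 by (simp add: c'_def)
      also have "(\<Sum>b\<in>B1. c' b * M b b') = (\<Sum>b\<in>B1. c b * M b b')"
        using B1(2) by (intro sum.cong) (auto simp: c'_def)
      finally show ?thesis .
    qed
    have "(\<Sum>b\<in>B. c' b * M b b') = 0" if "b' \<in> B'" for b'
    proof -
      have "(\<Sum>b\<in>B1. c b * M1 b b') = (\<Sum>b\<in>B1. c b * M b b') + t * M p b'"
        by (simp add: M1_def t_def right_diff_distrib sum_subtractf sum_distrib_left sum_divide_distrib
            sum_negf mult_ac)
      then show ?thesis using c(2) that sum by (simp add: add.commute)
    qed
    moreover have "(\<Sum>b\<in>B. c' b * M b b0) = 0" unfolding sum using p by (simp add: t_def)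
    moreover have "\<exists>b\<in>B. c' b \<noteq> 0" using c(1) B1 by (auto simp: c'_def)
    ultimately show ?thesis by blast
  qed
qed

text \<open>Expressing the elements of the larger basis in the smaller one yields a nontrivial
  relation modulo \<open>I\<close>, that is, a second representation of zero besides the trivial
  one.\<close>

lemma quotient_basis_card_le:
  assumes I: "0 \<in> I" "\<And>g h. g \<in> I \<Longrightarrow> h \<in> I \<Longrightarrow> g + h \<in> I" "\<And>c g. g \<in> I \<Longrightarrow> c * g \<in> I"
    and B: "quotient_basis I B" and B': "quotient_basis I B'"
  shows "card B \<le> card B'"
proof (rule ccontr)
  assume "\<not> ?thesis"
  then have less: "card B' < card B" by simp
  have fin: "finite B" "finite B'" using B B' by (auto simp: quotient_basis_def)
  have "\<forall>b. \<exists>c. b - (\<Sum>b'\<in>B'. cps_const (c b') * b') \<in> I"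
    using B' unfolding quotient_basis_def by meson
  then obtain M where M: "\<And>b. b - (\<Sum>b'\<in>B'. cps_const (M b b') * b') \<in> I" by metis
  obtain c where c: "\<exists>b\<in>B. c b \<noteq> 0" "\<forall>b'\<in>B'. (\<Sum>b\<in>B. c b * M b b') = 0"
    using homogeneous_system_nontrivial[OF fin(2,1) less, of M] by blast
  define d where "d b = (if b \<in> B then - c b else 0)" for b
  have I_sum: "sum g J \<in> I" if "\<And>j. j \<in> J \<Longrightarrow> g j \<in> I" for g :: "cps \<Rightarrow> cps" and J
    using that by (induction J rule: infinite_finite_induct) (auto intro: I)
  have "(\<Sum>b\<in>B. cps_const (c b) * (b - (\<Sum>b'\<in>B'. cps_const (M b b') * b'))) \<in> I"
    by (intro I_sum I M)
  also have "(\<Sum>b\<in>B. cps_const (c b) * (b - (\<Sum>b'\<in>B'. cps_const (M b b') * b'))) =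
      (\<Sum>b\<in>B. cps_const (c b) * b) - (\<Sum>b\<in>B. \<Sum>b'\<in>B'. cps_const (c b * M b b') * b')"
    by (simp add: right_diff_distrib sum_subtractf sum_distrib_left cps_const_mult mult.assoc)
  also have "(\<Sum>b\<in>B. \<Sum>b'\<in>B'. cps_const (c b * M b b') * b') =
      (\<Sum>b'\<in>B'. cps_const (\<Sum>b\<in>B. c b * M b b') * b')"
    by (subst sum.swap) (simp add: cps_const_sum sum_distrib_right)
  also have "\<dots> = 0" using c(2) by (simp add: cps_const_0)
  finally have "(\<Sum>b\<in>B. cps_const (c b) * b) \<in> I" by simp
  moreover have "(\<Sum>b\<in>B. cps_const (d b) * b) = - (\<Sum>b\<in>B. cps_const (c b) * b)"
    using cps_const_diff[of 0] by (simp add: d_def sum_negf[symmetric] cps_const_0)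
  ultimately have d_I: "0 - (\<Sum>b\<in>B. cps_const (d b) * b) \<in> I" by simp
  define P where "P z \<longleftrightarrow> (\<forall>b. b \<notin> B \<longrightarrow> z b = 0) \<and> 0 - (\<Sum>b\<in>B. cps_const (z b) * b) \<in> I" for z
  have "P d" unfolding P_def using d_I by (simp add: d_def)
  moreover have "P (\<lambda>_. 0)" using I(1) by (simp add: P_def cps_const_0)
  moreover have "\<exists>!z. P z" using B unfolding quotient_basis_def P_def by blast
  ultimately have "d = (\<lambda>_. 0)" by blast
  then have "d b = 0" for b by simp
  then have "c b = 0" if "b \<in> B" for b using that unfolding d_def by (metis neg_equal_0_iff_equal)
  then show False using c(1) by blast
qed

lemma quotient_dim_eq:
  assumes I: "0 \<in> I" "\<And>g h. g \<in> I \<Longrightarrow> h \<in> I \<Longrightarrow> g + h \<in> I" "\<And>c g. g \<in> I \<Longrightarrow> c * g \<in> I"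
    and B: "quotient_basis I B"
  shows "quotient_dim I = enat (card B)"
  unfolding quotient_dim_def
proof (rule antisym)
  show "Inf {enat (card B) |B. quotient_basis I B} \<le> enat (card B)"
    using B by (intro Inf_lower) blast
  show "enat (card B) \<le> Inf {enat (card B) |B. quotient_basis I B}"
  proof (rule Inf_greatest)
    fix e assume "e \<in> {enat (card B) |B. quotient_basis I B}"
    then obtain B' where "e = enat (card B')" "quotient_basis I B'" by blast
    then show "enat (card B) \<le> e" using quotient_basis_card_le[OF I B] by simp
  qed
qed

section \<open>Intersection numbers on parametrized curves\<close>

lemma subdegree_diff_lead:
  fixes u v :: "complex fps"
  assumes "u \<noteq> 0" "v \<noteq> 0" "subdegree u = subdegree v"
  defines "w \<equiv> u - fps_const (u $ subdegree u / v $ subdegree u) * v"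
  shows "w = 0 \<or> subdegree w > subdegree u"
proof (cases "w = 0")
  case False
  have "w $ i = 0" if "i \<le> subdegree u" for i
  proof (cases "i = subdegree u")
    case True
    have "v $ subdegree u \<noteq> 0" using assms(2,3) by simp
    then show ?thesis by (simp add: w_def True)
  next
    case False
    then have "i < subdegree u" "i < subdegree v" using that assms(3) by linarith+
    then have "u $ i = 0" "v $ i = 0" by (simp_all only: nth_less_subdegree_zero)
    then show ?thesis by (simp add: w_def)
  qed
  then have "subdegree w > subdegree u"
    using False by (intro subdegree_greaterI) auto
  then show ?thesis ..
qed simp

text \<open>The two facts about pulling back along (a, b) that determine intersection numbers: the
  kernel is the ideal of \<open>f\<close>, and the image contains all convergent series of order at
  least \<open>c\<close>. Here \<open>c\<close> is any such bound, which may exceed the conductor of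
  the semigroup.\<close>

locale parametrization =
  fixes f :: cps and a b :: "complex fps" and c :: nat
  assumes conv_a: "conv a" and conv_b: "conv b" and a0: "a $ 0 = 0" and b0: "b $ 0 = 0"
    and kernel: "\<And>g. arc (fps_of_cps g) a b = 0 \<longleftrightarrow> f dvd g"
    and conductor: "\<And>h. conv h \<Longrightarrow> (\<And>i. i < c \<Longrightarrow> h $ i = 0) \<Longrightarrow> \<exists>g. arc (fps_of_cps g) a b = h"
begin

definition pull :: "cps \<Rightarrow> complex fps" where
  "pull g = arc (fps_of_cps g) a b"

lemma pull_add: "pull (g + h) = pull g + pull h"
  and pull_diff: "pull (g - h) = pull g - pull h"
  and pull_mult: "pull (g * h) = pull g * pull h"
  and pull_const: "pull (cps_const z) = fps_const z"
  and pull_0: "pull 0 = 0"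
  by (simp_all add: pull_def cps_rep arc_add arc_diff arc_mult arc_const arc_0 a0 b0)

lemma pull_sum: "pull (sum g I) = (\<Sum>i\<in>I. pull (g i))"
  by (induction I rule: infinite_finite_induct) (simp_all add: pull_0 pull_add)

lemma conv_pull: "conv (pull g)"
  unfolding pull_def using conv_a conv_b a0 b0 by (intro conv_intros) auto

definition orders :: "nat set" where
  "orders = {subdegree (pull g) | g. pull g \<noteq> 0}"

lemma orders_add: "i \<in> orders \<Longrightarrow> j \<in> orders \<Longrightarrow> i + j \<in> orders"
proof -
  assume "i \<in> orders" "j \<in> orders"
  then obtain g h where "i = subdegree (pull g)" "pull g \<noteq> 0" "j = subdegree (pull h)" "pull h \<noteq> 0"
    by (auto simp: orders_def)
  then show "i + j \<in> orders"
    unfolding orders_def by (intro CollectI exI[of _ "g * h"]) (simp add: pull_mult)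
qed

lemma orders_ge: "i \<ge> c \<Longrightarrow> i \<in> orders"
proof -
  assume "i \<ge> c"
  then obtain g where "pull g = fps_X ^ i"
    using conductor[OF conv_power[OF conv_X], of i] by (auto simp: pull_def fps_X_power_nth)
  then show "i \<in> orders" unfolding orders_def by (intro CollectI exI[of _ g]) simp
qed

text \<open>Pulling back identifies the quotient by (f, h) with the image ring modulo the multiples
  of \<open>pull h\<close>. A basis is given by one element for each order not of the form s + k
  with s an order, where k is the order of \<open>pull h\<close>; there are exactly k such
  orders.\<close>

theorem intersection_number_eq:
  assumes "\<not> f dvd h"
  shows "intersection_number f h = enat (subdegree (pull h))"
proof -
  define k where "k = subdegree (pull h)"
  have h: "pull h \<noteq> 0" using assms kernel by (simp add: pull_def)
  have k: "k \<in> orders" using h by (auto simp: orders_def k_def)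
  define I where "I = {u * f + v * h | u v. True}"
  have I_iff: "g \<in> I \<longleftrightarrow> (\<exists>v. pull g = pull v * pull h)" for g
  proof
    assume "g \<in> I"
    moreover have "pull f = 0" using kernel[of f] by (simp add: pull_def)
    ultimately show "\<exists>v. pull g = pull v * pull h" by (auto simp: I_def pull_add pull_mult)
  next
    assume "\<exists>v. pull g = pull v * pull h"
    then obtain v where "pull (g - v * h) = 0" by (auto simp: pull_diff pull_mult)
    then have "f dvd g - v * h" using kernel by (simp add: pull_def)
    then obtain u where "g - v * h = f * u" by (elim dvdE)
    then have "g = u * f + v * h" by (simp add: algebra_simps)
    then show "g \<in> I" by (auto simp: I_def)
  qed
  have I: "0 \<in> I" "\<And>g h. g \<in> I \<Longrightarrow> h \<in> I \<Longrightarrow> g + h \<in> I" "\<And>c g. g \<in> I \<Longrightarrow> c * g \<in> I"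
  proof -
    show "0 \<in> I" unfolding I_iff by (intro exI[of _ 0]) (simp add: pull_0)
    show "g + g' \<in> I" if gg: "g \<in> I" "g' \<in> I" for g g'
    proof -
      obtain v v' where "pull g = pull v * pull h" "pull g' = pull v' * pull h"
        using gg unfolding I_iff by blast
      then show ?thesis unfolding I_iff
        by (intro exI[of _ "v + v'"]) (simp add: pull_add distrib_right)
    qed
    show "c * g \<in> I" if gg: "g \<in> I" for c g
    proof -
      obtain v where "pull g = pull v * pull h" using gg unfolding I_iff by blast
      then show ?thesis unfolding I_iff by (intro exI[of _ "c * v"]) (simp add: pull_mult mult.assoc)
    qed
  qed
  define T where "T = orders - (\<lambda>s. s + k) ` orders"
  have T: "finite T \<and> card T = k"
  proof -
    \<comment> \<open>From \<open>c\<close> onwards every number is an order. Below c + k there are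
      thus card L + k orders, and those removed are the translates of \<open>L\<close>, so k
      remain.\<close>
    define L where "L = orders \<inter> {..<c}"
    have "orders \<inter> {..<c + k} = L \<union> {c..<c + k}"
      using orders_ge by (auto simp: L_def)
    moreover have "L \<inter> {c..<c + k} = {}" by (auto simp: L_def)
    moreover have "finite L" by (simp add: L_def)
    ultimately have card: "card (orders \<inter> {..<c + k}) = card L + k" by (simp add: card_Un_disjoint)
    have sub: "(\<lambda>s. s + k) ` L \<subseteq> orders \<inter> {..<c + k}"
      using orders_add[OF _ k] by (auto simp: L_def)
    have "T = orders \<inter> {..<c + k} - (\<lambda>s. s + k) ` L"
    proof (intro equalityI subsetI)
      fix x assume x: "x \<in> T"
      have "x < c + k"
      proof (rule ccontr)
        assume "\<not> ?thesis"
        then have "x - k \<in> orders" "x = x - k + k" using orders_ge[of "x - k"] by auto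
        then show False using x unfolding T_def by blast
      qed
      then show "x \<in> orders \<inter> {..<c + k} - (\<lambda>s. s + k) ` L" using x by (auto simp: T_def L_def)
    next
      fix x assume x: "x \<in> orders \<inter> {..<c + k} - (\<lambda>s. s + k) ` L"
      then show "x \<in> T" by (auto simp: T_def L_def)
    qed
    then show ?thesis
      using card card_Diff_subset[OF _ sub] card_image[of "\<lambda>s. s + k" L] \<open>finite L\<close> by (simp add: inj_on_def)
  qed
  have "\<forall>s\<in>orders. \<exists>g. pull g \<noteq> 0 \<and> subdegree (pull g) = s" by (auto simp: orders_def)
  then obtain e where e: "\<And>s. s \<in> orders \<Longrightarrow> pull (e s) \<noteq> 0"
    "\<And>s. s \<in> orders \<Longrightarrow> subdegree (pull (e s)) = s" by metis
  have T_orders: "s \<in> orders" if "s \<in> T" for s using that by (simp add: T_def)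
  have inj: "inj_on e T" by (rule inj_onI) (metis e(2) T_orders)
  define B where "B = e ` T"
  have B: "finite B" "card B = k" using T inj by (auto simp: B_def card_image)
  define R where "R = {g. \<exists>z. g - (\<Sum>b\<in>B. cps_const (z b) * b) \<in> I}"
  have R_I: "g \<in> R" if "g \<in> I" for g
    using that unfolding R_def by (intro CollectI exI[of _ "\<lambda>_. 0"]) (simp add: cps_const_0)
  have R_add: "g + g' \<in> R" if gg: "g \<in> R" "g' \<in> R" for g g'
  proof -
    obtain z z' where "g - (\<Sum>b\<in>B. cps_const (z b) * b) \<in> I" "g' - (\<Sum>b\<in>B. cps_const (z' b) * b) \<in> I"
      using gg by (auto simp: R_def)
    from I(2)[OF this] have "g + g' - (\<Sum>b\<in>B. cps_const (z b + z' b) * b) \<in> I"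
      by (simp add: cps_const_add distrib_right sum.distrib algebra_simps)
    then show ?thesis by (auto simp: R_def)
  qed
  have R_B: "cps_const z * b \<in> R" if b: "b \<in> B" for z b
  proof -
    have "(\<Sum>b'\<in>B. cps_const (if b' = b then z else 0) * b') = (\<Sum>b'\<in>B. if b' = b then cps_const z * b else 0)"
      by (intro sum.cong) (auto simp: cps_const_0)
    then have "cps_const z * b - (\<Sum>b'\<in>B. cps_const (if b' = b then z else 0) * b') = 0"
      using b B by simp
    then show ?thesis unfolding R_def using I(1) by (intro CollectI exI[of _ "\<lambda>b'. if b' = b then z else 0"]) simp
  qed
  \<comment> \<open>Leading terms are cancelled successively, by a basis element if the order lies
    in \<open>T\<close> and by a multiple of \<open>h\<close> otherwise. Once the order reaches c +
    k, the quotient by \<open>pull h\<close> has order at least \<open>c\<close> and is itself a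
    pull-back, so the rest lies in \<open>I\<close>.\<close>
  have R: "g \<in> R" if "\<And>i. i < c + k - n \<Longrightarrow> pull g $ i = 0" for g n
    using that
  proof (induction n arbitrary: g)
    case 0
    define G where "G = fps_shift k (pull g)"
    define H where "H = fps_shift k (pull h)"
    have "conv (G * inverse H)"
      unfolding G_def H_def using h conv_pull by (intro conv_intros) (auto simp: k_def)
    moreover have "(G * inverse H) $ i = 0" if "i < c" for i
      using that 0 by (auto simp: fps_mult_nth G_def intro!: sum.neutral)
    ultimately obtain v where v: "pull v = G * inverse H"
      unfolding pull_def using conductor by blast
    have G: "pull g = G * fps_X ^ k" unfolding G_def
      by (rule fps_ext) (use 0 in \<open>auto simp: fps_X_power_mult_right_nth\<close>)
    have H: "pull h = H * fps_X ^ k"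
      unfolding k_def H_def by (rule subdegree_decompose)
    have "inverse H * H = 1"
      using h by (intro inverse_mult_eq_1) (simp add: k_def H_def)
    moreover have "pull v * pull h = G * (inverse H * H) * fps_X ^ k"
      unfolding v H by (simp only: mult_ac)
    ultimately have "pull g = pull v * pull h" by (simp add: G)
    then show ?case using R_I I_iff by blast
  next
    case (Suc n)
    show ?case
    proof (cases "pull g = 0")
      case True
      then show ?thesis using R_I I_iff[of g] by (metis mult_zero_left pull_0)
    next
      case False
      define j where "j = subdegree (pull g)"
      have j: "j \<in> orders" using False by (auto simp: orders_def j_def)
      have j_ge: "j \<ge> c + k - Suc n" unfolding j_def using False Suc.prems
        by (meson not_le nth_subdegree_nonzero)
      have "\<exists>g'. g' \<in> R \<and> pull g' \<noteq> 0 \<and> subdegree (pull g') = j \<and> (\<forall>z. cps_const z * g' \<in> R)"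
      proof (cases "j \<in> T")
        case True
        then have "e j \<in> B" by (simp add: B_def)
        then have "\<forall>z. cps_const z * e j \<in> R" using R_B by blast
        moreover from this have "e j \<in> R" by (metis cps_const_1 mult_1)
        ultimately show ?thesis using e[OF j] by blast
      next
        case False
        then obtain i where i: "i \<in> orders" "j = i + k" using j by (auto simp: T_def)
        have "pull (e i * h) = pull (e i) * pull h" by (rule pull_mult)
        then have "e i * h \<in> I" unfolding I_iff by blast
        moreover from this have "\<forall>z. cps_const z * (e i * h) \<in> R" using I(3) R_I by blast
        moreover have "pull (e i * h) \<noteq> 0" "subdegree (pull (e i * h)) = j"
          using e[OF i(1)] h i by (auto simp: pull_mult k_def)
        ultimately show ?thesis using R_I by blast
      qed
      then obtain g' where g': "pull g' \<noteq> 0" "subdegree (pull g') = j" "\<And>z. cps_const z * g' \<in> R"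
        by blast
      define z where "z = pull g $ j / pull g' $ j"
      define g2 where "g2 = g - cps_const z * g'"
      have pull_g2: "pull g2 = pull g - fps_const z * pull g'"
        by (simp add: g2_def pull_diff pull_mult pull_const)
      have "pull g2 = 0 \<or> subdegree (pull g2) > j"
        using subdegree_diff_lead[OF False g'(1)] g'(2) unfolding pull_g2 z_def j_def by simp
      then have "pull g2 $ i = 0" if "i < c + k - n" for i
        using that j_ge by (auto intro: nth_less_subdegree_zero)
      then have "g2 \<in> R" by (rule Suc.IH)
      then have "g2 + cps_const z * g' \<in> R" using g'(3) R_add by blast
      then show ?thesis by (simp add: g2_def)
    qed
  qed
  have "quotient_basis I B"
    unfolding quotient_basis_def
  proof (intro conjI allI B)
    fix g
    have "g \<in> R" using R[where n = "c + k"] by auto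
    then obtain z where z: "g - (\<Sum>b\<in>B. cps_const (z b) * b) \<in> I" by (auto simp: R_def)
    show "\<exists>!z. (\<forall>b. b \<notin> B \<longrightarrow> z b = 0) \<and> g - (\<Sum>b\<in>B. cps_const (z b) * b) \<in> I"
    proof (rule ex_ex1I)
      have "(\<Sum>b\<in>B. cps_const (if b \<in> B then z b else 0) * b) = (\<Sum>b\<in>B. cps_const (z b) * b)"
        by (intro sum.cong) auto
      then show "\<exists>z. (\<forall>b. b \<notin> B \<longrightarrow> z b = 0) \<and> g - (\<Sum>b\<in>B. cps_const (z b) * b) \<in> I"
        using z by (intro exI[of _ "\<lambda>b. if b \<in> B then z b else 0"]) auto
    next
      fix y y'
      assume y: "(\<forall>b. b \<notin> B \<longrightarrow> y b = 0) \<and> g - (\<Sum>b\<in>B. cps_const (y b) * b) \<in> I"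
        and y': "(\<forall>b. b \<notin> B \<longrightarrow> y' b = 0) \<and> g - (\<Sum>b\<in>B. cps_const (y' b) * b) \<in> I"
      define d where "d b = y' b - y b" for b
      have "(g - (\<Sum>b\<in>B. cps_const (y b) * b)) + (- 1) * (g - (\<Sum>b\<in>B. cps_const (y' b) * b)) \<in> I"
        using y y' I by blast
      also have "(g - (\<Sum>b\<in>B. cps_const (y b) * b)) + (- 1) * (g - (\<Sum>b\<in>B. cps_const (y' b) * b)) =
          (\<Sum>b\<in>B. cps_const (d b) * b)"
        by (simp add: d_def cps_const_diff left_diff_distrib sum_subtractf)
      finally obtain v where v: "pull (\<Sum>b\<in>B. cps_const (d b) * b) = pull v * pull h"
        using I_iff by blast
      have eq: "pull (\<Sum>b\<in>B. cps_const (d b) * b) = (\<Sum>s\<in>T. fps_const (d (e s)) * pull (e s))"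
        unfolding B_def by (simp add: sum.reindex[OF inj] pull_sum pull_mult pull_const)
      \<comment> \<open>Otherwise the least order s0 with nonzero coefficient survives in the sum.
        It would then be an order plus k, but such numbers were excluded from
        \<open>T\<close>.\<close>
      have "d (e s) = 0" if "s \<in> T" for s
      proof (rule ccontr)
        assume "d (e s) \<noteq> 0"
        define N where "N = {s \<in> T. d (e s) \<noteq> 0}"
        have N: "finite N" "N \<noteq> {}" using T \<open>d (e s) \<noteq> 0\<close> that by (auto simp: N_def)
        define s0 where "s0 = Min N"
        have s0: "s0 \<in> T" "d (e s0) \<noteq> 0" "\<And>s. s \<in> T \<Longrightarrow> d (e s) \<noteq> 0 \<Longrightarrow> s0 \<le> s"
          using Min_in[OF N] Min_le[OF N(1)] by (auto simp: s0_def N_def)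
        let ?u = "pull (\<Sum>b\<in>B. cps_const (d b) * b)"
        have coeff: "(fps_const (d (e s)) * pull (e s)) $ i = 0" if "s \<in> T" "i \<le> s0" "s \<noteq> s0 \<or> i < s0" for s i
          using that s0(3)[of s] e(2)[OF T_orders[of s]] nth_less_subdegree_zero[of i "pull (e s)"]
          by (cases "d (e s) = 0") auto
        have "?u $ s0 = (\<Sum>s\<in>{s0}. (fps_const (d (e s)) * pull (e s)) $ s0)"
          unfolding eq fps_sum_nth using T s0 coeff by (intro sum.mono_neutral_right) auto
        then have "?u $ s0 \<noteq> 0"
          using s0 e[OF T_orders[of s0]] nth_subdegree_nonzero[of "pull (e s0)"] by simp
        moreover have "?u $ i = 0" if "i < s0" for i
          unfolding eq fps_sum_nth using coeff that by (intro sum.neutral) auto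
        ultimately have "subdegree ?u = s0" "?u \<noteq> 0" by (auto intro!: subdegreeI)
        then have "pull v \<noteq> 0" "s0 = subdegree (pull v) + k"
          using v h by (auto simp: k_def)
        then have "s0 \<in> (\<lambda>s. s + k) ` orders" by (auto simp: orders_def)
        then show False using s0(1) by (simp add: T_def)
      qed
      then have "d b = 0" for b using y y' by (cases "b \<in> B") (auto simp: B_def d_def)
      then show "y = y'" by (auto simp: d_def)
    qed
  qed
  then have "quotient_dim I = enat k" using quotient_dim_eq[OF I] B by metis
  then show ?thesis by (simp add: intersection_number_def I_def k_def)
qed

corollary value_semigroup_eq: "value_semigroup f = orders"
  unfolding value_semigroup_def orders_def
  using intersection_number_eq kernel by (auto simp: pull_def)

text \<open>The pull-back maps to an integral domain and has the multiples of \<open>f\<close> as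
  kernel, so \<open>f\<close> is prime.\<close>

lemma irreducible:
  assumes "f \<noteq> 0" "\<not> f dvd 1"
  shows "irreducible f"
proof (rule irreducibleI)
  fix g h assume gh: "f = g * h"
  have "pull g * pull h = 0" using kernel[of f] gh by (simp add: pull_def flip: pull_mult[unfolded pull_def])
  then have "f dvd g \<or> f dvd h" using kernel by (auto simp: pull_def)
  then show "g dvd 1 \<or> h dvd 1"
  proof
    assume "f dvd g"
    then obtain u where "g = f * u" by (elim dvdE)
    then have "f * (u * h) = f * 1" using gh by (metis mult.assoc mult_1_right)
    then have "u * h = 1" using assms(1) by simp
    then show ?thesis by (metis dvd_triv_right)
  next
    assume "f dvd h"
    then obtain u where "h = f * u" by (elim dvdE)
    then have "f * (u * g) = f * 1" using gh by (metis mult.assoc mult.commute mult_1_right)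
    then have "u * g = 1" using assms(1) by simp
    then show ?thesis by (metis dvd_triv_right)
  qed
qed (use assms in auto)

end

section \<open>Ramified substitution and semigroups\<close>

definition ram :: "nat \<Rightarrow> complex fps \<Rightarrow> complex fps" where
  "ram n a = fps_compose a (fps_X ^ n)"

lemma conv_iff_bounded: "conv h \<longleftrightarrow> (\<exists>r>0. \<exists>M. \<forall>i. norm (h $ i) * r ^ i \<le> M)"
proof
  assume "conv h"
  then obtain r M where "r > 0" and M: "\<And>i j. norm (bicoeff (fps_const h) i j) * r ^ (i + j) \<le> M"
    using biconvergent_fps_const unfolding biconvergent_def by blast
  then show "\<exists>r>0. \<exists>M. \<forall>i. norm (h $ i) * r ^ i \<le> M"
    using M[of _ 0] by (auto simp: bicoeff_simps)
next
  assume "\<exists>r>0. \<exists>M. \<forall>i. norm (h $ i) * r ^ i \<le> M"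
  then obtain r M where r: "r > 0" and M: "\<And>i. norm (h $ i) * r ^ i \<le> M" by blast
  have "0 \<le> norm (h $ 0) * r ^ 0" by simp
  with M have "M \<ge> 0" by (meson order_trans)
  then have "norm (bicoeff (fps_const h) i j) * r ^ (i + j) \<le> M" for i j
    using M[of i] by (simp add: bicoeff_simps)
  then show "conv h" unfolding biconvergent_fps_const_iff [symmetric] biconvergent_def using r by blast
qed

text \<open>The offset \<open>j\<close> may exceed \<open>n\<close>: t^j times this series at t^n is
  the part of \<open>h\<close> whose exponents are congruent to \<open>j\<close> modulo
  \<open>n\<close> and at least \<open>j\<close>.\<close>

definition fps_section :: "nat \<Rightarrow> nat \<Rightarrow> complex fps \<Rightarrow> complex fps" where
  "fps_section n j h = Abs_fps (\<lambda>i. h $ (n * i + j))"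

lemma conv_section:
  assumes "conv h"
  shows "conv (fps_section n j h)"
proof -
  obtain r M where r: "r > 0" and M: "\<And>i. norm (h $ i) * r ^ i \<le> M"
    using assms unfolding conv_iff_bounded by blast
  have "norm (fps_section n j h $ i) * (r ^ n) ^ i \<le> M / r ^ j" for i
    using M[of "n * i + j"] r by (simp add: fps_section_def power_add power_mult pos_le_divide_eq mult.assoc)
  moreover have "r ^ n > 0" using r by simp
  ultimately show ?thesis unfolding conv_iff_bounded by blast
qed

context
  fixes n :: nat
  assumes n: "n > 0"
begin

private lemma Xn0: "(fps_X ^ n :: complex fps) $ 0 = 0"
  using n by simp

lemma ram_nth: "ram n a $ k = (if n dvd k then a $ (k div n) else 0)"
proof -
  have "ram n a $ k = (\<Sum>i\<in>{0..k}. a $ i * (if k = n * i then 1 else 0))"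
    by (simp add: ram_def fps_compose_nth fps_X_power_nth flip: power_mult)
  also have "\<dots> = (\<Sum>i\<in>{0..k}. if n dvd k \<and> i = k div n then a $ (k div n) else 0)"
    using n by (intro sum.cong) auto
  also have "\<dots> = (if n dvd k then a $ (k div n) else 0)"
    by (auto intro: div_le_dividend)
  finally show ?thesis .
qed

lemma ram_nth_0 [simp]: "ram n a $ 0 = a $ 0"
  by (simp add: ram_nth)

lemma ram_add: "ram n (a + b) = ram n a + ram n b"
  and ram_diff: "ram n (a - b) = ram n a - ram n b"
  and ram_uminus: "ram n (- a) = - ram n a"
  and ram_mult: "ram n (a * b) = ram n a * ram n b"
  and ram_power: "ram n (a ^ k) = ram n a ^ k"
  and ram_const: "ram n (fps_const z) = fps_const z"
  and ram_numeral: "ram n (numeral w) = numeral w"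
  and ram_0: "ram n 0 = 0" and ram_1: "ram n 1 = 1"
  using Xn0 by (simp_all add: ram_def fps_compose_add_distrib fps_compose_sub_distrib
      fps_compose_uminus fps_compose_mult_distrib fps_compose_power)

lemma ram_X: "ram n fps_X = fps_X ^ n"
  using n by (simp add: ram_def fps_X_fps_compose_startby0)

lemma ram_eq_iff: "ram n a = ram n b \<longleftrightarrow> a = b"
proof
  assume eq: "ram n a = ram n b"
  have "ram n a $ (n * k) = a $ k" "ram n b $ (n * k) = b $ k" for k using n by (simp_all add: ram_nth)
  then show "a = b" by (metis eq fps_ext)
qed simp

lemma ram_eq_0_iff: "ram n a = 0 \<longleftrightarrow> a = 0"
  using ram_eq_iff[of a 0] by (simp add: ram_0)

lemma subdegree_ram: "subdegree (ram n a) = n * subdegree a"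
proof (cases "a = 0")
  case False
  show ?thesis
  proof (rule subdegreeI)
    show "ram n a $ (n * subdegree a) \<noteq> 0" using False n by (simp add: ram_nth)
    show "ram n a $ i = 0" if "i < n * subdegree a" for i
      using that n by (auto simp: ram_nth elim!: dvdE)
  qed
qed (simp add: ram_0)

lemma conv_ram: "conv a \<Longrightarrow> conv (ram n a)"
  unfolding ram_def using n by (intro conv_intros) auto

lemma arc_const_Xpow:
  assumes "b $ 0 = 0"
  shows "arc (fps_const h) (fps_X ^ n) b = ram n h"
  using arc_const[OF Xn0 assms] by (simp add: ram_def)

end

lemma ram_1_left: "ram 1 a = a"
  by (simp add: ram_def)

section \<open>Semigroups from pairwise distinct orders\<close>

lemma sum_distinct_orders:
  fixes u :: "'a \<Rightarrow> complex fps"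
  assumes "finite J" "\<exists>j\<in>J. u j \<noteq> 0"
    and "\<And>j k. j \<in> J \<Longrightarrow> k \<in> J \<Longrightarrow> u j \<noteq> 0 \<Longrightarrow> u k \<noteq> 0 \<Longrightarrow> subdegree (u j) = subdegree (u k) \<Longrightarrow> j = k"
  shows "sum u J \<noteq> 0 \<and> (\<exists>j\<in>J. u j \<noteq> 0 \<and> subdegree (sum u J) = subdegree (u j))"
proof -
  define N where "N = (\<lambda>j. subdegree (u j)) ` {j \<in> J. u j \<noteq> 0}"
  have N: "finite N" "N \<noteq> {}" using assms by (auto simp: N_def)
  from Min_in[OF N] obtain j where j: "j \<in> J" "u j \<noteq> 0" "Min N = subdegree (u j)"
    unfolding N_def by blast
  have le: "subdegree (u j) \<le> subdegree (u k)" if "k \<in> J" "u k \<noteq> 0" for k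
    unfolding j(3)[symmetric] by (rule Min_le[OF N(1)]) (use that in \<open>auto simp: N_def\<close>)
  have z: "u k $ i = 0" if "k \<in> J" "i \<le> subdegree (u j)" "k \<noteq> j \<or> i < subdegree (u j)" for k i
  proof (cases "u k = 0")
    case False
    have "i < subdegree (u k)"
    proof (cases "k = j")
      case True
      then show ?thesis using that(3) by simp
    next
      case False
      then have "subdegree (u k) \<noteq> subdegree (u j)"
        using assms(3)[of k j] that(1) j(1,2) \<open>u k \<noteq> 0\<close> by blast
      then show ?thesis using le[OF that(1) \<open>u k \<noteq> 0\<close>] that(2) by linarith
    qed
    then show ?thesis by (rule nth_less_subdegree_zero)
  qed simp
  have "sum u J $ subdegree (u j) = (\<Sum>k\<in>{j}. u k $ subdegree (u j))"
    unfolding fps_sum_nth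
    by (rule sum.mono_neutral_right[OF assms(1)]) (use j(1) in simp, rule ballI, rule z, simp_all)
  then have nz: "sum u J $ subdegree (u j) \<noteq> 0" using j by simp
  moreover have "sum u J $ i = 0" if "i < subdegree (u j)" for i
    unfolding fps_sum_nth by (intro sum.neutral ballI z) (use that in simp_all)
  ultimately have "subdegree (sum u J) = subdegree (u j)" by (rule subdegreeI)
  moreover have "sum u J \<noteq> 0" using nz by auto
  ultimately show ?thesis using j by blast
qed

lemma coprime_orders_inj:
  fixes n s :: nat
  assumes "n * x + s * j = n * y + s * k" "coprime n s" "j < n" "k < n"
  shows "j = k"
proof -
  have *: "j = k" if "n * x + s * j = n * y + s * k" "j \<le> k" "k < n" for j k x y
  proof -
    have "s * j \<le> s * k" using that(2) by simp
    then have "s * (k - j) + n * y = n * x" using that(1) unfolding diff_mult_distrib2 by linarith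
    then have "n dvd s * (k - j) + n * y" by simp
    then have "n dvd s * (k - j)" by (simp add: dvd_add_left_iff)
    then have "n dvd k - j" using assms(2) by (simp add: coprime_dvd_mult_right_iff)
    moreover have "k - j < n" using that(3) by simp
    ultimately have "k - j = 0" using dvd_imp_le[of n "k - j"] by linarith
    then show ?thesis using that(2) by simp
  qed
  show ?thesis
  proof (cases "j \<le> k")
    case True
    then show ?thesis using *[of x j y k] assms by blast
  next
    case False
    then show ?thesis using *[of y k x j] assms by simp
  qed
qed

text \<open>Modulo \<open>f\<close> every series is a combination of (y - \<phi>)^j with j < n and
  coefficients r_j(x). Along the arc these terms have orders n ord(r_j) + s j, pairwise distinct
  because s is prime to n and j < n. Hence no cancellation occurs: the pull-back vanishes only if
  all r_j do, and its order lies in the semigroup of n and s.\<close>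

lemma parametrization_coprime:
  fixes f :: cps and \<phi> \<eta> :: "complex fps"
  assumes n: "n > 0" and cop: "coprime n s" "s > 0"
    and \<phi>: "conv \<phi>" "\<phi> $ 0 = 0" and \<eta>: "conv \<eta>" "\<eta> \<noteq> 0" "subdegree \<eta> = s"
    and reg: "\<And>j. j < n \<Longrightarrow> bicoeff (fps_of_cps f) 0 j = 0" "bicoeff (fps_of_cps f) 0 n \<noteq> 0"
    and root: "arc (fps_of_cps f) (fps_X ^ n) (ram n \<phi> + \<eta>) = 0"
    and conductor: "\<And>h. conv h \<Longrightarrow> (\<And>i. i < c \<Longrightarrow> h $ i = 0) \<Longrightarrow>
      \<exists>G. biconvergent G \<and> arc G (fps_X ^ n) (ram n \<phi> + \<eta>) = h"
  shows "parametrization f (fps_X ^ n) (ram n \<phi> + \<eta>) c"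
    and "parametrization.orders (fps_X ^ n) (ram n \<phi> + \<eta>) = {n * i + s * j | i j. True}"
proof -
  let ?a = "fps_X ^ n :: complex fps" and ?b = "ram n \<phi> + \<eta>"
  have a0: "?a $ 0 = 0" using n by simp
  have eta0: "\<eta> $ 0 = 0" by (rule nth_less_subdegree_zero) (use \<eta>(3) cop(2) in simp)
  have b0: "?b $ 0 = 0" using n \<phi>(2) eta0 by simp
  have Y: "arc (fps_X - fps_const \<phi>) ?a ?b = \<eta>"
    using arc_const_Xpow[OF n b0] by (simp add: arc_diff[OF a0 b0] arc_Y[OF a0 b0])
  have red: "\<exists>Q r. biconvergent Q \<and> G = Q * fps_of_cps f + (\<Sum>j<n. fps_const (r j) * (fps_X - fps_const \<phi>) ^ j)
      \<and> arc G ?a ?b = (\<Sum>j<n. ram n (r j) * \<eta> ^ j)" if G: "biconvergent G" for G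
  proof -
    obtain Q r where Q: "biconvergent Q"
      "G = Q * fps_of_cps f + (\<Sum>j<n. fps_const (r j) * (fps_X - fps_const \<phi>) ^ j)"
      using weierstrass_division_shifted[OF biconvergent_fps_of_cps reg G \<phi>(1)] by blast
    have "arc G ?a ?b = (\<Sum>j<n. ram n (r j) * \<eta> ^ j)"
      by (subst Q(2)) (simp add: arc_add[OF a0 b0] arc_mult[OF a0 b0] root arc_sum[OF a0 b0]
          arc_power[OF a0 b0] arc_const_Xpow[OF n b0] Y)
    with Q show ?thesis by blast
  qed
  have ord: "(\<Sum>j<n. ram n (r j) * \<eta> ^ j) \<noteq> 0 \<and>
      (\<exists>j<n. subdegree (\<Sum>j<n. ram n (r j) * \<eta> ^ j) = n * subdegree (r j) + s * j)"
    if "\<exists>j<n. r j \<noteq> 0" for r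
  proof -
    have nz: "ram n (r j) * \<eta> ^ j \<noteq> 0 \<longleftrightarrow> r j \<noteq> 0" for j
      using \<eta>(2) by (simp add: ram_eq_0_iff[OF n])
    have sd: "subdegree (ram n (r j) * \<eta> ^ j) = n * subdegree (r j) + s * j" if "r j \<noteq> 0" for j
      using that \<eta> by (simp add: ram_eq_0_iff[OF n] subdegree_ram[OF n] mult.commute)
    have "(\<Sum>j<n. ram n (r j) * \<eta> ^ j) \<noteq> 0 \<and> (\<exists>j\<in>{..<n}. ram n (r j) * \<eta> ^ j \<noteq> 0 \<and>
      subdegree (\<Sum>j<n. ram n (r j) * \<eta> ^ j) = subdegree (ram n (r j) * \<eta> ^ j))"
    proof (rule sum_distinct_orders)
      show "\<exists>j\<in>{..<n}. ram n (r j) * \<eta> ^ j \<noteq> 0" using that unfolding nz by blast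
      fix j k assume jk: "j \<in> {..<n}" "k \<in> {..<n}" "ram n (r j) * \<eta> ^ j \<noteq> 0" "ram n (r k) * \<eta> ^ k \<noteq> 0"
        and eq: "subdegree (ram n (r j) * \<eta> ^ j) = subdegree (ram n (r k) * \<eta> ^ k)"
      have "n * subdegree (r j) + s * j = n * subdegree (r k) + s * k"
        using eq sd[of j] sd[of k] jk(3,4) unfolding nz by simp
      then show "j = k" by (rule coprime_orders_inj[OF _ cop(1)]) (use jk in auto)
    qed simp
    then obtain j where "j < n" "r j \<noteq> 0" and
      "subdegree (\<Sum>j<n. ram n (r j) * \<eta> ^ j) = subdegree (ram n (r j) * \<eta> ^ j)"
      and "(\<Sum>j<n. ram n (r j) * \<eta> ^ j) \<noteq> 0" unfolding nz by blast
    then show ?thesis using sd[of j] by auto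
  qed
  show par: "parametrization f ?a ?b c"
  proof
    show "conv ?a" "conv ?b" using \<phi> \<eta> n by (auto intro!: conv_intros conv_ram)
    fix g
    show "arc (fps_of_cps g) ?a ?b = 0 \<longleftrightarrow> f dvd g"
    proof
      assume z: "arc (fps_of_cps g) ?a ?b = 0"
      obtain Q r where Q: "biconvergent Q"
        "fps_of_cps g = Q * fps_of_cps f + (\<Sum>j<n. fps_const (r j) * (fps_X - fps_const \<phi>) ^ j)"
        "arc (fps_of_cps g) ?a ?b = (\<Sum>j<n. ram n (r j) * \<eta> ^ j)"
        using red[OF biconvergent_fps_of_cps] by blast
      have "r j = 0" if "j < n" for j using ord[of r] z Q(3) that by metis
      then have "fps_of_cps g = Q * fps_of_cps f" using Q(2) by simp
      then show "f dvd g" using Q(1) by (auto simp: cps_dvd_iff)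
    next
      assume "f dvd g"
      then obtain H where "fps_of_cps g = H * fps_of_cps f" by (auto simp: cps_dvd_iff)
      then show "arc (fps_of_cps g) ?a ?b = 0" by (simp add: arc_mult[OF a0 b0] root)
    qed
  next
    fix h assume "conv h" "\<And>i. i < c \<Longrightarrow> h $ i = 0"
    then obtain G where "biconvergent G" "arc G ?a ?b = h" using conductor by blast
    then show "\<exists>g. arc (fps_of_cps g) ?a ?b = h"
      by (intro exI[of _ "Abs_cps G"]) (simp add: fps_of_cps_Abs)
  qed (use a0 b0 in auto)
  interpret parametrization f ?a ?b c by (rule par)
  show "parametrization.orders ?a ?b = {n * i + s * j | i j. True}"
  proof (intro equalityI subsetI)
    fix k assume "k \<in> orders"
    then obtain g where g: "pull g \<noteq> 0" "k = subdegree (pull g)" by (auto simp: orders_def)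
    obtain r where r: "pull g = (\<Sum>j<n. ram n (r j) * \<eta> ^ j)"
      using red[OF biconvergent_fps_of_cps, of g] unfolding pull_def by blast
    have "\<exists>j<n. r j \<noteq> 0"
    proof (rule ccontr)
      assume "\<not> ?thesis"
      then have "pull g = 0" unfolding r by (intro sum.neutral) (simp add: ram_0[OF n])
      then show False using g by simp
    qed
    then show "k \<in> {n * i + s * j | i j. True}" using ord[of r] g(2) r by auto
  next
    fix k assume "k \<in> {n * i + s * j | i j. True}"
    then obtain i j where k: "k = n * i + s * j" by blast
    let ?G = "bi_X ^ i * (fps_X - fps_const \<phi>) ^ j"
    have "biconvergent ?G" using \<phi> by (intro biconv_intros) auto
    then have "pull (Abs_cps ?G) = arc ?G ?a ?b" by (simp add: pull_def fps_of_cps_Abs)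
    also have "\<dots> = fps_X ^ (n * i) * \<eta> ^ j"
      by (simp add: arc_mult[OF a0 b0] arc_power[OF a0 b0] Y arc_const_Xpow[OF n b0] ram_power[OF n] ram_X[OF n] power_mult)
    finally have "pull (Abs_cps ?G) = fps_X ^ (n * i) * \<eta> ^ j" .
    then have "subdegree (pull (Abs_cps ?G)) = k" "pull (Abs_cps ?G) \<noteq> 0"
      using \<eta> by (simp_all add: k mult.commute)
    then show "k \<in> orders" unfolding orders_def by blast
  qed
qed

lemma section_split_2:
  assumes "odd s" and "\<And>i. odd i \<Longrightarrow> i < s \<Longrightarrow> h $ i = 0"
  shows "h = ram 2 (fps_section 2 0 h) + fps_X ^ s * ram 2 (fps_section 2 s h)"
proof (rule fps_ext)
  fix i
  show "h $ i = (ram 2 (fps_section 2 0 h) + fps_X ^ s * ram 2 (fps_section 2 s h)) $ i"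
  proof (cases "even i")
    case True
    then have "i < s \<or> odd (i - s)" using assms(1) by (cases "i < s") auto
    then show ?thesis using True by (auto simp: fps_X_power_mult_nth ram_nth fps_section_def)
  next
    case False
    show ?thesis
    proof (cases "i < s")
      case True
      then show ?thesis using False assms(2)[of i] by (simp add: fps_X_power_mult_nth ram_nth)
    next
      case ge: False
      then have "even (i - s)" using False assms(1) by simp
      then show ?thesis using ge False by (simp add: fps_X_power_mult_nth ram_nth fps_section_def)
    qed
  qed
qed

text \<open>As 3 does not divide \<open>s\<close>, the numbers 0, s and 2s represent all residue
  classes. The hypotheses say that no coefficient of the latter two classes lies below its starting
  exponent.\<close>

lemma section_split_3:
  assumes s: "\<not> 3 dvd s" and h: "\<And>i. i mod 3 = s mod 3 \<Longrightarrow> i < s \<Longrightarrow> h $ i = 0"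
    "\<And>i. i mod 3 = 2 * s mod 3 \<Longrightarrow> i < 2 * s \<Longrightarrow> h $ i = 0"
  shows "h = ram 3 (fps_section 3 0 h) + fps_X ^ s * ram 3 (fps_section 3 s h)
    + fps_X ^ (2 * s) * ram 3 (fps_section 3 (2 * s) h)"
proof (rule fps_ext)
  fix i
  have term_nth: "(fps_X ^ k * ram 3 (fps_section 3 k h)) $ i = (if i mod 3 = k mod 3 then h $ i else 0)"
    if "i mod 3 = k mod 3 \<Longrightarrow> i < k \<Longrightarrow> h $ i = 0" for k
  proof (cases "i < k")
    case True
    then show ?thesis using that by (simp add: fps_X_power_mult_nth)
  next
    case False
    then have "3 dvd i - k \<longleftrightarrow> i mod 3 = k mod 3" by (metis mod_eq_dvd_iff_nat not_less)
    moreover have "3 * ((i - k) div 3) + k = i" if "3 dvd i - k" using that False by simp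
    ultimately show ?thesis using False by (auto simp: fps_X_power_mult_nth ram_nth fps_section_def)
  qed
  have 0: "ram 3 (fps_section 3 0 h) $ i = (if i mod 3 = 0 then h $ i else 0)"
    using term_nth[of 0] by simp
  have "s mod 3 = 1 \<and> 2 * s mod 3 = 2 \<or> s mod 3 = 2 \<and> 2 * s mod 3 = 1"
    using s by presburger
  moreover have "i mod 3 = 0 \<or> i mod 3 = 1 \<or> i mod 3 = 2" by presburger
  moreover have 1: "(fps_X ^ s * ram 3 (fps_section 3 s h)) $ i = (if i mod 3 = s mod 3 then h $ i else 0)"
    by (rule term_nth[OF h(1)])
  moreover have 2: "(fps_X ^ (2 * s) * ram 3 (fps_section 3 (2 * s) h)) $ i =
      (if i mod 3 = 2 * s mod 3 then h $ i else 0)"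
    by (rule term_nth[OF h(2)])
  ultimately show "h $ i = (ram 3 (fps_section 3 0 h) + fps_X ^ s * ram 3 (fps_section 3 s h)
    + fps_X ^ (2 * s) * ram 3 (fps_section 3 (2 * s) h)) $ i"
    unfolding fps_add_nth 0 by (elim disjE conjE) simp_all
qed

lemma arc_0_X_nth: "arc F 0 fps_X $ j = bicoeff F 0 j"
proof -
  have "arc F 0 fps_X $ j = (\<Sum>i\<le>j. \<Sum>l\<le>j. if i = 0 \<and> l = j then bicoeff F 0 j else 0)"
    by (auto simp: arc_def power_0_left fps_X_power_nth intro!: sum.cong)
  also have "\<dots> = (\<Sum>i\<le>j. if i = 0 then bicoeff F 0 j else 0)"
    by (intro sum.cong refl) (simp add: sum.delta)
  also have "\<dots> = bicoeff F 0 j" by (simp add: sum.delta)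
  finally show ?thesis .
qed

lemma parametrization_line:
  assumes D: "fps_of_cps D = fps_X - fps_const \<alpha>" and \<alpha>: "conv \<alpha>" "\<alpha> $ 0 = 0"
  shows "parametrization D fps_X \<alpha> 0" and "parametrization.orders fps_X \<alpha> = UNIV"
proof -
  \<comment> \<open>The general result requires a summand of positive order prime to
    \<open>n\<close>; with n = s = 1 this summand is taken to be t, and \<alpha> is split
    accordingly.\<close>
  have eq: "ram 1 (\<alpha> - fps_X) + fps_X = \<alpha>" unfolding ram_1_left by simp
  have red: "arc (fps_of_cps D) (fps_X ^ 1) (ram 1 (\<alpha> - fps_X) + fps_X) = 0"
    unfolding eq D using \<alpha>(2) by (simp add: arc_diff arc_Y arc_const)
  have reg: "bicoeff (fps_of_cps D) 0 j = 0" if "j < 1" for j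
    using that \<alpha>(2) by (simp add: D bicoeff_simps)
  have reg1: "bicoeff (fps_of_cps D) 0 1 \<noteq> 0" by (simp add: D bicoeff_simps)
  have cond: "\<exists>G. biconvergent G \<and> arc G (fps_X ^ 1) (ram 1 (\<alpha> - fps_X) + fps_X) = h" if "conv h" for h
    using that \<alpha>(2) unfolding eq
    by (intro exI[of _ "fps_const h"]) (simp add: biconvergent_fps_const arc_const)
  have c: "conv (\<alpha> - fps_X)" "(\<alpha> - fps_X) $ 0 = 0" using \<alpha> by (auto intro: conv_intros)
  note p = parametrization_coprime[where n = 1 and s = 1 and c = 0 and \<eta> = fps_X and \<phi> = "\<alpha> - fps_X" and f = D,
      OF _ _ _ c conv_X _ _ reg reg1 red cond]
  show "parametrization D fps_X \<alpha> 0" using p(1) unfolding eq by simp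
  have "x \<in> {1 * i + 1 * j | i j. True}" for x :: nat
    by (intro CollectI exI[of _ x] exI[of _ 0]) simp
  moreover have "parametrization.orders fps_X \<alpha> = {1 * i + 1 * j | i j. True}"
    by (rule p(2)[unfolded eq power_one_right]) simp_all
  ultimately show "parametrization.orders fps_X \<alpha> = UNIV" by blast
qed

text \<open>With x = t^2 the two half-integral branches become one series whose odd part starts at
  t^k. A series of order at least k is h0(t^2) + t^k h1(t^2), and this is the pull-back of h0 + (h1
  / d) (y - \<phi>).\<close>

lemma parametrization_double:
  assumes D: "fps_of_cps D = (fps_X - fps_const \<phi>) ^ 2 - fps_const (fps_X ^ k * d ^ 2)"
    and \<phi>: "conv \<phi>" "\<phi> $ 0 = 0" and d: "conv d" "d $ 0 \<noteq> 0" and k: "odd k"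
  defines "b \<equiv> ram 2 \<phi> + fps_X ^ k * ram 2 d"
  shows "parametrization D (fps_X ^ 2) b k"
    and "parametrization.orders (fps_X ^ 2) b = {2 * i + k * j | i j. True}"
proof -
  have two: "(2::nat) > 0" by simp
  have k0: "k > 0" using k by (cases k) auto
  have b0: "b $ 0 = 0" using \<phi> k0 by (simp add: b_def)
  have a0: "(fps_X ^ 2 :: complex fps) $ 0 = 0" by simp
  let ?\<eta> = "fps_X ^ k * ram 2 d"
  have rd: "ram 2 d $ 0 \<noteq> 0" using d by simp
  have "d \<noteq> 0" using d(2) by auto
  then have rd': "ram 2 d \<noteq> 0" by (simp add: ram_eq_0_iff)
  have \<eta>: "conv ?\<eta>" "?\<eta> \<noteq> 0" "subdegree ?\<eta> = k"
    using d rd rd' by (auto intro!: conv_intros conv_ram simp: subdegree_eq_0_iff)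
  have red: "arc (fps_of_cps D) (fps_X ^ 2) (ram 2 \<phi> + ?\<eta>) = 0"
    using a0 b0 unfolding D b_def[symmetric]
    by (simp add: arc_diff arc_power arc_Y arc_const_Xpow ram_mult ram_power ram_X)
      (simp add: b_def power_mult_distrib power_mult[symmetric] mult.commute)
  have arcD: "arc (fps_of_cps D) 0 fps_X = fps_X ^ 2"
    using \<phi>(2) k0 by (simp add: D arc_diff arc_power arc_Y arc_const fps_compose_0_right)
  have reg: "bicoeff (fps_of_cps D) 0 j = 0" if "j < 2" for j
    using that unfolding arc_0_X_nth[symmetric] arcD by (simp add: fps_X_power_nth)
  have reg2: "bicoeff (fps_of_cps D) 0 2 \<noteq> 0"
    unfolding arc_0_X_nth[symmetric] arcD by (simp add: fps_X_power_nth)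
  have cond: "\<exists>G. biconvergent G \<and> arc G (fps_X ^ 2) (ram 2 \<phi> + ?\<eta>) = h"
    if "conv h" "\<And>i. i < k \<Longrightarrow> h $ i = 0" for h
  proof -
    define h0 where "h0 = fps_section 2 0 h"
    define h1 where "h1 = fps_section 2 k h"
    have h: "h = ram 2 h0 + fps_X ^ k * ram 2 h1"
      unfolding h0_def h1_def using k that by (intro section_split_2)
    have ch: "conv h0" "conv h1" unfolding h0_def h1_def by (intro conv_section that)+
    define r where "r = h1 * inverse d"
    have r: "r * d = h1" "conv r"
      using d ch by (auto simp: r_def mult.assoc inverse_mult_eq_1 intro!: conv_intros)
    let ?G = "fps_const h0 + fps_const r * (fps_X - fps_const \<phi>)"
    have "biconvergent ?G" using ch r \<phi> by (intro biconv_intros) auto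
    moreover have "arc ?G (fps_X ^ 2) b = h"
      using a0 b0 unfolding h r(1)[symmetric]
      by (simp add: arc_add arc_mult arc_diff arc_Y arc_const_Xpow ram_mult) (simp add: b_def)
    ultimately show ?thesis unfolding b_def by blast
  qed
  have "coprime 2 k" using k by simp
  note p = parametrization_coprime[OF two this k0 \<phi> \<eta> reg reg2 red cond, folded b_def]
  show "parametrization D (fps_X ^ 2) b k" by (rule p(1))
  show "parametrization.orders (fps_X ^ 2) b = {2 * i + k * j | i j. True}" by (rule p(2))
qed

section \<open>The cubic branch along its parametrization\<close>

lemma fps_const_numeral: "fps_const (numeral k) = numeral k"
  by (simp add: numeral_fps_const)

lemma power3_diff_rescaled:
  fixes a :: "'a::comm_ring_1"
  assumes "a * t ^ 3 = v ^ 3"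
  shows "(A ^ 3 - a * B ^ 3) * t ^ 3 = (t * A) ^ 3 - (v * B) ^ 3"
proof -
  have "(A ^ 3 - a * B ^ 3) * t ^ 3 = (t * A) ^ 3 - (a * t ^ 3) * B ^ 3"
    by (simp add: power_mult_distrib algebra_simps)
  then show ?thesis by (simp only: assms power_mult_distrib)
qed

text \<open>
  Cramer's rule for the coordinates of \<open>\<tau>\<^sup>3 (h\<^sub>0 + \<tau> h\<^sub>1 + \<tau>\<^sup>2 h\<^sub>2)\<close> with respect to the powers of
  \<open>U + V\<close>, separated according to residue classes of exponents modulo 3.
\<close>

lemma cubic_coordinates:
  fixes U V \<tau> :: "'a::comm_ring_1"
  assumes U: "U = \<tau> * A" and V: "\<mu> * B = \<tau> * V" and \<nu>: "\<nu> * \<tau> ^ 3 = U ^ 3 - V ^ 3" and i: "i * \<nu> = 1"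
    and r1: "r1 = (\<tau> ^ 3 * h1 * A ^ 2 - \<mu> ^ 2 * h2 * B ^ 2) * i"
    and r2: "r2 = (\<tau> ^ 3 * h2 * A - \<mu> * h1 * B) * i"
    and r0: "r0 = \<tau> ^ 3 * h0 - 2 * r2 * (\<mu> * A * B)"
  shows "r0 + r1 * (U + V) + r2 * (U + V) ^ 2 = \<tau> ^ 3 * (h0 + \<tau> * h1 + \<tau> ^ 2 * h2)"
proof -
  have "\<mu> * A * B = A * (\<mu> * B)" by (simp add: mult_ac)
  also have "\<dots> = U * V" unfolding V U by (simp only: mult_ac)
  finally have r0': "r0 = \<tau> ^ 3 * h0 - 2 * r2 * (U * V)" by (simp add: r0)
  have "\<tau> ^ 3 * h1 * A ^ 2 - \<mu> ^ 2 * h2 * B ^ 2 = \<tau> * h1 * U ^ 2 - (\<mu> * B) ^ 2 * h2"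
    by (simp add: U power2_eq_square power3_eq_cube algebra_simps)
  then have r1': "r1 = (\<tau> * h1 * U ^ 2 - \<tau> ^ 2 * V ^ 2 * h2) * i"
    by (simp add: r1 V power_mult_distrib)
  have "\<tau> ^ 3 * h2 * A - \<mu> * h1 * B = \<tau> ^ 2 * h2 * U - (\<mu> * B) * h1"
    by (simp add: U power2_eq_square power3_eq_cube algebra_simps)
  then have r2': "r2 = (\<tau> ^ 2 * h2 * U - \<tau> * V * h1) * i" by (simp add: r2 V)
  have "r0 + r1 * (U + V) + r2 * (U + V) ^ 2 =
      \<tau> ^ 3 * h0 + (r1 * U + r2 * V ^ 2) + (r1 * V + r2 * U ^ 2)"
    by (simp add: r0' power2_eq_square algebra_simps)
  also have "r1 * U + r2 * V ^ 2 = \<tau> * h1 * i * (U ^ 3 - V ^ 3)"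
    unfolding r1' r2' by (simp add: power2_eq_square power3_eq_cube algebra_simps)
  also have "r1 * V + r2 * U ^ 2 = \<tau> ^ 2 * h2 * i * (U ^ 3 - V ^ 3)"
    unfolding r1' r2' by (simp add: power2_eq_square power3_eq_cube algebra_simps)
  also have "\<tau> ^ 3 * h0 + \<tau> * h1 * i * (U ^ 3 - V ^ 3) + \<tau> ^ 2 * h2 * i * (U ^ 3 - V ^ 3) =
      \<tau> ^ 3 * (h0 + (i * \<nu>) * (\<tau> * h1 + \<tau> ^ 2 * h2))"
    unfolding \<nu>[symmetric] by (simp add: algebra_simps)
  finally show ?thesis by (simp add: i add.assoc)
qed

context cubic_branch
begin

definition "U = fps_X ^ s * ram 3 A"
definition "V = fps_X ^ (3 * m - s) * ram 3 B"
definition "y = ram 3 \<sigma> + (U + V)"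

lemma orders_bounds: "2 * m > s" "3 * m - s > s" "m \<ge> 3"
  using ms s by linarith+

lemma ram_Xpow: "ram 3 (fps_X ^ k) = fps_X ^ (3 * k)"
  by (simp add: ram_power ram_X power_mult)

lemma UV: "3 * U * V = - ram 3 (fps_X ^ m * p1)"
proof -
  have "3 * U * V = (fps_X ^ s * fps_X ^ (3 * m - s)) * ram 3 (3 * A * B)"
    unfolding U_def V_def by (simp add: ram_mult ram_numeral mult_ac)
  also have "fps_X ^ s * fps_X ^ (3 * m - s) = (fps_X ^ (3 * m) :: complex fps)"
    using orders_bounds by (simp flip: power_add)
  finally show ?thesis by (simp add: AB ram_mult ram_uminus ram_Xpow)
qed

lemma U3V3: "U ^ 3 + V ^ 3 = - ram 3 (fps_X ^ s * q1)"
proof -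
  have "U ^ 3 = fps_X ^ (3 * s) * ram 3 (A ^ 3)"
    by (simp add: U_def power_mult_distrib ram_power mult.commute flip: power_mult)
  moreover have "V ^ 3 = fps_X ^ (3 * s) * ram 3 (fps_X ^ (3 * m - 2 * s) * B ^ 3)"
  proof -
    have "(3 * m - s) * 3 = 3 * s + 3 * (3 * m - 2 * s)" using ms by simp
    then show ?thesis
      by (simp add: V_def power_mult_distrib ram_mult ram_power ram_X mult.assoc
          flip: power_mult power_add)
  qed
  ultimately have "U ^ 3 + V ^ 3 = fps_X ^ (3 * s) * ram 3 (A ^ 3 + fps_X ^ (3 * m - 2 * s) * B ^ 3)"
    by (simp add: ram_add distrib_left)
  then show ?thesis by (simp add: AB ram_mult ram_uminus ram_Xpow)
qed

lemma conv_UV: "conv U" "conv V" "conv y"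
  unfolding U_def V_def y_def using A B sigma by (auto intro!: conv_intros conv_ram)

lemma UV_nth: "i < s \<Longrightarrow> U $ i = 0" "i < 3 * m - s \<Longrightarrow> V $ i = 0" "U $ s = A $ 0"
  by (simp_all add: U_def V_def fps_X_power_mult_nth)

lemma subdegree_UV: "subdegree (U + V) = s" "U + V \<noteq> 0"
proof -
  have "(U + V) $ s \<noteq> 0" using UV_nth orders_bounds A by simp
  moreover have "(U + V) $ i = 0" if "i < s" for i using that UV_nth orders_bounds by simp
  ultimately show "subdegree (U + V) = s" by (rule subdegreeI)
  show "U + V \<noteq> 0" using \<open>(U + V) $ s \<noteq> 0\<close> by (metis fps_zero_nth)
qed

lemma y_nth_0: "y $ 0 = 0"
  using sigma s UV_nth(1,2)[of 0] orders_bounds by (simp add: y_def)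

lemma arc_f:
  assumes "a $ 0 = 0" "b $ 0 = 0"
  defines "\<eta> \<equiv> b - fps_compose \<sigma> a"
  shows "arc (fps_of_cps f) a b = arc W a b * (\<eta> ^ 3 + fps_compose (fps_X ^ m * p1) a * \<eta>
    + fps_compose (fps_X ^ s * q1) a)"
  using assms unfolding f_eq
  by (simp add: arc_mult arc_add arc_diff arc_power arc_Y arc_const)

lemma root_y: "arc (fps_of_cps f) (fps_X ^ 3) y = 0"
proof -
  have "(U + V) ^ 3 + ram 3 (fps_X ^ m * p1) * (U + V) + ram 3 (fps_X ^ s * q1) = 0"
    by (rule cardano_identity[OF UV U3V3])
  then show ?thesis
    using arc_f[of "fps_X ^ 3" y] y_nth_0 by (simp add: y_def ram_def)
qed

lemma regular: "j < 3 \<Longrightarrow> bicoeff (fps_of_cps f) 0 j = 0" "bicoeff (fps_of_cps f) 0 3 \<noteq> 0"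
proof -
  have "arc (fps_of_cps f) 0 fps_X = arc W 0 fps_X * fps_X ^ 3"
    using arc_f[of 0 fps_X] sigma s orders_bounds by (simp add: fps_compose_0_right)
  then have *: "bicoeff (fps_of_cps f) 0 j = (arc W 0 fps_X * fps_X ^ 3) $ j" for j
    by (simp flip: arc_0_X_nth)
  show "bicoeff (fps_of_cps f) 0 j = 0" if "j < 3"
    using that unfolding * by (simp add: fps_X_power_mult_right_nth)
  show "bicoeff (fps_of_cps f) 0 3 \<noteq> 0"
    unfolding * using W(2) by (simp add: fps_X_power_mult_right_nth arc_0_X_nth)
qed

text \<open>Finding coordinates with respect to 1, U + V, (U + V)^2 is a linear problem with
  determinant U^3 - V^3 of order 3s. The bound 5s is 3s, which absorbs this determinant, plus 2s,
  which makes the splitting into residue classes starting at 0, s, 2s possible.\<close>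

lemma conductor_y:
  assumes h: "conv h" "\<And>i. i < 5 * s \<Longrightarrow> h $ i = 0"
  shows "\<exists>G. biconvergent G \<and> arc G (fps_X ^ 3) y = h"
proof -
  define g where "g = fps_shift (3 * s) h"
  have h_eq: "h = fps_X ^ (3 * s) * g"
    unfolding g_def by (rule fps_ext) (use h(2) in \<open>simp add: fps_X_power_mult_nth\<close>)
  define h0 where "h0 = fps_section 3 0 g"
  define h1 where "h1 = fps_section 3 s g"
  define h2 where "h2 = fps_section 3 (2 * s) g"
  have g_eq: "g = ram 3 h0 + fps_X ^ s * ram 3 h1 + fps_X ^ (2 * s) * ram 3 h2"
    unfolding h0_def h1_def h2_def using s(2) h(2) by (intro section_split_3) (simp_all add: g_def)
  have "conv g" unfolding g_def using h(1) by simp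
  then have ch: "conv h0" "conv h1" "conv h2" unfolding h0_def h1_def h2_def by (simp_all only: conv_section)
  \<comment> \<open>This is the unit part of the determinant: U^3 - V^3 equals t^(3s) \<nu>(t^3),
    and \<nu>(0) = A(0)^3 since 3m > 2s.\<close>
  define \<nu> where "\<nu> = A ^ 3 - fps_X ^ (3 * m - 2 * s) * B ^ 3"
  have \<nu>: "conv \<nu>" "\<nu> $ 0 \<noteq> 0"
    using A B ms by (auto simp: \<nu>_def fps_power_zeroth power_0_left intro!: conv_intros)
  define i where "i = inverse \<nu>"
  have i: "conv i" "i * \<nu> = 1" using \<nu> by (auto simp: i_def inverse_mult_eq_1 intro!: conv_intros)
  define r1 where "r1 = (fps_X ^ s * h1 * A ^ 2 - fps_X ^ (2 * m) * h2 * B ^ 2) * i"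
  define r2 where "r2 = (fps_X ^ s * h2 * A - fps_X ^ m * h1 * B) * i"
  define r0 where "r0 = fps_X ^ s * h0 - 2 * r2 * (fps_X ^ m * A * B)"
  have cr: "conv r0" "conv r1" "conv r2"
    unfolding r0_def r1_def r2_def using ch i A B
    by (auto intro!: conv_intros simp flip: fps_const_numeral)
  let ?t = "fps_X :: complex fps" and ?r = "ram 3"
  let ?\<tau> = "?t ^ s" and ?\<mu> = "?t ^ (3 * m)"
  have e1: "U = ?\<tau> * ?r A" by (simp add: U_def)
  have e2: "?\<mu> * ?r B = ?\<tau> * V"
    using orders_bounds unfolding V_def mult.assoc[symmetric] by (simp flip: power_add)
  have e3: "?r (fps_X ^ s) = ?\<tau> ^ 3" by (simp add: ram_Xpow mult.commute flip: power_mult)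
  have e4: "?r (fps_X ^ m) = ?\<mu>" by (rule ram_Xpow)
  have e5: "?r \<nu> * ?\<tau> ^ 3 = U ^ 3 - V ^ 3"
  proof -
    have "3 * (3 * m - 2 * s) + s * 3 = (3 * m - s) * 3" using ms by simp
    then have "?t ^ (3 * (3 * m - 2 * s)) * ?\<tau> ^ 3 = (?t ^ (3 * m - s)) ^ 3"
      by (simp flip: power_mult power_add)
    then have "(?r A ^ 3 - ?t ^ (3 * (3 * m - 2 * s)) * ?r B ^ 3) * ?\<tau> ^ 3 = U ^ 3 - V ^ 3"
      unfolding U_def V_def by (rule power3_diff_rescaled)
    moreover have "?r \<nu> = ?r A ^ 3 - ?t ^ (3 * (3 * m - 2 * s)) * ?r B ^ 3"
      by (simp only: \<nu>_def ram_diff ram_mult ram_power [of 3 A] ram_power [of 3 B] ram_Xpow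
          zero_less_numeral)
    ultimately show ?thesis by simp
  qed
  have e6: "?r i * ?r \<nu> = 1" using i(2) by (simp flip: ram_mult add: ram_1)
  have r1: "?r r1 = (?\<tau> ^ 3 * ?r h1 * ?r A ^ 2 - ?\<mu> ^ 2 * ?r h2 * ?r B ^ 2) * ?r i"
  proof -
    have "?r (fps_X ^ (2 * m)) = ?\<mu> ^ 2" by (simp add: ram_Xpow mult.commute flip: power_mult)
    then show ?thesis unfolding r1_def
      by (simp only: ram_mult ram_diff ram_power[of 3 A] ram_power[of 3 B] e3 zero_less_numeral)
  qed
  have r2: "?r r2 = (?\<tau> ^ 3 * ?r h2 * ?r A - ?\<mu> * ?r h1 * ?r B) * ?r i"
    unfolding r2_def by (simp only: ram_mult ram_diff e3 e4 zero_less_numeral)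
  have r0: "?r r0 = ?\<tau> ^ 3 * ?r h0 - 2 * ?r r2 * (?\<mu> * ?r A * ?r B)"
    unfolding r0_def by (simp only: ram_mult ram_diff ram_numeral e3 e4 zero_less_numeral)
  have "?r r0 + ?r r1 * (U + V) + ?r r2 * (U + V) ^ 2 = ?\<tau> ^ 3 * (?r h0 + ?\<tau> * ?r h1 + ?\<tau> ^ 2 * ?r h2)"
    by (rule cubic_coordinates[OF e1 e2 e5 e6 r1 r2 r0])
  then have key: "?r r0 + ?r r1 * (U + V) + ?r r2 * (U + V) ^ 2 = h"
    unfolding h_eq g_eq by (simp add: mult.commute flip: power_mult)
  let ?Y = "fps_X - fps_const \<sigma>"
  let ?G = "fps_const r0 + fps_const r1 * ?Y + fps_const r2 * ?Y ^ 2"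
  have "biconvergent ?G" using cr sigma by (intro biconv_intros) auto
  moreover have "arc ?G (fps_X ^ 3) y = h"
    using y_nth_0 unfolding key[symmetric]
    by (simp add: arc_add arc_mult arc_diff arc_power arc_Y arc_const_Xpow y_def)
  ultimately show ?thesis by blast
qed

lemma coprime_3_s: "coprime 3 s"
  using s(2) by (simp add: prime_imp_coprime)

lemmas parametrization_y = parametrization_coprime[OF _ coprime_3_s _ sigma _ subdegree_UV(2,1)
    regular root_y[unfolded y_def] conductor_y[unfolded y_def], folded y_def]

lemma parametrization: "parametrization f (fps_X ^ 3) y (5 * s)"
  by (rule parametrization_y(1)) (use s conv_UV in \<open>auto intro: conv_intros\<close>)

lemma value_semigroup: "value_semigroup f = {3 * i + s * j | i j. True}"
  unfolding parametrization.value_semigroup_eq[OF parametrization]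
  by (rule parametrization_y(2)) (use s conv_UV in \<open>auto intro: conv_intros\<close>)

end

lemma generated_semigroup_two:
  assumes "k < l"
  shows "generated_semigroup (set [k, l]) = {k * i + l * j | i j. True}"
proof (intro equalityI subsetI)
  fix x assume "x \<in> generated_semigroup (set [k, l])"
  then obtain c where "x = (\<Sum>z\<in>set [k, l]. c z * z)" by (auto simp: generated_semigroup_def)
  then have "x = k * c k + l * c l" using assms by (simp add: mult.commute)
  then show "x \<in> {k * i + l * j | i j. True}" by blast
next
  fix x assume "x \<in> {k * i + l * j | i j. True}"
  then obtain i j where "x = k * i + l * j" by blast
  then show "x \<in> generated_semigroup (set [k, l])"
    using assms unfolding generated_semigroup_def
    by (intro CollectI exI[of _ "\<lambda>z. if z = k then i else j"]) (simp add: mult.commute)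
qed

text \<open>Each of \<open>s\<close> and \<open>s1\<close> lies in the semigroup generated by 3 and
  the other. Neither is divisible by 3, so each uses the other at least once and is at least as
  large.\<close>

lemma (in cubic_branch) semigroup_generator_eq:
  assumes "has_semigroup f [3, s1]"
  shows "s1 = s"
proof -
  have lt: "3 < s1" and eq: "value_semigroup f = generated_semigroup (set [3, s1])"
    using assms by (auto simp: has_semigroup_def)
  have eq: "{3 * i + s * j | i j. True} = {3 * i + s1 * j | i j. True}"
    using eq value_semigroup generated_semigroup_two[OF lt] by simp
  have "s \<in> {3 * i + s * j | i j. True}" by (intro CollectI exI[of _ 0] exI[of _ 1]) simp
  then obtain i j where ij: "s = 3 * i + s1 * j" unfolding eq by blast
  have "s1 \<in> {3 * i + s1 * j | i j. True}" by (intro CollectI exI[of _ 0] exI[of _ 1]) simp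
  then obtain i' j' where ij': "s1 = 3 * i' + s * j'" unfolding eq[symmetric] by blast
  have "j > 0" using ij s(2) by (cases j) auto
  then have "s1 \<le> s" using ij by (cases j) auto
  have "\<not> 3 dvd s1" using ij s(2) by (metis dvd_add dvd_mult2 dvd_triv_left)
  then have "j' > 0" using ij' by (cases j') auto
  then have "s \<le> s1" using ij' by (cases j') auto
  with \<open>s1 \<le> s\<close> show ?thesis by simp
qed

section \<open>The Zariski invariant\<close>

lemma fps_X_deriv_nth: "(fps_X * fps_deriv a) $ n = of_nat n * a $ n" for a :: "complex fps"
  by (cases n) simp_all

text \<open>The Euler operator t d/dt multiplies each monomial by its exponent, so it preserves
  residue classes of exponents. This is why forms are multiplied by t before their values are
  compared.\<close>

lemma fps_X_deriv_ram:
  "fps_X * fps_deriv (fps_X ^ k * ram 3 a) = fps_X ^ k * ram 3 (of_nat k * a + 3 * (fps_X * fps_deriv a))"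
proof (rule fps_ext)
  fix n
  have nth: "(of_nat k * a + 3 * (fps_X * fps_deriv a)) $ j = of_nat (k + 3 * j) * a $ j" for j
  proof -
    have "of_nat k * a = fps_const (of_nat k) * a" "3 * (fps_X * fps_deriv a) = fps_const 3 * (fps_X * fps_deriv a)"
      by (simp_all add: fps_of_nat fps_const_numeral)
    then show ?thesis
      by (simp only: fps_add_nth fps_mult_left_const_nth fps_X_deriv_nth of_nat_add of_nat_mult
          of_nat_numeral distrib_right mult.assoc)
  qed
  show "(fps_X * fps_deriv (fps_X ^ k * ram 3 a)) $ n =
    (fps_X ^ k * ram 3 (of_nat k * a + 3 * (fps_X * fps_deriv a))) $ n"
  proof (cases "n < k")
    case True
    then show ?thesis by (simp only: fps_X_deriv_nth fps_X_power_mult_nth) simp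
  next
    case False
    show ?thesis
    proof (cases "3 dvd n - k")
      case True
      then obtain j where "n - k = 3 * j" by (elim dvdE)
      then have n: "n = k + 3 * j" using False by simp
      show ?thesis unfolding n by (simp only: fps_X_deriv_nth fps_X_power_mult_nth) (simp add: ram_nth nth ring_distribs)
    next
      case F: False
      then show ?thesis using False by (simp only: fps_X_deriv_nth fps_X_power_mult_nth) (simp add: ram_nth)
    qed
  qed
qed

lemma form_expansion_identity:
  fixes t :: "'a::comm_ring_1"
  shows "t * (q * (u + v) ^ 2 + a0 + a1 * (u + v)) + (r * (u + v) ^ 2 + b0 + b1 * (u + v)) * (S + (u' + v')) =
    (t * a0 + b0 * S) + ((t * a1 + b1 * S) * u + b0 * u') + ((t * a1 + b1 * S) * v + b0 * v')
      + (t * q * (u + v) ^ 2 + r * (u + v) ^ 2 * (S + (u' + v')) + b1 * (u + v) * (u' + v'))"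
  by (simp add: algebra_simps)

context cubic_branch
begin

text \<open>The three displayed parts have exponents congruent to 0, s and -s modulo 3. Everything
  quadratic in \<open>Y\<close>, and the product of \<open>Y\<close> with the Euler derivative of U
  + V, has order at least 2s and is collected in \<open>E\<close>. The condition for E = 0 gives an
  exact formula for the form attaining the Zariski invariant.\<close>

lemma form_expansion:
  assumes "fps_of_cps g = Q * (fps_X - fps_const \<sigma>) ^ 2 + fps_const r0 + fps_const r1 * (fps_X - fps_const \<sigma>)"
    and "fps_of_cps h = R * (fps_X - fps_const \<sigma>) ^ 2 + fps_const h0 + fps_const h1 * (fps_X - fps_const \<sigma>)"
  defines "w \<equiv> subst_arc g (fps_X ^ 3) y * fps_deriv (fps_X ^ 3) + subst_arc h (fps_X ^ 3) y * fps_deriv y"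
    and "k \<equiv> 3 * r1 + 3 * (h1 * fps_deriv \<sigma>)"
  shows "\<exists>E. (Q = 0 \<longrightarrow> R = 0 \<longrightarrow> h1 = 0 \<longrightarrow> E = 0) \<and>
    fps_X * w = ram 3 (fps_X * (3 * r0 + 3 * (h0 * fps_deriv \<sigma>)))
      + fps_X ^ s * ram 3 (fps_X * k * A + h0 * (of_nat s * A + 3 * (fps_X * fps_deriv A)))
      + fps_X ^ (3 * m - s) * ram 3 (fps_X * k * B + h0 * (of_nat (3 * m - s) * B + 3 * (fps_X * fps_deriv B)))
      + fps_X ^ (2 * s) * E"
proof -
  let ?T = "fps_X :: complex fps" and ?Y = "U + V"
  define \<theta> where "\<theta> a = ?T * fps_deriv a" for a
  have \<theta>_add: "\<theta> (a + b) = \<theta> a + \<theta> b" for a b by (simp add: \<theta>_def distrib_left)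
  define q where "q = arc Q (fps_X ^ 3) y"
  define r where "r = arc R (fps_X ^ 3) y"
  have g: "subst_arc g (fps_X ^ 3) y = q * ?Y ^ 2 + ram 3 r0 + ram 3 r1 * ?Y"
    using y_nth_0 unfolding subst_arc_eq_arc assms(1) q_def
    by (simp add: arc_add arc_mult arc_diff arc_power arc_Y arc_const_Xpow) (simp add: y_def)
  have h: "subst_arc h (fps_X ^ 3) y = r * ?Y ^ 2 + ram 3 h0 + ram 3 h1 * ?Y"
    using y_nth_0 unfolding subst_arc_eq_arc assms(2) r_def
    by (simp add: arc_add arc_mult arc_diff arc_power arc_Y arc_const_Xpow) (simp add: y_def)
  have \<theta>\<sigma>: "\<theta> (ram 3 \<sigma>) = 3 * (?T ^ 3 * ram 3 (fps_deriv \<sigma>))"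
    using fps_X_deriv_ram[of 0 \<sigma>] by (simp add: \<theta>_def ram_mult ram_numeral ram_X)
  have \<theta>U: "\<theta> U = ?T ^ s * ram 3 (of_nat s * A + 3 * (?T * fps_deriv A))"
    unfolding \<theta>_def U_def by (rule fps_X_deriv_ram)
  have \<theta>V: "\<theta> V = ?T ^ (3 * m - s) * ram 3 (of_nat (3 * m - s) * B + 3 * (?T * fps_deriv B))"
    unfolding \<theta>_def V_def by (rule fps_X_deriv_ram)
  have \<theta>y: "\<theta> y = 3 * (?T ^ 3 * ram 3 (fps_deriv \<sigma>)) + (\<theta> U + \<theta> V)"
    unfolding y_def \<theta>_add \<theta>\<sigma> ..
  define z where "z = fps_shift s (U + V)"
  have z: "?Y = ?T ^ s * z"
    using subdegree_decompose[of "U + V", unfolded subdegree_UV(1)]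
    unfolding z_def by (subst (asm) mult.commute)
  define z' where "z' = ram 3 (of_nat s * A + 3 * (?T * fps_deriv A)) +
    ?T ^ (3 * m - 2 * s) * ram 3 (of_nat (3 * m - s) * B + 3 * (?T * fps_deriv B))"
  have "?T ^ (3 * m - s) = ?T ^ s * ?T ^ (3 * m - 2 * s)"
    using ms by (simp flip: power_add)
  then have z': "\<theta> U + \<theta> V = ?T ^ s * z'"
    unfolding \<theta>U \<theta>V z'_def by (simp only: distrib_left mult.assoc)
  have rr: "ram 3 (fps_X * k) * (fps_X ^ e * ram 3 a) + ram 3 h0 * (fps_X ^ e * ram 3 c) =
      fps_X ^ e * ram 3 (fps_X * k * a + h0 * c)" for e a c
  proof -
    have "ram 3 (fps_X * k * a + h0 * c) = ram 3 (fps_X * k) * ram 3 a + ram 3 h0 * ram 3 c"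
      by (simp only: ram_add ram_mult zero_less_numeral)
    then show ?thesis by (simp only: distrib_left mult_ac)
  qed
  define E where "E = 3 * ?T ^ 3 * q * z ^ 2 + r * z ^ 2 * \<theta> y + ram 3 h1 * z * z'"
  have d3: "fps_X * fps_deriv (fps_X ^ 3) = 3 * ?T ^ 3"
    using fps_X_deriv_ram[of 3 1] by (simp add: ram_1 ram_numeral mult.commute)
  have "fps_X * w = (fps_X * fps_deriv (fps_X ^ 3)) * subst_arc g (fps_X ^ 3) y + subst_arc h (fps_X ^ 3) y * \<theta> y"
    unfolding w_def \<theta>_def by (simp only: distrib_left mult_ac)
  also have "\<dots> = (3 * ?T ^ 3 * ram 3 r0 + ram 3 h0 * (3 * (?T ^ 3 * ram 3 (fps_deriv \<sigma>))))
      + ((3 * ?T ^ 3 * ram 3 r1 + ram 3 h1 * (3 * (?T ^ 3 * ram 3 (fps_deriv \<sigma>)))) * U + ram 3 h0 * \<theta> U)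
      + ((3 * ?T ^ 3 * ram 3 r1 + ram 3 h1 * (3 * (?T ^ 3 * ram 3 (fps_deriv \<sigma>)))) * V + ram 3 h0 * \<theta> V)
      + (3 * ?T ^ 3 * q * ?Y ^ 2 + r * ?Y ^ 2 * \<theta> y + ram 3 h1 * ?Y * (\<theta> U + \<theta> V))"
    unfolding d3 g h \<theta>y by (rule form_expansion_identity)
  also have "3 * ?T ^ 3 * ram 3 r0 + ram 3 h0 * (3 * (?T ^ 3 * ram 3 (fps_deriv \<sigma>))) =
      ram 3 (fps_X * (3 * r0 + 3 * (h0 * fps_deriv \<sigma>)))"
    by (simp add: ram_mult ram_add ram_numeral ram_X algebra_simps)
  also have k: "3 * ?T ^ 3 * ram 3 r1 + ram 3 h1 * (3 * (?T ^ 3 * ram 3 (fps_deriv \<sigma>))) = ram 3 (fps_X * k)"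
    by (simp add: k_def ram_mult ram_add ram_numeral ram_X algebra_simps)
  also have "ram 3 (fps_X * k) * U + ram 3 h0 * \<theta> U =
      fps_X ^ s * ram 3 (fps_X * k * A + h0 * (of_nat s * A + 3 * (fps_X * fps_deriv A)))"
    unfolding \<theta>U unfolding U_def by (rule rr)
  also have "ram 3 (fps_X * k) * V + ram 3 h0 * \<theta> V =
      fps_X ^ (3 * m - s) * ram 3 (fps_X * k * B + h0 * (of_nat (3 * m - s) * B + 3 * (fps_X * fps_deriv B)))"
    unfolding \<theta>V unfolding V_def by (rule rr)
  also have "3 * ?T ^ 3 * q * ?Y ^ 2 + r * ?Y ^ 2 * \<theta> y + ram 3 h1 * ?Y * (\<theta> U + \<theta> V) = ?T ^ (2 * s) * E"
  proof -
    have X2: "?T ^ (2 * s) = ?T ^ s * ?T ^ s" by (simp add: mult_2 power_add)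
    show ?thesis unfolding E_def z z' X2 by (simp add: power2_eq_square algebra_simps)
  qed
  finally have "fps_X * w = ram 3 (fps_X * (3 * r0 + 3 * (h0 * fps_deriv \<sigma>)))
      + fps_X ^ s * ram 3 (fps_X * k * A + h0 * (of_nat s * A + 3 * (fps_X * fps_deriv A)))
      + fps_X ^ (3 * m - s) * ram 3 (fps_X * k * B + h0 * (of_nat (3 * m - s) * B + 3 * (fps_X * fps_deriv B)))
      + fps_X ^ (2 * s) * E" .
  moreover have "Q = 0 \<longrightarrow> R = 0 \<longrightarrow> h1 = 0 \<longrightarrow> E = 0"
    using y_nth_0 by (simp add: E_def q_def r_def arc_0 ram_0)
  ultimately show ?thesis by blast
qed

text \<open>Since 3 is a generator, only j modulo 3 matters; the residue classes start at 0, s and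
  2s.\<close>

lemma mem_semigroup_iff:
  "n \<in> {3 * i + s * j | i j. True} \<longleftrightarrow> 3 dvd n \<or> (n \<ge> s \<and> 3 dvd n - s) \<or> (n \<ge> 2 * s \<and> 3 dvd n - 2 * s)"
proof
  assume "n \<in> {3 * i + s * j | i j. True}"
  then obtain i j where n: "n = 3 * i + s * j" by blast
  define t where "t = j div 3"
  have j: "j = 3 * t + j mod 3" by (simp add: t_def)
  have "n = 3 * (i + s * t) + s * (j mod 3)" unfolding n by (subst j) (simp add: algebra_simps)
  moreover have "j mod 3 = 0 \<or> j mod 3 = 1 \<or> j mod 3 = 2" by linarith
  ultimately show "3 dvd n \<or> (n \<ge> s \<and> 3 dvd n - s) \<or> (n \<ge> 2 * s \<and> 3 dvd n - 2 * s)" by auto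
next
  assume "3 dvd n \<or> (n \<ge> s \<and> 3 dvd n - s) \<or> (n \<ge> 2 * s \<and> 3 dvd n - 2 * s)"
  then show "n \<in> {3 * i + s * j | i j. True}"
  proof (elim disjE conjE)
    assume "3 dvd n"
    then obtain i where "n = 3 * i" by (elim dvdE)
    then have "n = 3 * i + s * 0" by simp
    then show ?thesis by blast
  next
    assume "s \<le> n" "3 dvd n - s"
    then obtain i where "n - s = 3 * i" by (elim dvdE)
    then have "n = 3 * i + s * 1" using \<open>s \<le> n\<close> by simp
    then show ?thesis by blast
  next
    assume "2 * s \<le> n" "3 dvd n - 2 * s"
    then obtain i where "n - 2 * s = 3 * i" by (elim dvdE)
    then have "n = 3 * i + s * 2" using \<open>2 * s \<le> n\<close> by simp
    then show ?thesis by blast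
  qed
qed

section \<open>Differential values outside the semigroup\<close>

lemma ge_2s_mem_semigroup:
  assumes "n \<ge> 2 * s"
  shows "n \<in> {3 * i + s * j | i j. True}"
proof -
  have "3 dvd n \<or> 3 dvd n - s \<or> 3 dvd n - 2 * s" using s(2) assms by presburger
  then show ?thesis unfolding mem_semigroup_iff using assms by auto
qed

text \<open>The order of t w is exactly the value \<nu> of the form. A value outside the semigroup
  lies below 2s and can come neither from the class of 0 nor from that of s, hence only from the
  summand starting at \<mu> = 3m - s. The first coefficient of this summand vanishes, which raises
  the bound by 3; and it is zero altogether if p1 = 0, since then B = 0.\<close>

lemma differential_value_ge:
  assumes w: "w = subst_arc g (fps_X ^ 3) y * fps_deriv (fps_X ^ 3) + subst_arc h (fps_X ^ 3) y * fps_deriv y"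
    and "w \<noteq> 0" and nS: "subdegree w + 1 \<notin> {3 * i + s * j | i j. True}"
  shows "p1 \<noteq> 0 \<and> 3 * m - s + 3 \<le> subdegree w + 1 \<and> subdegree w + 1 < 2 * s"
proof -
  define \<nu> where "\<nu> = subdegree w + 1"
  define \<mu> where "\<mu> = 3 * m - s"
  have "\<mu> > s" using orders_bounds by (simp add: \<mu>_def)
  let ?Y2 = "(fps_X - fps_const \<sigma>) ^ 2"
  have Y2: "biconvergent ?Y2" using sigma by (intro biconv_intros) auto
  have arcY2: "arc ?Y2 0 fps_X = fps_X ^ 2"
    using sigma by (simp add: arc_power arc_diff arc_Y arc_const fps_compose_0_right)
  have reg: "bicoeff ?Y2 0 j = 0" if "j < 2" for j
    using that unfolding arc_0_X_nth[symmetric] arcY2 by (simp add: fps_X_power_nth)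
  have reg2: "bicoeff ?Y2 0 2 \<noteq> 0" unfolding arc_0_X_nth[symmetric] arcY2 by (simp add: fps_X_power_nth)
  have div: "\<exists>Q r0 r1. fps_of_cps g = Q * ?Y2 + fps_const r0 + fps_const r1 * (fps_X - fps_const \<sigma>)" for g
  proof -
    obtain Q r where "fps_of_cps g = Q * ?Y2 + (\<Sum>j<2. fps_const (r j) * (fps_X - fps_const \<sigma>) ^ j)"
      using weierstrass_division_shifted[OF Y2 reg reg2 biconvergent_fps_of_cps sigma(1)] by metis
    then have "fps_of_cps g = Q * ?Y2 + fps_const (r 0) + fps_const (r 1) * (fps_X - fps_const \<sigma>)"
      by (simp add: numeral_2_eq_2 add.assoc)
    then show ?thesis by blast
  qed
  obtain Q r0 r1 where g: "fps_of_cps g = Q * ?Y2 + fps_const r0 + fps_const r1 * (fps_X - fps_const \<sigma>)"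
    using div by blast
  obtain R h0 h1 where h: "fps_of_cps h = R * ?Y2 + fps_const h0 + fps_const h1 * (fps_X - fps_const \<sigma>)"
    using div by blast
  define k where "k = 3 * r1 + 3 * (h1 * fps_deriv \<sigma>)"
  define u0 where "u0 = fps_X * (3 * r0 + 3 * (h0 * fps_deriv \<sigma>))"
  define u where "u = fps_X * k * A + h0 * (of_nat s * A + 3 * (fps_X * fps_deriv A))"
  define v where "v = fps_X * k * B + h0 * (of_nat \<mu> * B + 3 * (fps_X * fps_deriv B))"
  obtain E where E: "fps_X * w = ram 3 u0 + fps_X ^ s * ram 3 u + fps_X ^ \<mu> * ram 3 v + fps_X ^ (2 * s) * E"
    using form_expansion[OF g h] unfolding w u0_def u_def v_def k_def \<mu>_def by blast
  have nth: "(fps_X * w) $ n = ram 3 u0 $ n + (if n < s then 0 else ram 3 u $ (n - s)) +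
      (if n < \<mu> then 0 else ram 3 v $ (n - \<mu>))" if "n < 2 * s" for n
    unfolding E using that by (simp add: fps_X_power_mult_nth)
  have \<nu>_lt: "\<nu> < 2 * s" using nS ge_2s_mem_semigroup[of \<nu>] unfolding \<nu>_def by (metis not_le)
  have n3: "\<not> 3 dvd \<nu>" "\<not> (\<nu> \<ge> s \<and> 3 dvd \<nu> - s)"
    using nS unfolding mem_semigroup_iff \<nu>_def by blast+
  have "(fps_X * w) $ \<nu> \<noteq> 0" using \<open>w \<noteq> 0\<close> by (simp add: \<nu>_def)
  then have v_nz: "\<nu> \<ge> \<mu>" "ram 3 v $ (\<nu> - \<mu>) \<noteq> 0"
    using nth[OF \<nu>_lt] n3 by (auto simp: ram_nth split: if_splits)
  \<comment> \<open>Otherwise the class of \<open>s\<close> contributes the nonzero coefficient s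
    h0(0) A(0) at t^s, so \<nu> is at most \<open>s\<close>, which is less than \<mu>.\<close>
  have "h0 $ 0 = 0"
  proof (rule ccontr)
    assume h00: "h0 $ 0 \<noteq> 0"
    have "(fps_X * w) $ s = u $ 0"
      using nth[of s] s \<open>\<mu> > s\<close> by (simp add: ram_nth)
    also have "\<dots> = h0 $ 0 * (of_nat s * A $ 0)"
      by (simp add: u_def fps_of_nat[symmetric])
    finally have "(fps_X * w) $ s \<noteq> 0" using h00 A s by simp
    moreover have "(fps_X * w) $ i = 0" if "i < \<nu>" for i
      using that by (cases i) (auto simp: \<nu>_def intro: nth_less_subdegree_zero)
    ultimately have "\<nu> \<le> s" by (meson not_le)
    then show False using v_nz \<open>\<mu> > s\<close> by simp
  qed
  then have "v $ 0 = 0" by (simp add: v_def)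
  moreover have "v $ ((\<nu> - \<mu>) div 3) \<noteq> 0"
    using v_nz(2) by (simp add: ram_nth split: if_splits)
  ultimately have "(\<nu> - \<mu>) div 3 \<noteq> 0" by metis
  then have "\<nu> - \<mu> \<ge> 3" by linarith
  moreover have "p1 \<noteq> 0"
  proof
    assume "p1 = 0"
    then have "3 * A * B = 0" using AB by simp
    moreover have "A \<noteq> 0" using A by auto
    ultimately have "B = 0" by simp
    then have "v = 0" by (simp add: v_def)
    then show False using v_nz by (simp add: ram_0)
  qed
  ultimately show ?thesis using \<nu>_lt v_nz unfolding \<nu>_def \<mu>_def by linarith
qed

lemma puiseux_y: "mult0 f = 3 \<Longrightarrow> puiseux_parametrization f (fps_X ^ 3) y"
  using conv_UV y_nth_0 root_y by (simp add: puiseux_parametrization_def subst_arc_eq_arc)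

text \<open>The form with dy-coefficient 3 x A(x) and dx-coefficient r0 + r1 (y - \<sigma>) is
  chosen so that its parts in the classes of 0 and s cancel. The first coefficient of what remains
  is 3 (\<mu> - s) A(0) B(0), which is nonzero because \<mu> > s and p1(0) is nonzero.\<close>

lemma differential_value_attained:
  assumes "mult0 f = 3" "p1 \<noteq> 0"
  shows "3 * m - s + 3 \<in> differential_values f"
proof -
  define \<mu> where "\<mu> = 3 * m - s"
  have "\<mu> > s" using orders_bounds by (simp add: \<mu>_def)
  define h0 where "h0 = 3 * (fps_X * A)"
  define r1 where "r1 = - (of_nat s * A + 3 * (fps_X * fps_deriv A))"
  define r0 where "r0 = - (h0 * fps_deriv \<sigma>)"
  let ?Y = "fps_X - fps_const \<sigma>"
  let ?G = "0 * ?Y ^ 2 + fps_const r0 + fps_const r1 * ?Y"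
  let ?H = "0 * ?Y ^ 2 + fps_const h0 + fps_const 0 * ?Y"
  have c: "conv h0" "conv r1" "conv r0"
    unfolding r0_def r1_def h0_def using A sigma
    by (auto intro!: conv_intros simp: fps_of_nat[symmetric] simp flip: fps_const_numeral)
  have G: "fps_of_cps (Abs_cps ?G) = ?G"
    by (rule fps_of_cps_Abs) (use c sigma in \<open>auto intro!: biconv_intros\<close>)
  have H: "fps_of_cps (Abs_cps ?H) = ?H"
    by (rule fps_of_cps_Abs) (use c sigma in \<open>auto intro!: biconv_intros\<close>)
  define w where "w = subst_arc (Abs_cps ?G) (fps_X ^ 3) y * fps_deriv (fps_X ^ 3)
    + subst_arc (Abs_cps ?H) (fps_X ^ 3) y * fps_deriv y"
  define k where "k = 3 * r1 + 3 * (0 * fps_deriv \<sigma>)"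
  define v where "v = fps_X * k * B + h0 * (of_nat \<mu> * B + 3 * (fps_X * fps_deriv B))"
  have "fps_X * w = ram 3 (fps_X * (3 * r0 + 3 * (h0 * fps_deriv \<sigma>)))
      + fps_X ^ s * ram 3 (fps_X * k * A + h0 * (of_nat s * A + 3 * (fps_X * fps_deriv A)))
      + fps_X ^ \<mu> * ram 3 v"
    using form_expansion[OF G H] unfolding w_def v_def k_def \<mu>_def by auto
  also have "fps_X * (3 * r0 + 3 * (h0 * fps_deriv \<sigma>)) = 0" by (simp add: r0_def)
  also have "fps_X * k * A + h0 * (of_nat s * A + 3 * (fps_X * fps_deriv A)) = 0"
    by (simp add: k_def r1_def h0_def algebra_simps)
  finally have Xw: "fps_X * w = fps_X ^ \<mu> * ram 3 v" by (simp add: ram_0)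
  define v1 where "v1 = 3 * r1 * B + 3 * A * (of_nat \<mu> * B + 3 * (fps_X * fps_deriv B))"
  have v: "v = fps_X * v1" by (simp add: v_def v1_def k_def h0_def algebra_simps)
  have "v1 $ 0 = 3 * (of_nat \<mu> - of_nat s) * A $ 0 * B $ 0"
    by (simp add: v1_def r1_def fps_of_nat[symmetric] algebra_simps)
  moreover have "B $ 0 \<noteq> 0"
  proof
    assume "B $ 0 = 0"
    then have "(3 * A * B) $ 0 = 0" by simp
    then show False using AB p1 assms(2) by simp
  qed
  ultimately have "v1 $ 0 \<noteq> 0" using A \<open>\<mu> > s\<close> by simp
  then have v1: "v1 \<noteq> 0" "subdegree v1 = 0" by auto
  have "ram 3 v = fps_X ^ 3 * ram 3 v1" by (simp add: v ram_mult ram_X)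
  then have Xw': "fps_X * w = fps_X ^ (\<mu> + 3) * ram 3 v1" unfolding Xw by (simp add: power_add)
  have "ram 3 v1 \<noteq> 0" "subdegree (ram 3 v1) = 0" using v1 by (simp_all add: ram_eq_0_iff subdegree_ram)
  then have "fps_X * w \<noteq> 0" "subdegree (fps_X * w) = \<mu> + 3"
    unfolding Xw' by simp_all
  then have "w \<noteq> 0" "subdegree w + 1 = \<mu> + 3" by simp_all
  then show ?thesis
    unfolding differential_values_def \<mu>_def
    using puiseux_y[OF assms(1)] by (intro CollectI exI conjI) (auto simp: w_def)
qed

text \<open>\<open>differential_values\<close> ranges over all Puiseux parametrizations, so bounds
  for \<open>y\<close> must be extended to its conjugates. These arise from a primitive cube root of
  unity \<omega>: scaling \<open>A\<close> by \<omega>^i and \<open>B\<close> by \<omega>^(2i)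
  preserves A B, A^3 and B^3, so each conjugate satisfies the same locale.\<close>

lemma other_roots:
  assumes "arc (fps_of_cps f) (fps_X ^ 3) b = 0" "b $ 0 = 0"
  obtains A' B' where "cubic_branch f W \<sigma> p1 q1 A' B' s m" "b = cubic_branch.y \<sigma> A' B' s m"
proof -
  obtain c :: complex where c: "c ^ 2 = - 3" using power2_csqrt by blast
  define z where "z = (c - 1) / 2"
  have "4 * (z ^ 2 + z + 1) = c ^ 2 + 3"
    unfolding z_def power2_eq_square by (simp add: field_simps)
  then have "4 * (z ^ 2 + z + 1) = 0" unfolding c by (metis add.left_inverse)
  then have z: "z ^ 2 + z + 1 = 0" unfolding mult_eq_0_iff by simp
  define \<omega> where "\<omega> = fps_const z"
  have w: "\<omega> ^ 2 + \<omega> + 1 = 0"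
    using z unfolding \<omega>_def by (simp add: fps_const_power flip: fps_const_1_eq_1 fps_const_add)
  then have w3: "\<omega> ^ 3 = 1" by algebra
  define \<eta> where "\<eta> = b - ram 3 \<sigma>"
  have "arc W (fps_X ^ 3) b $ 0 \<noteq> 0" using assms(2) W by (simp add: arc_nth_0)
  then have "arc W (fps_X ^ 3) b \<noteq> 0" by auto
  then have "\<eta> ^ 3 + ram 3 (fps_X ^ m * p1) * \<eta> + ram 3 (fps_X ^ s * q1) = 0"
    using arc_f[of "fps_X ^ 3" b] assms by (simp add: \<eta>_def ram_def)
  moreover have "ram 3 (fps_X ^ m * p1) = - (3 * U * V)" "ram 3 (fps_X ^ s * q1) = - (U ^ 3 + V ^ 3)"
    by (simp_all only: UV U3V3 minus_minus)
  ultimately have "\<eta> ^ 3 - 3 * U * V * \<eta> - (U ^ 3 + V ^ 3) = 0"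
    by (simp only: mult_minus_left diff_conv_add_uminus)
  moreover have "(\<eta> - (U + V)) * (\<eta> - (\<omega> * U + \<omega> ^ 2 * V)) * (\<eta> - (\<omega> ^ 2 * U + \<omega> * V)) =
      \<eta> ^ 3 - 3 * U * V * \<eta> - (U ^ 3 + V ^ 3)"
    using w by algebra
  ultimately have "\<eta> = U + V \<or> \<eta> = \<omega> * U + \<omega> ^ 2 * V \<or> \<eta> = \<omega> ^ 2 * U + \<omega> * V" by simp
  then obtain i where i: "\<eta> = \<omega> ^ i * U + \<omega> ^ (2 * i) * V"
  proof (elim disjE)
    assume "\<eta> = U + V"
    then show thesis using that[of 0] by simp
  next
    assume "\<eta> = \<omega> * U + \<omega> ^ 2 * V"
    then show thesis using that[of 1] by simp
  next
    assume *: "\<eta> = \<omega> ^ 2 * U + \<omega> * V"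
    have "\<omega> ^ (2 * 2) = \<omega> ^ 3 * \<omega>" by (simp add: eval_nat_numeral mult_ac)
    then show thesis using that[of 2] * w3 by simp
  qed
  define A' where "A' = fps_const (z ^ i) * A"
  define B' where "B' = fps_const (z ^ (2 * i)) * B"
  have "z \<noteq> 0" using z by auto
  have "\<omega> ^ (3 * i) = 1" by (simp add: power_mult w3)
  then have w3i: "fps_const (z ^ (3 * i)) = 1" by (simp add: \<omega>_def fps_const_power)
  have "3 * A' * B' = fps_const (z ^ i) * fps_const (z ^ (2 * i)) * (3 * A * B)"
    by (simp only: A'_def B'_def mult_ac)
  also have "fps_const (z ^ i) * fps_const (z ^ (2 * i)) = fps_const (z ^ (3 * i))"
    by (simp flip: power_add)
  finally have e1: "3 * A' * B' = - p1" by (simp add: w3i AB)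
  have e2: "A' ^ 3 = A ^ 3"
    using w3i by (simp add: A'_def power_mult_distrib fps_const_power mult.commute flip: power_mult)
  have "(z ^ (2 * i)) ^ 3 = (z ^ (3 * i)) ^ 2" by (simp add: mult_ac flip: power_mult)
  then have e3: "B' ^ 3 = B ^ 3"
    using w3i by (simp add: B'_def power_mult_distrib fps_const_power)
  interpret b: cubic_branch f W \<sigma> p1 q1 A' B' s m
  proof
    show "A' ^ 3 + fps_X ^ (3 * m - 2 * s) * B' ^ 3 = - q1" unfolding e2 e3 by (rule AB)
    show "A' $ 0 \<noteq> 0" using A \<open>z \<noteq> 0\<close> by (simp add: A'_def)
    show "conv A'" "conv B'" using A B by (auto simp: A'_def B'_def intro!: conv_intros)
  qed (use f_eq W sigma p1 q1 s ms e1 in auto)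
  have "b.U = \<omega> ^ i * U" "b.V = \<omega> ^ (2 * i) * V"
    unfolding b.U_def b.V_def unfolding U_def V_def A'_def B'_def \<omega>_def
    by (simp_all add: ram_mult ram_const fps_const_power mult_ac)
  then have "b = b.y" using i by (simp add: b.y_def \<eta>_def algebra_simps)
  then show thesis using that b.cubic_branch_axioms by blast
qed

text \<open>The least candidate 3m - s + 3 belongs to the residue class of 2s, so it is a gap of the
  semigroup exactly when it is below 2s, that is, when m + 1 < s. Subtracting the multiplicity 3
  gives 3m - s.\<close>

theorem zariski_invariant_eq:
  assumes mult: "mult0 f = 3"
  shows "zariski_invariant f = (if p1 \<noteq> 0 \<and> m + 1 < s then 3 * m - s else 0)"
proof -
  let ?S = "{3 * i + s * j | i j. True}"
  let ?D = "differential_values f - value_semigroup f"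
  have bound: "p1 \<noteq> 0 \<and> 3 * m - s + 3 \<le> \<nu> \<and> \<nu> < 2 * s" if "\<nu> \<in> ?D" for \<nu>
  proof -
    obtain w x b g h where *: "\<nu> = subdegree w + 1" "puiseux_parametrization f x b"
      "w = subst_arc g x b * fps_deriv x + subst_arc h x b * fps_deriv b" "w \<noteq> 0" "\<nu> \<notin> ?S"
      using \<open>\<nu> \<in> ?D\<close> unfolding differential_values_def value_semigroup by blast
    then have x: "x = fps_X ^ 3" using mult by (simp add: puiseux_parametrization_def)
    have b: "b $ 0 = 0" "arc (fps_of_cps f) (fps_X ^ 3) b = 0"
      using *(2) unfolding x by (simp_all add: puiseux_parametrization_def subst_arc_eq_arc)
    obtain A' B' where c: "cubic_branch f W \<sigma> p1 q1 A' B' s m" "b = cubic_branch.y \<sigma> A' B' s m"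
      using other_roots[OF b(2,1)] by blast
    interpret b: cubic_branch f W \<sigma> p1 q1 A' B' s m by (rule c(1))
    show ?thesis using b.differential_value_ge[of w g h] * c(2) x by simp
  qed
  show ?thesis
  proof (cases "p1 \<noteq> 0 \<and> m + 1 < s")
    case True
    have lt: "3 * m - s + 3 < 2 * s" and "3 * m - s + 3 > s" using True orders_bounds by auto
    have "3 * m - s + 3 \<notin> ?S"
    proof -
      have "3 * m - s + 3 = 3 * (m + 1) - s" using orders_bounds by simp
      moreover have "\<not> 3 dvd 3 * (m + 1) - s"
      proof
        assume "3 dvd 3 * (m + 1) - s"
        then have "3 dvd (3 * (m + 1) - s) + s \<longleftrightarrow> 3 dvd s" by (rule dvd_add_right_iff)
        moreover have "(3 * (m + 1) - s) + s = 3 * (m + 1)" using orders_bounds by simp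
        ultimately show False using s(2) by (metis dvd_triv_left)
      qed
      moreover have "\<not> 3 dvd 3 * (m + 1) - s - s"
      proof
        assume "3 dvd 3 * (m + 1) - s - s"
        then have "3 dvd (3 * (m + 1) - s - s) + 2 * s \<longleftrightarrow> 3 dvd 2 * s" by (rule dvd_add_right_iff)
        moreover have "(3 * (m + 1) - s - s) + 2 * s = 3 * (m + 1)" using ms by simp
        ultimately have "3 dvd 2 * s" by (metis dvd_triv_left)
        then show False using s(2) by presburger
      qed
      ultimately show ?thesis unfolding mem_semigroup_iff using lt by simp
    qed
    then have mem: "3 * m - s + 3 \<in> ?D"
      using differential_value_attained[OF mult] True value_semigroup by auto
    have "Inf ?D = 3 * m - s + 3"
      by (rule cInf_eq_minimum[OF mem]) (use bound in blast)
    then show ?thesis using mem True mult unfolding zariski_invariant_def by auto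
  next
    case False
    have "?D = {}"
    proof (rule ccontr)
      assume "?D \<noteq> {}"
      then obtain \<nu> where "\<nu> \<in> ?D" by blast
      then show False using bound[of \<nu>] False orders_bounds by linarith
    qed
    then show ?thesis using False unfolding zariski_invariant_def by auto
  qed
qed

end

section \<open>The discriminant\<close>

lemma arc_numeral:
  assumes "a $ 0 = 0" "b $ 0 = 0"
  shows "arc (numeral k) a b = numeral k"
  using arc_const[OF assms, of "numeral k"] by (simp add: fps_const_numeral)

lemma bicoeff_00_power: "bicoeff (F ^ n) 0 0 = bicoeff F 0 0 ^ n"
  by (induction n) (simp_all add: bicoeff_00_mult bicoeff_simps)

text \<open>Evaluating along y = \<open>c\<close> shows that \<open>c\<close> is a root on the left,
  since the unit \<open>G\<close> vanishes along no arc through the origin. Cancelling this factor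
  leaves one root to compare.\<close>

lemma two_linear_factors_unique:
  fixes a b c d :: "complex fps"
  assumes eq: "G * ((fps_X - fps_const a) * (fps_X - fps_const b)) = H * ((fps_X - fps_const c) * (fps_X - fps_const d))"
    and G: "bicoeff G 0 0 \<noteq> 0" and 0: "c $ 0 = 0" "d $ 0 = 0"
  shows "a = c \<and> b = d \<or> a = d \<and> b = c"
proof -
  have G_nz: "arc G fps_X e \<noteq> 0" if "e $ 0 = 0" for e
  proof -
    have "arc G fps_X e $ 0 \<noteq> 0" using that G by (simp add: arc_nth_0)
    then show ?thesis by auto
  qed
  have lin: "arc (fps_X - fps_const e) fps_X e' = e' - e" if "e' $ 0 = 0" for e e'
    using that by (simp add: arc_diff arc_Y arc_const)
  have X0: "(fps_X :: complex fps) $ 0 = 0" by simp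
  have nz: "fps_X - fps_const e \<noteq> (0 :: bifps)" for e
  proof -
    have "bicoeff (fps_X - fps_const e) 0 1 \<noteq> 0" by (simp add: bicoeff_simps)
    then show ?thesis by (metis bicoeff_simps(1))
  qed
  have "arc G fps_X c * ((c - a) * (c - b)) = 0"
    using arg_cong[OF eq, of "\<lambda>F. arc F fps_X c"]
    by (simp add: arc_mult[OF X0 0(1)] lin[OF 0(1)])
  then have "c = a \<or> c = b" using G_nz[OF 0(1)] by auto
  moreover have "y = d" if "G * ((fps_X - fps_const x) * (fps_X - fps_const y)) = H * ((fps_X - fps_const c) * (fps_X - fps_const d))"
    "c = x" for x y
  proof -
    have "(fps_X - fps_const c) * (G * (fps_X - fps_const y)) = (fps_X - fps_const c) * (H * (fps_X - fps_const d))"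
      using that by (simp only: mult_ac)
    then have "G * (fps_X - fps_const y) = H * (fps_X - fps_const d)" using nz by simp
    from arg_cong[OF this, of "\<lambda>F. arc F fps_X d"] have "arc G fps_X d * (d - y) = 0"
      by (simp add: arc_mult[OF X0 0(2)] lin[OF 0(2)])
    then show ?thesis using G_nz[OF 0(2)] by simp
  qed
  moreover have "G * ((fps_X - fps_const b) * (fps_X - fps_const a)) = H * ((fps_X - fps_const c) * (fps_X - fps_const d))"
    using eq by (simp only: mult_ac)
  ultimately show ?thesis using eq by blast
qed

lemma is_discriminant_cubic:
  assumes "is_discriminant f D" "mult0 f = 3"
  obtains N w g0 g1 where "N \<ge> 1" "bicoeff w 0 0 \<noteq> 0" "g0 $ 0 = 0" "g1 $ 0 = 0"
    "ramify N (cps_dy f) = w * ((fps_X - fps_const g0) * (fps_X - fps_const g1))"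
    "ramify N D = (fps_X - fps_const (arc (fps_of_cps f) (fps_X ^ N) g0)) *
      (fps_X - fps_const (arc (fps_of_cps f) (fps_X ^ N) g1))"
proof -
  obtain N w \<gamma> where *: "N \<ge> 1" "w dvd 1" "\<forall>j < (2::nat). fps_conv_radius (\<gamma> j) > 0 \<and> fps_nth (\<gamma> j) 0 = 0"
    "ramify N (cps_dy f) = ramify N w * (\<Prod>j < (2::nat). fps_X - fps_const (\<gamma> j))"
    "ramify N D = (\<Prod>j < (2::nat). fps_X - fps_const (subst_arc f (fps_X ^ N) (\<gamma> j)))"
    using assms unfolding is_discriminant_def by auto
  have adic: "fps_const (fps_X ^ N) \<in> adic (Suc 0)" using *(1) by (simp add: fps_const_adic_1_iff)
  have "bicoeff (ramify N w) 0 0 \<noteq> 0"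
    using *(2) unfolding ramify_eq_bisubst[OF *(1)] bicoeff_00_bisubst[OF adic Y_adic_1]
    by (simp add: cps_unit_iff)
  then show thesis
    by (rule that[of N "ramify N w" "\<gamma> 0" "\<gamma> 1", OF *(1)])
      (use * in \<open>simp_all add: numeral_2_eq_2 subst_arc_eq_arc mult_ac\<close>)
qed

lemma bisubst_Xpow_Xpow:
  assumes "N \<ge> 1" "M \<ge> 1"
  shows "bisubst (bisubst F (fps_const (fps_X ^ N)) fps_X) (fps_const (fps_X ^ M)) fps_X
    = bisubst F (fps_const (fps_X ^ (N * M))) fps_X"
proof -
  have a: "fps_const (fps_X ^ k) \<in> adic (Suc 0)" if "k \<ge> 1" for k
    using that by (simp add: fps_const_adic_1_iff)
  have "ram M (fps_X ^ N) = fps_X ^ (N * M)"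
    using assms by (simp add: ram_power ram_X mult.commute flip: power_mult)
  then have "bisubst (fps_const (fps_X ^ N)) (fps_const (fps_X ^ M)) fps_X = fps_const (fps_X ^ (N * M))"
    using assms by (simp add: bisubst_const_arc_aux ram_def)
  then show ?thesis
    using assms by (simp add: bisubst_bisubst a bisubst_Y)
qed

text \<open>A description with denominator \<open>N\<close> persists for every multiple of
  \<open>N\<close>, so two descriptions can be compared at a common denominator.\<close>

lemma is_discriminant_cubic_ramified:
  assumes D: "is_discriminant f D" "mult0 f = 3"
  obtains N where "N \<ge> 1" "\<And>M. M \<ge> 1 \<Longrightarrow> \<exists>w g0 g1. bicoeff w 0 0 \<noteq> 0 \<and> g0 $ 0 = 0 \<and> g1 $ 0 = 0 \<and>
    ramify (N * M) (cps_dy f) = w * ((fps_X - fps_const g0) * (fps_X - fps_const g1)) \<and>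
    ramify (N * M) D = (fps_X - fps_const (arc (fps_of_cps f) (fps_X ^ (N * M)) g0)) *
      (fps_X - fps_const (arc (fps_of_cps f) (fps_X ^ (N * M)) g1))"
proof -
  obtain N w g0 g1 where N: "N \<ge> 1" and w: "bicoeff w 0 0 \<noteq> 0" and g: "g0 $ 0 = 0" "g1 $ 0 = 0"
    and dy: "ramify N (cps_dy f) = w * ((fps_X - fps_const g0) * (fps_X - fps_const g1))"
    and RD: "ramify N D = (fps_X - fps_const (arc (fps_of_cps f) (fps_X ^ N) g0)) *
      (fps_X - fps_const (arc (fps_of_cps f) (fps_X ^ N) g1))"
    by (rule is_discriminant_cubic[OF D])
  show thesis
  proof (rule that[OF N])
    fix M :: nat assume M: "M \<ge> 1"
    have XM: "fps_const (fps_X ^ M) \<in> adic (Suc 0)" using M by (simp add: fps_const_adic_1_iff)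
    define \<Phi> where "\<Phi> F = bisubst F (fps_const (fps_X ^ M)) fps_X" for F
    have \<Phi>: "\<Phi> (F * G) = \<Phi> F * \<Phi> G" "\<Phi> (F - G) = \<Phi> F - \<Phi> G" "\<Phi> fps_X = fps_X"
      "\<Phi> (fps_const a) = fps_const (ram M a)" for F G a
      using M by (simp_all add: \<Phi>_def bisubst_mult[OF XM Y_adic_1] bisubst_diff[OF XM Y_adic_1]
          bisubst_Y[OF XM Y_adic_1] bisubst_const_arc_aux ram_def)
    have NM: "N * M \<ge> 1" using N M by simp
    have ram: "ramify (N * M) h = \<Phi> (ramify N h)" for h
      unfolding \<Phi>_def ramify_eq_bisubst[OF N] ramify_eq_bisubst[OF NM] bisubst_Xpow_Xpow[OF N M] ..
    have ra: "ram M (arc F (fps_X ^ N) b) = arc F (fps_X ^ (N * M)) (ram M b)" if "b $ 0 = 0" for F b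
    proof -
      have "ram M (fps_X ^ N) = fps_X ^ (N * M)"
        using M by (simp add: ram_power ram_X mult.commute flip: power_mult)
      then show ?thesis unfolding ram_def
        using N M that by (simp add: arc_compose)
    qed
    show "\<exists>w g0 g1. bicoeff w 0 0 \<noteq> 0 \<and> g0 $ 0 = 0 \<and> g1 $ 0 = 0 \<and>
      ramify (N * M) (cps_dy f) = w * ((fps_X - fps_const g0) * (fps_X - fps_const g1)) \<and>
      ramify (N * M) D = (fps_X - fps_const (arc (fps_of_cps f) (fps_X ^ (N * M)) g0)) *
        (fps_X - fps_const (arc (fps_of_cps f) (fps_X ^ (N * M)) g1))"
    proof (intro exI conjI)
      show "bicoeff (\<Phi> w) 0 0 \<noteq> 0" using w unfolding \<Phi>_def by (simp add: bicoeff_00_bisubst[OF XM Y_adic_1])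
      show "ram M g0 $ 0 = 0" "ram M g1 $ 0 = 0" using M g by simp_all
      show "ramify (N * M) (cps_dy f) = \<Phi> w * ((fps_X - fps_const (ram M g0)) * (fps_X - fps_const (ram M g1)))"
        unfolding ram dy \<Phi> ..
      show "ramify (N * M) D = (fps_X - fps_const (arc (fps_of_cps f) (fps_X ^ (N * M)) (ram M g0))) *
        (fps_X - fps_const (arc (fps_of_cps f) (fps_X ^ (N * M)) (ram M g1)))"
        unfolding ram RD \<Phi> ra[OF g(1)] ra[OF g(2)] ..
    qed
  qed
qed

lemma ramify_inj:
  assumes "ramify N D = ramify N D'" "N \<ge> 1"
  shows "D = D'"
proof -
  have "fps_nth (fps_of_cps D) j = fps_nth (fps_of_cps D') j" for j
    using arg_cong[OF assms(1), of "\<lambda>F. F $ j"] ram_eq_iff[of N] assms(2)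
    by (simp add: ramify_def ram_def)
  then show ?thesis unfolding cps_eq_iff by (rule fps_ext)
qed

text \<open>The definite description \<open>discriminant\<close> is meaningful only once this is
  known. At the denominator N M the critical points coincide as an unordered pair, hence so do the
  products over critical values.\<close>

theorem is_discriminant_unique:
  assumes "is_discriminant f D" "is_discriminant f D'" "mult0 f = 3"
  shows "D = D'"
proof -
  obtain N where N: "N \<ge> 1" and 1: "\<And>M. M \<ge> 1 \<Longrightarrow> \<exists>w g0 g1. bicoeff w 0 0 \<noteq> 0 \<and> g0 $ 0 = 0 \<and> g1 $ 0 = 0 \<and>
    ramify (N * M) (cps_dy f) = w * ((fps_X - fps_const g0) * (fps_X - fps_const g1)) \<and>
    ramify (N * M) D = (fps_X - fps_const (arc (fps_of_cps f) (fps_X ^ (N * M)) g0)) *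
      (fps_X - fps_const (arc (fps_of_cps f) (fps_X ^ (N * M)) g1))"
    using is_discriminant_cubic_ramified[OF assms(1,3)] by blast
  obtain M where M: "M \<ge> 1" and 2: "\<And>N. N \<ge> 1 \<Longrightarrow> \<exists>w g0 g1. bicoeff w 0 0 \<noteq> 0 \<and> g0 $ 0 = 0 \<and> g1 $ 0 = 0 \<and>
    ramify (M * N) (cps_dy f) = w * ((fps_X - fps_const g0) * (fps_X - fps_const g1)) \<and>
    ramify (M * N) D' = (fps_X - fps_const (arc (fps_of_cps f) (fps_X ^ (M * N)) g0)) *
      (fps_X - fps_const (arc (fps_of_cps f) (fps_X ^ (M * N)) g1))"
    using is_discriminant_cubic_ramified[OF assms(2,3)] by blast
  obtain w g0 g1 where g: "bicoeff w 0 0 \<noteq> 0"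
    "ramify (N * M) (cps_dy f) = w * ((fps_X - fps_const g0) * (fps_X - fps_const g1))"
    "ramify (N * M) D = (fps_X - fps_const (arc (fps_of_cps f) (fps_X ^ (N * M)) g0)) *
      (fps_X - fps_const (arc (fps_of_cps f) (fps_X ^ (N * M)) g1))"
    using 1[OF M] by blast
  obtain w' h0 h1 where h: "h0 $ 0 = 0" "h1 $ 0 = 0"
    "ramify (N * M) (cps_dy f) = w' * ((fps_X - fps_const h0) * (fps_X - fps_const h1))"
    "ramify (N * M) D' = (fps_X - fps_const (arc (fps_of_cps f) (fps_X ^ (N * M)) h0)) *
      (fps_X - fps_const (arc (fps_of_cps f) (fps_X ^ (N * M)) h1))"
    using 2[OF N] unfolding mult.commute[of M N] by blast
  have "g0 = h0 \<and> g1 = h1 \<or> g0 = h1 \<and> g1 = h0"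
    by (rule two_linear_factors_unique[of w _ _ w']) (use g h in simp_all)
  then have "ramify (N * M) D = ramify (N * M) D'"
    unfolding g(3) h(4) by (auto simp: mult.commute)
  then show ?thesis by (rule ramify_inj) (use N M in simp)
qed

lemma discriminant_eqI:
  assumes "is_discriminant f D" "mult0 f = 3"
  shows "discriminant f = D"
  unfolding discriminant_def using assms is_discriminant_unique by (intro the_equality)

section \<open>Critical values without solving for the critical points\<close>

lemma ramified_square_root:
  assumes "conv \<Delta>" "\<Delta> $ 0 = 0"
  obtains \<kappa> where "conv \<kappa>" "\<kappa> $ 0 = 0" "\<kappa> ^ 2 = ram 2 \<Delta>"
proof (cases "\<Delta> = 0")
  case True
  then show thesis using that[of 0] by (simp add: ram_0)
next
  case False
  obtain j d where d: "\<Delta> = fps_X ^ j * d" "d $ 0 \<noteq> 0" "conv d"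
    using fps_order_decompose[OF False assms(1)] by blast
  obtain e where e: "conv e" "e ^ 2 = d" using conv_root[of d 2] d by auto
  have "j > 0" using assms(2) d by (cases j) auto
  show thesis
  \<comment> \<open>The substitution x = t^2 doubles the order, so t^j is a square root of x^j;
    denominator 2 therefore suffices for the critical points.\<close>
  proof (rule that)
    show "conv (fps_X ^ j * ram 2 e)" using e by (auto intro!: conv_intros conv_ram)
    show "(fps_X ^ j * ram 2 e) $ 0 = 0" using \<open>j > 0\<close> by simp
    show "(fps_X ^ j * ram 2 e) ^ 2 = ram 2 \<Delta>"
      unfolding d(1) e(2)[symmetric]
      by (simp add: power_mult_distrib ram_mult ram_power ram_X mult.commute flip: power_mult)
  qed
qed

text \<open>
  Write \<open>Y = y - \<sigma>\<close>. If \<open>\<partial>f/\<partial>y\<close> is a unit times \<open>Y\<^sup>2 + 2cY + c\<^sub>0\<close> and \<open>f \<equiv> r\<^sub>0 + r\<^sub>1 Y\<close> modulo this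
  quadratic polynomial, then the critical values of \<open>f\<close> are \<open>r\<^sub>0 - r\<^sub>1 c \<plusminus> r\<^sub>1 \<surd>(c\<^sup>2 - c\<^sub>0)\<close>.
\<close>

lemma is_discriminant_from_division:
  assumes mult: "mult0 f = 3" and w: "biconvergent w" "bicoeff w 0 0 \<noteq> 0"
    and dy: "fps_deriv (fps_of_cps f) = w * ((fps_X - fps_const \<sigma>) ^ 2 +
      2 * fps_const c * (fps_X - fps_const \<sigma>) + fps_const c0)"
    and f: "fps_of_cps f = K * ((fps_X - fps_const \<sigma>) ^ 2 +
      2 * fps_const c * (fps_X - fps_const \<sigma>) + fps_const c0) + fps_const r0 + fps_const r1 * (fps_X - fps_const \<sigma>)"
    and conv: "conv \<sigma>" "conv c" "conv c0" and zero: "\<sigma> $ 0 = 0" "c $ 0 = 0" "c0 $ 0 = 0"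
    and D: "fps_of_cps D = (fps_X - fps_const (r0 - r1 * c)) ^ 2 - fps_const (r1 ^ 2 * (c ^ 2 - c0))"
  shows "is_discriminant f D"
proof -
  have "conv (c ^ 2 - c0)" "(c ^ 2 - c0) $ 0 = 0" using conv zero by (auto intro: conv_intros)
  then obtain \<kappa> where \<kappa>: "conv \<kappa>" "\<kappa> $ 0 = 0" "\<kappa> ^ 2 = ram 2 (c ^ 2 - c0)"
    by (rule ramified_square_root)
  define \<gamma> where "\<gamma> j = ram 2 (\<sigma> - c) + (if j = (0::nat) then \<kappa> else - \<kappa>)" for j
  have \<gamma>: "conv (\<gamma> j)" "\<gamma> j $ 0 = 0" for j
    using conv zero \<kappa> by (auto simp: \<gamma>_def intro!: conv_intros conv_ram)
  let ?\<Phi> = "\<lambda>F. bisubst F (fps_const (fps_X ^ 2)) fps_X"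
  have X2: "fps_const (fps_X ^ 2) \<in> adic (Suc 0)" by (simp add: fps_const_adic_1_iff)
  note sub = bisubst_mult[OF X2 Y_adic_1] bisubst_add[OF X2 Y_adic_1] bisubst_diff[OF X2 Y_adic_1]
    bisubst_power[OF X2 Y_adic_1] bisubst_Y[OF X2 Y_adic_1]
  have sub_const: "?\<Phi> (fps_const a) = fps_const (ram 2 a)" for a
    by (simp add: bisubst_const_arc_aux ram_def)
  have sub_2: "?\<Phi> 2 = 2" using sub_const[of 2] by (simp add: ram_numeral fps_const_numeral)
  have prod: "(\<Prod>j<2. fps_X - fps_const (h j)) = (fps_X - fps_const (h 0)) * (fps_X - fps_const (h 1))"
    for h :: "nat \<Rightarrow> complex fps"
    by (simp add: numeral_2_eq_2)
  have k2: "fps_const \<kappa> ^ 2 = fps_const (ram 2 c) ^ 2 - fps_const (ram 2 c0)"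
    using arg_cong[OF \<kappa>(3), of fps_const] by (simp add: ram_diff ram_power flip: fps_const_power fps_const_sub)
  have "ramify 2 (cps_dy f) = ramify 2 (Abs_cps w) * (\<Prod>j<2. fps_X - fps_const (\<gamma> j))"
  proof -
    have "ramify 2 (cps_dy f) = ?\<Phi> w * ((fps_X - fps_const (ram 2 \<sigma>)) ^ 2 +
      2 * fps_const (ram 2 c) * (fps_X - fps_const (ram 2 \<sigma>)) + fps_const (ram 2 c0))"
      by (simp only: ramify_eq_bisubst[OF one_le_numeral] cps_dy.rep_eq dy sub sub_const sub_2)
    also have "(fps_X - fps_const (ram 2 \<sigma>)) ^ 2 +
      2 * fps_const (ram 2 c) * (fps_X - fps_const (ram 2 \<sigma>)) + fps_const (ram 2 c0) =
      (fps_X - (fps_const (ram 2 \<sigma>) - fps_const (ram 2 c) + fps_const \<kappa>)) *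
      (fps_X - (fps_const (ram 2 \<sigma>) - fps_const (ram 2 c) - fps_const \<kappa>))"
      using k2 by algebra
    also have "\<dots> = (\<Prod>j<2. fps_X - fps_const (\<gamma> j))"
      unfolding prod by (simp add: \<gamma>_def ram_diff)
    also have "?\<Phi> w = ramify 2 (Abs_cps w)"
      by (simp add: ramify_eq_bisubst fps_of_cps_Abs w)
    finally show ?thesis .
  qed
  moreover have "ramify 2 D = (\<Prod>j<2. fps_X - fps_const (subst_arc f (fps_X ^ 2) (\<gamma> j)))"
  proof -
    have val: "subst_arc f (fps_X ^ 2) (\<gamma> j) = ram 2 r0 + ram 2 r1 * (\<gamma> j - ram 2 \<sigma>)" for j
    proof -
      have "(if j = 0 then \<kappa> else - \<kappa>) ^ 2 = ram 2 c ^ 2 - ram 2 c0"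
        using \<kappa>(3) by (simp add: ram_diff ram_power)
      moreover have "\<gamma> j - ram 2 \<sigma> = (if j = 0 then \<kappa> else - \<kappa>) - ram 2 c"
        by (simp add: \<gamma>_def ram_diff)
      ultimately have "(\<gamma> j - ram 2 \<sigma>) ^ 2 + 2 * ram 2 c * (\<gamma> j - ram 2 \<sigma>) + ram 2 c0 = 0"
        by algebra
      then show ?thesis
        unfolding subst_arc_eq_arc f using \<gamma>(2)[of j]
        by (simp add: arc_add arc_mult arc_diff arc_power arc_Y arc_const_Xpow arc_numeral)
    qed
    have r1k: "(fps_const (ram 2 r1) * fps_const \<kappa>) ^ 2 = fps_const (ram 2 (r1 ^ 2 * (c ^ 2 - c0)))"
      using arg_cong[OF \<kappa>(3), of fps_const]
      by (simp add: power_mult_distrib ram_mult ram_power flip: fps_const_power fps_const_mult)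
    have "ramify 2 D = (fps_X - fps_const (ram 2 (r0 - r1 * c))) ^ 2 - fps_const (ram 2 (r1 ^ 2 * (c ^ 2 - c0)))"
      by (simp only: ramify_eq_bisubst[OF one_le_numeral] D sub sub_const)
    also have "\<dots> = (fps_X - (fps_const (ram 2 (r0 - r1 * c)) + fps_const (ram 2 r1) * fps_const \<kappa>)) *
        (fps_X - (fps_const (ram 2 (r0 - r1 * c)) - fps_const (ram 2 r1) * fps_const \<kappa>))"
      unfolding r1k[symmetric] by (simp add: power2_eq_square algebra_simps)
    also have "fps_const (ram 2 (r0 - r1 * c)) + fps_const (ram 2 r1) * fps_const \<kappa> =
        fps_const (subst_arc f (fps_X ^ 2) (\<gamma> 0))"
      unfolding val by (simp add: \<gamma>_def ram_diff ram_mult algebra_simps)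
    also have "fps_const (ram 2 (r0 - r1 * c)) - fps_const (ram 2 r1) * fps_const \<kappa> =
        fps_const (subst_arc f (fps_X ^ 2) (\<gamma> 1))"
      unfolding val by (simp add: \<gamma>_def ram_diff ram_mult algebra_simps)
    finally show ?thesis unfolding prod .
  qed
  moreover have "Abs_cps w dvd 1" using w by (simp add: cps_unit_iff fps_of_cps_Abs)
  ultimately show ?thesis
    unfolding is_discriminant_def mult using \<gamma>
    by (intro exI[of _ 2] exI[of _ "Abs_cps w"] exI[of _ \<gamma>]) simp
qed

text \<open>Evaluation at y = \<sigma> gives the first coefficient; after cancelling y - \<sigma> a
  second evaluation gives the next.\<close>

lemma Y_expansion_unique:
  fixes \<sigma> :: "complex fps"
  assumes "fps_const a0 + fps_const a1 * (fps_X - fps_const \<sigma>) + (fps_X - fps_const \<sigma>) ^ 2 * G =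
      fps_const b0 + fps_const b1 * (fps_X - fps_const \<sigma>) + (fps_X - fps_const \<sigma>) ^ 2 * H"
    and \<sigma>: "\<sigma> $ 0 = 0"
  shows "a0 = b0 \<and> a1 = b1"
proof -
  let ?Y = "fps_X - fps_const \<sigma>" and ?ev = "\<lambda>F. arc F fps_X \<sigma>"
  have ev: "?ev (F + G) = ?ev F + ?ev G" "?ev (F * G) = ?ev F * ?ev G" "?ev ?Y = 0"
    "?ev (fps_const a) = a" for F G a
    using \<sigma> by (simp_all add: arc_add arc_mult arc_diff arc_Y arc_const)
  have 0: "a0 = b0" using arg_cong[OF assms(1), of ?ev] by (simp add: ev power2_eq_square)
  have "bicoeff ?Y 0 1 \<noteq> 0" by (simp add: bicoeff_simps)
  then have Y: "?Y \<noteq> 0" by (metis bicoeff_simps(1))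
  have "?Y * (fps_const a1 + ?Y * G) = ?Y * (fps_const b1 + ?Y * H)"
    using assms(1) unfolding 0 by (simp add: power2_eq_square distrib_left mult_ac)
  then have "fps_const a1 + ?Y * G = fps_const b1 + ?Y * H" using Y by simp
  from arg_cong[OF this, of ?ev] have "a1 = b1" by (simp add: ev)
  with 0 show ?thesis by simp
qed

text \<open>The unit times the cubic, arranged as constant term, linear term, coefficients of Y^2
  and Y^3, and a multiple of Y^4: the shape on which \<open>quadratic_reduction\<close>
  operates.\<close>

lemma cubic_product_expansion:
  fixes Y :: "'a::comm_ring_1"
  shows "(R * Y ^ 4 + (w0 + w1 * Y + w2 * Y ^ 2 + w3 * Y ^ 3)) * (Y ^ 3 + p * Y + q) =
    w0 * q + (w0 * p + w1 * q) * Y + Y ^ 2 * ((w1 * p + w2 * q) + Y * ((w0 + w2 * p + w3 * q) +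
      Y * (w1 + w2 * Y + w3 * Y ^ 2 + R * Y ^ 3 + w3 * p + R * (p * Y + q))))"
  by (simp add: eval_nat_numeral algebra_simps)

text \<open>Modulo \<open>Q\<close> the square Y^2 equals -x L, so each occurrence of Y^2 gains a
  factor x. The only corrections of first order in x are linear in \<open>Y\<close>, namely -x f3 e0
  Y; all others are divisible by x^2.\<close>

lemma quadratic_reduction:
  fixes Y x e0 e1 :: "'a::comm_ring_1"
  defines "Q \<equiv> Y ^ 2 + 2 * (x * e1) * Y + x * e0" and "L \<equiv> 2 * e1 * Y + e0"
  shows "F0 + x * f1 * Y + Y ^ 2 * (x * f2 + Y * (f3 + Y * R)) =
    (x * f2 + f3 * Y - 2 * f3 * x * e1 + R * (Q - 2 * x * L)) * Q + F0 + x * (f1 - f3 * e0) * Y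
      + x ^ 2 * ((2 * f3 * e1 - f2) * L + R * L ^ 2)"
proof -
  define q where "q = Q"
  have Y2: "Y ^ 2 = q - x * L" by (simp add: q_def Q_def L_def algebra_simps)
  have "f3 * (Y * Y ^ 2) = f3 * Y * q - 2 * f3 * x * e1 * (q - x * L) - f3 * x * e0 * Y"
    unfolding Y2[symmetric] by (simp add: q_def Q_def power2_eq_square algebra_simps)
  moreover have "Y ^ 2 * (x * f2 + Y * (f3 + Y * R)) = x * f2 * Y ^ 2 + f3 * (Y * Y ^ 2) + R * (Y ^ 2) ^ 2"
    by (simp add: power2_eq_square algebra_simps)
  ultimately have "Y ^ 2 * (x * f2 + Y * (f3 + Y * R)) =
      x * f2 * (q - x * L) + (f3 * Y * q - 2 * f3 * x * e1 * (q - x * L) - f3 * x * e0 * Y) + R * (q - x * L) ^ 2"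
    unfolding Y2 by simp
  then show ?thesis unfolding q_def[symmetric] by (simp add: power2_eq_square algebra_simps)
qed

context cubic_branch
begin

text \<open>With x denoting X^k, the series c, c0 and r1 are all divisible by x. Hence r1^2 (c^2 -
  c0) is divisible by x^3, and r0 - r1 c differs from w0 q only by a multiple of x^2, whose order
  exceeds s.\<close>

theorem discriminant_cubic:
  assumes mult: "mult0 f = 3"
  obtains D \<phi>1 \<epsilon> where "discriminant f = D" "conv \<phi>1" "\<phi>1 $ 0 \<noteq> 0" "conv \<epsilon>"
    "fps_of_cps D = (fps_X - fps_const (fps_X ^ s * \<phi>1)) ^ 2 - fps_const (fps_X ^ (3 * min m s) * \<epsilon>)"
    "m < s \<longrightarrow> p1 \<noteq> 0 \<longrightarrow> \<epsilon> $ 0 \<noteq> 0"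
proof -
  let ?F = "fps_of_cps f" and ?C = "\<lambda>a. fps_const a :: bifps"
  define Y where "Y = fps_X - ?C \<sigma>"
  have Y: "biconvergent Y" unfolding Y_def using sigma by (intro biconv_intros)
  have Y0: "bicoeff Y 0 0 = 0" using sigma by (simp add: Y_def bicoeff_simps)
  have arcY: "arc Y 0 fps_X = fps_X"
    using sigma by (simp add: Y_def arc_diff arc_Y arc_const fps_compose_0_right)
  have arcYn: "arc (Y ^ n) 0 fps_X = fps_X ^ n" for n by (simp add: arc_power arcY)
  have regY: "bicoeff (Y ^ n) 0 j = (if j = n then 1 else 0)" for n j
    unfolding arc_0_X_nth[symmetric] arcYn by (simp add: fps_X_power_nth)
  \<comment> \<open>The power X^k divides both lower coefficients of the cubic, and 2k > s makes
    corrections of second order in X^k negligible against X^s.\<close>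
  define k where "k = min m s"
  have k: "k \<le> m" "k \<le> s" "2 * k > s" "k > 0" using orders_bounds s by (auto simp: k_def)
  define x where "x = (fps_X ^ k :: complex fps)"
  have x: "conv x" "x $ 0 = 0" using k by (auto simp: x_def intro: conv_intros)
  define p' where "p' = fps_X ^ (m - k) * p1"
  define q' where "q' = fps_X ^ (s - k) * q1"
  have p: "fps_X ^ m * p1 = x * p'" and q: "fps_X ^ s * q1 = x * q'"
    using k unfolding p'_def q'_def x_def mult.assoc[symmetric] power_add[symmetric] by simp_all
  have cpq: "conv p'" "conv q'" unfolding p'_def q'_def using p1 q1 by (auto intro!: conv_intros)
  have reg4: "bicoeff (Y ^ 4) 0 j = 0" if "j < 4" for j using that by (simp add: regY)
  have reg4': "bicoeff (Y ^ 4) 0 4 \<noteq> 0" by (simp add: regY)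
  obtain R4 w where R4: "biconvergent R4" and w: "\<And>j. conv (w j)"
    and W_exp: "W = R4 * Y ^ 4 + (\<Sum>j<4. ?C (w j) * (fps_X - ?C \<sigma>) ^ j)"
    using weierstrass_division_shifted[OF biconvergent_power[OF Y] reg4 reg4' W(1) sigma(1)] by blast
  have W_eq: "W = R4 * Y ^ 4 + (?C (w 0) + ?C (w 1) * Y + ?C (w 2) * Y ^ 2 + ?C (w 3) * Y ^ 3)"
    using W_exp unfolding Y_def[symmetric] by (simp add: eval_nat_numeral add.assoc)
  have w0: "w 0 $ 0 = bicoeff W 0 0"
    unfolding W_eq by (simp add: bicoeff_simps(2) bicoeff_00_mult bicoeff_00_power Y0) (simp add: bicoeff_simps)
  define f1 where "f1 = w 0 * p' + w 1 * q'"
  define f2 where "f2 = w 1 * p' + w 2 * q'"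
  define f3 where "f3 = w 0 + w 2 * (x * p') + w 3 * (x * q')"
  have cf: "conv f1" "conv f2" "conv f3"
    unfolding f1_def f2_def f3_def using w cpq x by (auto intro!: conv_intros)
  define R where "R = ?C (w 1) + ?C (w 2) * Y + ?C (w 3) * Y ^ 2 + R4 * Y ^ 3 + ?C (w 3) * ?C (x * p')
    + R4 * (?C (x * p') * Y + ?C (x * q'))"
  have R: "biconvergent R" unfolding R_def by (intro biconv_intros Y R4 w conv_intros x cpq)
  define F0 where "F0 = w 0 * (fps_X ^ s * q1)"
  have F_exp: "?F = ?C F0 + ?C x * ?C f1 * Y + Y ^ 2 * (?C x * ?C f2 + Y * (?C f3 + Y * R))"
  proof -
    have "?F = (R4 * Y ^ 4 + (?C (w 0) + ?C (w 1) * Y + ?C (w 2) * Y ^ 2 + ?C (w 3) * Y ^ 3)) *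
        (Y ^ 3 + ?C (x * p') * Y + ?C (x * q'))"
      using f_eq unfolding p q Y_def[symmetric] W_eq .
    also have "\<dots> = ?C (w 0) * ?C (x * q') + (?C (w 0) * ?C (x * p') + ?C (w 1) * ?C (x * q')) * Y +
        Y ^ 2 * ((?C (w 1) * ?C (x * p') + ?C (w 2) * ?C (x * q')) + Y * ((?C (w 0) + ?C (w 2) * ?C (x * p') +
          ?C (w 3) * ?C (x * q')) + Y * R))"
      unfolding R_def by (rule cubic_product_expansion)
    also have "?C (w 0) * ?C (x * q') = ?C F0" by (simp add: F0_def q)
    also have "?C (w 0) * ?C (x * p') + ?C (w 1) * ?C (x * q') = ?C x * ?C f1"
      by (simp add: f1_def algebra_simps)
    also have "?C (w 1) * ?C (x * p') + ?C (w 2) * ?C (x * q') = ?C x * ?C f2"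
      by (simp add: f2_def algebra_simps)
    also have "?C (w 0) + ?C (w 2) * ?C (x * p') + ?C (w 3) * ?C (x * q') = ?C f3"
      by (simp add: f3_def)
    finally show ?thesis .
  qed
  define H where "H = ?C x * ?C f2 + Y * (?C f3 + Y * R)"
  have dY: "fps_deriv Y = 1" by (simp add: Y_def)
  have dF: "fps_deriv ?F = ?C (x * f1) + ?C (2 * (x * f2)) * Y + Y ^ 2 * (2 * (?C f3 + Y * R) + fps_deriv H)"
  proof -
    have "fps_deriv (Y ^ 2 * H) = 2 * Y * H + Y ^ 2 * fps_deriv H"
      by (simp add: power2_eq_square dY algebra_simps)
    also have "2 * Y * H = 2 * (?C x * ?C f2) * Y + Y ^ 2 * (2 * (?C f3 + Y * R))"
      by (simp add: H_def power2_eq_square algebra_simps)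
    finally have "fps_deriv (Y ^ 2 * H) = ?C (2 * (x * f2)) * Y + Y ^ 2 * (2 * (?C f3 + Y * R) + fps_deriv H)"
      by (simp add: distrib_left add.assoc flip: fps_const_mult fps_const_numeral)
    then show ?thesis unfolding F_exp H_def[symmetric] by (simp add: dY add.assoc)
  qed
  have bdF: "biconvergent (fps_deriv ?F)" by (intro biconvergent_deriv biconvergent_fps_of_cps)
  have reg0: "bicoeff (fps_deriv ?F) 0 j = 0" if "j < 2" for j
    using that regular(1)[of "Suc j"] by (simp add: bicoeff_deriv)
  have reg2: "bicoeff (fps_deriv ?F) 0 2 \<noteq> 0"
    using regular(2) by (simp add: bicoeff_deriv numeral_2_eq_2 numeral_3_eq_3 del: of_nat_Suc)
  have "\<exists>v r. biconvergent v \<and> bicoeff v 0 0 \<noteq> 0 \<and> (\<forall>j. conv (r j)) \<and> (\<forall>j<2. r j $ 0 = 0) \<and>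
      fps_deriv ?F = v * (fps_X ^ 2 + (\<Sum>j<2. ?C (r j) * fps_X ^ j))"
  proof (rule weierstrass_preparation[OF bdF reg0 reg2, where k = 0])
    fix v r assume a: "biconvergent v" "bicoeff v 0 0 \<noteq> 0" "\<And>j. conv (r j)" "\<And>j. j < 2 \<Longrightarrow> r j $ 0 = 0"
      "fps_deriv ?F = v * (fps_X ^ 2 + (\<Sum>j<2. ?C (r j) * fps_X ^ j))"
    show ?thesis by (intro exI[of _ v] exI[of _ r] conjI allI impI a)
  qed
  then obtain v r where v: "biconvergent v" "bicoeff v 0 0 \<noteq> 0"
    and r: "\<And>j. conv (r j)" "\<And>j. j < 2 \<Longrightarrow> r j $ 0 = 0"
    and dF_prep: "fps_deriv ?F = v * (fps_X ^ 2 + (\<Sum>j<2. ?C (r j) * fps_X ^ j))"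
    by (elim exE conjE) blast
  define hf where "hf = (fps_const (1 / 2) :: complex fps)"
  have hf: "2 * hf = 1" "conv hf"
  proof -
    have "2 * hf = fps_const 2 * fps_const (1 / 2)" by (simp add: hf_def fps_const_numeral)
    then show "2 * hf = 1" by simp
  qed (simp add: hf_def)
  define c where "c = \<sigma> + hf * r 1"
  define c0 where "c0 = \<sigma> ^ 2 + r 1 * \<sigma> + r 0"
  have c: "conv c" "c $ 0 = 0" "conv c0" "c0 $ 0 = 0"
    unfolding c_def c0_def using sigma r hf by (auto intro!: conv_intros simp: power2_eq_square)
  define Q where "Q = Y ^ 2 + 2 * ?C c * Y + ?C c0"
  have "fps_X ^ 2 + (\<Sum>j<2. ?C (r j) * fps_X ^ j) = Q"
  proof -
    have "(\<Sum>j<2. ?C (r j) * fps_X ^ j) = ?C (r 0) + ?C (r 1) * fps_X" by (simp add: eval_nat_numeral)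
    moreover have "2 * ?C c = 2 * ?C \<sigma> + ?C (2 * hf) * ?C (r 1)"
      by (simp add: c_def distrib_left mult.assoc flip: fps_const_add fps_const_mult fps_const_numeral)
    then have "2 * ?C c = 2 * ?C \<sigma> + ?C (r 1)" by (simp add: hf)
    moreover have "?C c0 = ?C \<sigma> ^ 2 + ?C (r 1) * ?C \<sigma> + ?C (r 0)"
      by (simp add: c0_def)
    ultimately show ?thesis unfolding Q_def Y_def by (simp add: power2_eq_square algebra_simps)
  qed
  then have dF_Q: "fps_deriv ?F = v * Q" using dF_prep by simp
  have bQ: "biconvergent Q" unfolding Q_def using c Y by (intro biconv_intros) (simp_all add: numeral_fps_const biconvergent_fps_const)
  have arcQ: "arc Q 0 fps_X = fps_X ^ 2"
    using c by (simp add: Q_def arc_add arc_mult arc_numeral arc_const arcY arcYn fps_compose_0_right)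
  have Qreg: "bicoeff Q 0 j = 0" if "j < 2" for j
    using that unfolding arc_0_X_nth[symmetric] arcQ by (simp add: fps_X_power_nth)
  have Qreg2: "bicoeff Q 0 2 \<noteq> 0" unfolding arc_0_X_nth[symmetric] arcQ by (simp add: fps_X_power_nth)
  have linear: "\<exists>K (g :: nat \<Rightarrow> complex fps). biconvergent K \<and> (\<forall>j. conv (g j)) \<and> G = K * P + ?C (g 0) + ?C (g 1) * Y"
    if PG: "biconvergent P" "\<And>j. j < 2 \<Longrightarrow> bicoeff P 0 j = 0" "bicoeff P 0 2 \<noteq> 0" "biconvergent G" for P G
  proof -
    obtain K g where K: "biconvergent K" "\<And>j. conv (g j)" "G = K * P + (\<Sum>j<2. ?C (g j) * (fps_X - ?C \<sigma>) ^ j)"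
      using weierstrass_division_shifted[OF PG sigma(1)] by blast
    have "(\<Sum>j<2. ?C (g j) * (fps_X - ?C \<sigma>) ^ j) = ?C (g 0) + ?C (g 1) * Y"
      unfolding Y_def by (simp add: numeral_2_eq_2)
    then have G: "G = K * P + ?C (g 0) + ?C (g 1) * Y" using K(3) by (simp only: add.assoc)
    show ?thesis by (rule exI[of _ K], rule exI[of _ g], intro conjI allI K(1,2) G)
  qed
  have Y2reg: "bicoeff (Y ^ 2) 0 j = 0" if "j < 2" for j using that by (simp add: regY)
  have Y2reg2: "bicoeff (Y ^ 2) 0 2 \<noteq> 0" by (simp add: regY)
  obtain V and u :: "nat \<Rightarrow> complex fps" where u: "\<And>j. conv (u j)" and v_eq: "v = V * Y ^ 2 + ?C (u 0) + ?C (u 1) * Y"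
    using linear[OF biconvergent_power[OF Y] Y2reg Y2reg2 v(1)] by blast
  \<comment> \<open>On x = 0 the y-derivative has y^2-coefficient 3 W(0, 0), three times the
    y^3-coefficient of \<open>f\<close>.\<close>
  have u0: "u 0 $ 0 = 3 * w 0 $ 0"
  proof -
    have "u 0 $ 0 = bicoeff v 0 0"
      unfolding v_eq by (simp add: bicoeff_simps(2) bicoeff_00_mult bicoeff_00_power Y0) (simp add: bicoeff_simps)
    also have "\<dots> = (arc v 0 fps_X * fps_X ^ 2) $ 2"
      by (simp add: fps_X_power_mult_right_nth arc_0_X_nth)
    also have "\<dots> = arc (fps_deriv ?F) 0 fps_X $ 2" unfolding dF_Q by (simp add: arc_mult arcQ)
    also have "\<dots> = 3 * bicoeff ?F 0 3"
      unfolding arc_0_X_nth by (simp add: bicoeff_deriv numeral_2_eq_2 numeral_3_eq_3)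
    also have "bicoeff ?F 0 3 = bicoeff W 0 0"
    proof -
      have "arc ?F 0 fps_X = arc W 0 fps_X * fps_X ^ 3"
        using arc_f[of 0 fps_X] sigma s orders_bounds by (simp add: fps_compose_0_right)
      then have "bicoeff ?F 0 3 = (arc W 0 fps_X * fps_X ^ 3) $ 3" by (simp flip: arc_0_X_nth)
      then show ?thesis by (simp add: fps_X_power_mult_right_nth arc_0_X_nth)
    qed
    finally show ?thesis by (simp add: w0)
  qed
  have w0_nz: "w 0 $ 0 \<noteq> 0" using w0 W(2) by simp
  have "?C (x * f1) + ?C (2 * (x * f2)) * Y + Y ^ 2 * (2 * (?C f3 + Y * R) + fps_deriv H) =
      ?C (u 0 * c0) + ?C (2 * (u 0 * c) + u 1 * c0) * Y + Y ^ 2 * (?C (u 0) + ?C (u 1) * (2 * ?C c + Y) + V * Q)"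
  proof -
    have e1: "v * Q = ?C (u 0 * c0) + (2 * (?C (u 0) * ?C c) + ?C (u 1) * ?C c0) * Y +
        Y ^ 2 * (?C (u 0) + ?C (u 1) * (2 * ?C c + Y) + V * Q)"
      unfolding v_eq Q_def fps_const_mult[symmetric] by (simp add: power2_eq_square algebra_simps del: fps_const_mult)
    have e2: "?C (2 * (u 0 * c) + u 1 * c0) = 2 * (?C (u 0) * ?C c) + ?C (u 1) * ?C c0"
      by (simp flip: fps_const_add fps_const_mult fps_const_numeral)
    show ?thesis unfolding dF[symmetric] dF_Q e1 e2 ..
  qed
  \<comment> \<open>Two expansions of the y-derivative are compared, one from differentiating
    \<open>f\<close> and one from its Weierstrass form. The unit u0 can be divided out, so c0 and
    then c turn out to be multiples of x.\<close>
  from Y_expansion_unique[OF this[unfolded Y_def] sigma(2)]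
  have eq1: "x * f1 = u 0 * c0" and eq2: "2 * (x * f2) = 2 * (u 0 * c) + u 1 * c0" by simp_all
  define i where "i = inverse (u 0)"
  have i: "i * u 0 = 1" "conv i"
    using u0 w0_nz u by (auto simp: i_def inverse_mult_eq_1 intro!: conv_intros)
  define e0 where "e0 = f1 * i"
  define e1 where "e1 = (f2 - hf * (u 1 * e0)) * i"
  have ce: "conv e0" "conv e1" unfolding e0_def e1_def using cf i u hf by (auto intro!: conv_intros)
  have c0: "c0 = x * e0"
  proof -
    have "c0 = i * u 0 * c0" by (simp add: i)
    also have "\<dots> = i * (x * f1)" by (simp only: eq1 mult.assoc)
    finally show ?thesis by (simp add: e0_def mult_ac)
  qed
  have c1: "c = x * e1"
  proof -
    have "c = (2 * hf) * (i * u 0) * c" by (simp add: i hf)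
    also have "\<dots> = hf * i * (2 * (u 0 * c))" by (simp only: mult_ac)
    also have "2 * (u 0 * c) = 2 * (x * f2) - u 1 * c0" using eq2 by simp
    also have "hf * i * (2 * (x * f2) - u 1 * c0) = x * (((2 * hf) * f2 - hf * (u 1 * e0)) * i)"
      unfolding c0 by (simp add: algebra_simps)
    finally show ?thesis by (simp only: hf e1_def mult_1)
  qed
  define L where "L = 2 * ?C e1 * Y + ?C e0"
  define G where "G = (2 * ?C f3 * ?C e1 - ?C f2) * L + R * L ^ 2"
  have two: "biconvergent 2" by (simp add: numeral_fps_const biconvergent_fps_const)
  have bL: "biconvergent L" unfolding L_def by (intro biconv_intros ce Y two)
  have bG: "biconvergent G" unfolding G_def by (intro biconv_intros cf ce bL R two)
  obtain K and g :: "nat \<Rightarrow> complex fps" where g: "\<And>j. conv (g j)" and G_eq: "G = K * Q + ?C (g 0) + ?C (g 1) * Y"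
    using linear[OF bQ Qreg Qreg2 bG] by blast
  define \<rho> where "\<rho> = f1 - f3 * e0 + x * g 1"
  define r0 where "r0 = F0 + x ^ 2 * g 0"
  define r1 where "r1 = x * \<rho>"
  have Q_eq: "Q = Y ^ 2 + 2 * (?C x * ?C e1) * Y + ?C x * ?C e0" by (simp add: Q_def c0 c1)
  define K' where "K' = ?C x * ?C f2 + ?C f3 * Y - 2 * ?C f3 * ?C x * ?C e1 + R * (Q - 2 * ?C x * L)"
  have "?F = K' * Q + ?C F0 + ?C x * (?C f1 - ?C f3 * ?C e0) * Y + ?C x ^ 2 * G"
    unfolding F_exp K'_def G_def Q_eq L_def by (rule quadratic_reduction)
  also have "\<dots> = (K' + ?C x ^ 2 * K) * Q + (?C F0 + ?C x ^ 2 * ?C (g 0)) +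
      (?C x * ((?C f1 - ?C f3 * ?C e0) + ?C x * ?C (g 1))) * Y"
    unfolding G_eq by (simp add: power2_eq_square algebra_simps
        del: fps_const_mult fps_const_add fps_const_sub)
  also have "?C F0 + ?C x ^ 2 * ?C (g 0) = ?C r0" by (simp add: r0_def)
  also have "?C x * ((?C f1 - ?C f3 * ?C e0) + ?C x * ?C (g 1)) = ?C r1" by (simp add: r1_def \<rho>_def)
  finally have F_red: "?F = (K' + ?C x ^ 2 * K) * Q + ?C r0 + ?C r1 * Y" .
  have cF0: "conv F0" unfolding F0_def using w q1 by (auto intro!: conv_intros)
  have cr: "conv r0" "conv r1" "conv \<rho>" unfolding r0_def r1_def \<rho>_def
    using cF0 x g cf ce by (auto intro!: conv_intros)
  let ?E = "(fps_X - ?C (r0 - r1 * c)) ^ 2 - ?C (r1 ^ 2 * (c ^ 2 - c0))"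
  define D where "D = Abs_cps ?E"
  have D: "fps_of_cps D = ?E" unfolding D_def
    by (rule fps_of_cps_Abs) (intro biconv_intros conv_intros cr c)
  have disc: "discriminant f = D"
    by (intro discriminant_eqI is_discriminant_from_division[OF mult v dF_Q[unfolded Q_def Y_def]
        F_red[unfolded Q_def Y_def]] sigma c D mult)
  define \<phi>1 where "\<phi>1 = w 0 * q1 + fps_X ^ (2 * k - s) * (g 0 - \<rho> * e1)"
  define \<epsilon> where "\<epsilon> = \<rho> ^ 2 * (x * e1 ^ 2 - e0)"
  have x2: "x ^ 2 = fps_X ^ s * fps_X ^ (2 * k - s)"
    using k unfolding x_def by (simp add: mult.commute flip: power_mult power_add)
  have "r0 - r1 * c = F0 + x ^ 2 * (g 0 - \<rho> * e1)"
    unfolding r0_def r1_def c1 by (simp add: power2_eq_square algebra_simps)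
  also have "\<dots> = fps_X ^ s * \<phi>1"
    unfolding x2 F0_def \<phi>1_def by (simp add: algebra_simps)
  finally have \<phi>: "r0 - r1 * c = fps_X ^ s * \<phi>1" .
  have "r1 ^ 2 * (c ^ 2 - c0) = x ^ 3 * \<epsilon>"
    unfolding r1_def c0 c1 \<epsilon>_def by (simp add: power2_eq_square power3_eq_cube algebra_simps)
  also have "x ^ 3 = fps_X ^ (3 * k)" by (simp add: x_def mult.commute flip: power_mult)
  finally have E: "r1 ^ 2 * (c ^ 2 - c0) = fps_X ^ (3 * min m s) * \<epsilon>" by (simp add: k_def)
  show thesis
  proof (rule that[OF disc])
    show "conv \<phi>1" unfolding \<phi>1_def using w q1 g cr ce by (auto intro!: conv_intros)
    show "\<phi>1 $ 0 \<noteq> 0" using w0_nz q1 k by (simp add: \<phi>1_def power_0_left)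
    show "conv \<epsilon>" unfolding \<epsilon>_def using cr x ce by (auto intro!: conv_intros)
    show "fps_of_cps D = (fps_X - ?C (fps_X ^ s * \<phi>1)) ^ 2 - ?C (fps_X ^ (3 * min m s) * \<epsilon>)"
      unfolding D \<phi> E ..
    show "m < s \<longrightarrow> p1 \<noteq> 0 \<longrightarrow> \<epsilon> $ 0 \<noteq> 0"
    proof (intro impI)
      assume "m < s" "p1 \<noteq> 0"
      then have "k = m" "p1 $ 0 \<noteq> 0" using p1 by (auto simp: k_def)
      \<comment> \<open>The leading terms are e0(0) = b/3 and \<rho>(0) = 2ab/3, which gives
        \<epsilon>(0) = -(4/27) a^2 b^3.\<close>
      define a b where "a = w 0 $ 0" and "b = p1 $ 0"
      have ab: "a \<noteq> 0" "b \<noteq> 0" using w0_nz \<open>p1 $ 0 \<noteq> 0\<close> by (simp_all add: a_def b_def)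
      have f10: "f1 $ 0 = a * b"
        using \<open>m < s\<close> \<open>k = m\<close> by (simp add: f1_def p'_def q'_def power_0_left a_def b_def)
      have f30: "f3 $ 0 = a"
        by (simp only: f3_def a_def fps_add_nth fps_mult_nth_0 x(2) mult_zero_left mult_zero_right add_0_right)
      have "i $ 0 * (3 * a) = 1"
        using arg_cong[OF i(1), of "\<lambda>F. F $ 0"] by (simp only: fps_mult_nth_0 u0 a_def) simp
      then have i0: "i $ 0 = 1 / (3 * a)" using ab(1) by (simp add: eq_divide_eq)
      have e00: "e0 $ 0 = b / 3" using ab by (simp add: e0_def f10 i0)
      have \<rho>0: "\<rho> $ 0 = a * b - a * (b / 3)"
        by (simp only: \<rho>_def fps_add_nth fps_sub_nth fps_mult_nth_0 x(2) mult_zero_left add_0_right f10 f30 e00)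
      have "\<epsilon> $ 0 = - ((a * b - a * (b / 3)) ^ 2 * (b / 3))"
        by (simp only: \<epsilon>_def fps_sub_nth fps_mult_nth_0 fps_power_zeroth x(2) mult_zero_left \<rho>0 e00) simp
      moreover have "a * b - a * (b / 3) = 2 / 3 * (a * b)" by simp
      ultimately have "\<epsilon> $ 0 = - ((2 / 3 * (a * b)) ^ 2 * (b / 3))" by metis
      then show "\<epsilon> $ 0 \<noteq> 0" using ab by simp
    qed
  qed
qed

end

section \<open>Geometry of the discriminant\<close>

lemma mult0_eqI:
  assumes "cps_coeff f i j \<noteq> 0" "i + j = n" "\<And>i j. i + j < n \<Longrightarrow> cps_coeff f i j = 0"
  shows "mult0 f = n"
  unfolding mult0_def
proof (rule Least_equality)
  show "\<exists>i j. i + j = n \<and> cps_coeff f i j \<noteq> 0" using assms(1,2) by blast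
  show "n \<le> k" if "\<exists>i j. i + j = k \<and> cps_coeff f i j \<noteq> 0" for k
    using that assms(3) by (meson not_le)
qed

lemma smooth_branch_graph:
  assumes "fps_of_cps D = fps_X - fps_const \<alpha>" "conv \<alpha>" "\<alpha> $ 0 = 0"
  shows "smooth_branch D"
proof -
  interpret parametrization D fps_X \<alpha> 0 by (rule parametrization_line[OF assms])
  have c1: "cps_coeff D 0 1 \<noteq> 0" and c0: "cps_coeff D 0 0 = 0"
    using assms by (simp_all add: cps_coeff_def bicoeff_simps)
  have "D \<noteq> 0" using c1 by (auto simp: cps_coeff_def zero_cps.rep_eq bicoeff_simps)
  moreover have "\<not> D dvd 1" using c0 by (simp add: cps_unit_iff cps_coeff_def)
  ultimately have "branch D" unfolding branch_def by (rule irreducible)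
  moreover have "mult0 D = 1" by (rule mult0_eqI[OF c1]) (use c0 in auto)
  ultimately show ?thesis by (simp add: smooth_branch_def)
qed

lemma double_cover_nth:
  fixes \<phi> E :: "complex fps"
  shows "((fps_X - fps_const \<phi>) ^ 2 - fps_const E) $ 0 = \<phi> ^ 2 - E"
    and "((fps_X - fps_const \<phi>) ^ 2 - fps_const E) $ 1 = - (2 * \<phi>)"
    and "((fps_X - fps_const \<phi>) ^ 2 - fps_const E) $ 2 = 1"
    and "j > 2 \<Longrightarrow> ((fps_X - fps_const \<phi>) ^ 2 - fps_const E) $ j = 0"
proof -
  have e: "(fps_X - fps_const \<phi>) ^ 2 - fps_const E = fps_const (\<phi> ^ 2 - E) - fps_const (2 * \<phi>) * fps_X + fps_X ^ 2"
  proof -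
    have "fps_const (2 * \<phi>) = 2 * fps_const \<phi>" by (simp flip: fps_const_mult fps_const_numeral)
    then show ?thesis by (simp add: power2_eq_square algebra_simps flip: fps_const_sub fps_const_mult)
  qed
  have *: "((fps_X - fps_const \<phi>) ^ 2 - fps_const E) $ j =
      (if j = 0 then \<phi> ^ 2 - E else 0) - (if j = 1 then 2 * \<phi> else 0) + (if j = 2 then 1 else 0)" for j
    unfolding e by (simp add: fps_X_power_nth)
  show "((fps_X - fps_const \<phi>) ^ 2 - fps_const E) $ 0 = \<phi> ^ 2 - E"
    "((fps_X - fps_const \<phi>) ^ 2 - fps_const E) $ 1 = - (2 * \<phi>)"
    "((fps_X - fps_const \<phi>) ^ 2 - fps_const E) $ 2 = 1"
    "j > 2 \<Longrightarrow> ((fps_X - fps_const \<phi>) ^ 2 - fps_const E) $ j = 0"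
    unfolding * by simp_all
qed

lemma quadratic_multiple_root: "\<not> rsquarefree ([:- a, 1:] ^ 2)" for a :: complex
  unfolding rsquarefree_def using order_power_n_n[of a 2] by (metis numeral_eq_one_iff semiring_norm(85) zero_neq_numeral)

text \<open>
  The Newton polygon has the compact edge from \<open>(0, 2)\<close> to \<open>(2s, 0)\<close>, whose polynomial is a square.
\<close>

lemma double_cover_degenerate:
  assumes D: "fps_of_cps D = (fps_X - fps_const (fps_X ^ s * \<phi>1)) ^ 2 - fps_const (fps_X ^ k * \<epsilon>)"
    and \<phi>1: "\<phi>1 $ 0 \<noteq> 0" and s: "s > 0" and k: "k > 2 * s"
  shows "\<not> nondegenerate D"
proof -
  let ?c = "cps_coeff D"
  define a where "a = \<phi>1 $ 0"
  have c0: "?c i 0 = (fps_X ^ (2 * s) * \<phi>1 ^ 2) $ i - (fps_X ^ k * \<epsilon>) $ i" for i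
    unfolding cps_coeff_def bicoeff_def D double_cover_nth(1)
    by (simp add: power_mult_distrib mult.commute flip: power_mult)
  have c1: "?c i 1 = - (2 * (fps_X ^ s * \<phi>1) $ i)" for i
    unfolding cps_coeff_def bicoeff_def D double_cover_nth(2)
    by (simp add: numeral_fps_const)
  have c2: "?c i 2 = (if i = 0 then 1 else 0)" for i
    unfolding cps_coeff_def bicoeff_def D double_cover_nth(3) by simp
  have c3: "?c i j = 0" if "j > 2" for i j
    unfolding cps_coeff_def bicoeff_def D double_cover_nth(4)[OF that] by simp
  have supp: "i + s * j \<ge> 2 * s \<and> j \<le> 2" if nz: "?c i j \<noteq> 0" for i j
  proof -
    consider "j = 0" | "j = 1" | "j = 2" | "j > 2" by linarith
    then show ?thesis
    proof cases
      case 1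
      then have "i \<ge> 2 * s"
        using nz c0[of i] k by (cases "i < 2 * s") (auto simp: fps_X_power_mult_nth)
      then show ?thesis using 1 by simp
    next
      case 2
      then have "i \<ge> s" using nz c1[of i] by (cases "i < s") (auto simp: fps_X_power_mult_nth)
      then show ?thesis using 2 by simp
    qed (use nz c2 c3 in \<open>auto split: if_splits\<close>)
  qed
  \<comment> \<open>Because k > 2s, the series \<open>\<epsilon>\<close> does not reach the edge, so
    the coefficients on it are those of (v - a u^s)^2.\<close>
  have v0: "?c (2 * s) 0 = a ^ 2" using k by (simp add: c0 fps_X_power_mult_nth fps_power_zeroth a_def)
  have v1: "?c s 1 = - (2 * a)" using c1[of s] by (simp add: fps_X_power_mult_nth a_def)
  have v2: "?c 0 2 = 1" by (simp add: c2)
  have a: "a \<noteq> 0" using \<phi>1 by (simp add: a_def)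
  define S where "S = {(real i + a, real j + b) | i j a b. ?c i j \<noteq> 0 \<and> a \<ge> 0 \<and> b \<ge> 0}"
  have N: "newton_polygon D = convex hull S" by (simp add: newton_polygon_def S_def)
  \<comment> \<open>This is the inner normal of the expected edge between \<open>?P\<close> and
    \<open>?Q\<close>; its minimum 2s on the polygon exhibits the segment as a face.\<close>
  let ?n = "(1 :: real, real s)" and ?P = "(0 :: real, 2 :: real)" and ?Q = "(2 * real s, 0 :: real)"
  have S_ge: "?n \<bullet> p \<ge> 2 * real s \<and> fst p \<ge> 0 \<and> snd p \<ge> 0" if pS: "p \<in> S" for p
  proof -
    obtain i j x y where p: "p = (real i + x, real j + y)" "?c i j \<noteq> 0" "x \<ge> 0" "y \<ge> 0"
      using pS by (auto simp: S_def)
    have "real (2 * s) \<le> real (i + s * j)" using supp[OF p(2)] by (subst of_nat_le_iff) simp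
    then have "2 * real s \<le> real i + real s * real j" by simp
    moreover have "?n \<bullet> p = (real i + real s * real j) + x + real s * y"
      unfolding p(1) by (simp add: inner_prod_def algebra_simps)
    moreover have "real s * y \<ge> 0" using p by simp
    ultimately have "?n \<bullet> p \<ge> 2 * real s" using p(3) by linarith
    then show ?thesis using p by simp
  qed
  have "convex {p. ?n \<bullet> p \<ge> 2 * real s \<and> fst p \<ge> 0 \<and> snd p \<ge> 0}"
  proof -
    have eq: "{p :: real \<times> real. ?n \<bullet> p \<ge> 2 * real s \<and> fst p \<ge> 0 \<and> snd p \<ge> 0} =
        {p. ?n \<bullet> p \<ge> 2 * real s} \<inter> {p. (1, 0) \<bullet> p \<ge> 0} \<inter> {p. (0, 1) \<bullet> p \<ge> 0}"
      by (auto simp: inner_prod_def)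
    show ?thesis unfolding eq by (intro convex_Int convex_halfspace_ge)
  qed
  then have "newton_polygon D \<subseteq> {p. ?n \<bullet> p \<ge> 2 * real s \<and> fst p \<ge> 0 \<and> snd p \<ge> 0}"
    unfolding N using S_ge by (intro hull_minimal) auto
  then have N_ge: "?n \<bullet> p \<ge> 2 * real s" "fst p \<ge> 0" "snd p \<ge> 0" if "p \<in> newton_polygon D" for p
    using that by auto
  define L where "L = newton_polygon D \<inter> {p. ?n \<bullet> p = 2 * real s}"
  have face: "L face_of newton_polygon D"
    unfolding L_def using N_ge(1)
    by (intro face_of_Int_supporting_hyperplane_ge) (simp_all add: N convex_convex_hull)
  have L_eq: "L = closed_segment ?P ?Q"
  proof (intro equalityI subsetI)
    fix p assume p: "p \<in> L"
    define t where "t = fst p / (2 * real s)"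
    have e: "fst p + real s * snd p = 2 * real s" and ge: "fst p \<ge> 0" "snd p \<ge> 0"
      using p N_ge[of p] by (auto simp: L_def inner_prod_def)
    have "fst p \<le> 2 * real s" using e ge by (smt (verit) mult_nonneg_nonneg of_nat_0_le_iff)
    then have t: "0 \<le> t" "t \<le> 1" using ge s by (simp_all add: t_def)
    have "fst p = t * (2 * real s)" using s by (simp add: t_def)
    moreover from this have "real s * snd p = real s * ((1 - t) * 2)" using e by (simp add: algebra_simps)
    then have "snd p = (1 - t) * 2" using s by simp
    ultimately have "p = (1 - t) *\<^sub>R ?P + t *\<^sub>R ?Q" by (simp add: prod_eq_iff)
    then show "p \<in> closed_segment ?P ?Q" using t by (auto simp: closed_segment_def)
  next
    fix p assume p: "p \<in> closed_segment ?P ?Q"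
    have "(real 0 + 0, real 2 + 0) \<in> S" "(real (2 * s) + 0, real 0 + 0) \<in> S"
      unfolding S_def using v0 v2 a by (fastforce, fastforce)
    then have "?P \<in> newton_polygon D" "?Q \<in> newton_polygon D"
      unfolding N by (auto intro: hull_inc)
    then have "p \<in> newton_polygon D"
      using p closed_segment_subset[of ?P "newton_polygon D" ?Q] by (auto simp: N convex_convex_hull)
    moreover obtain t where "p = (1 - t) *\<^sub>R ?P + t *\<^sub>R ?Q" using p by (auto simp: closed_segment_def)
    then have "?n \<bullet> p = 2 * real s" by (simp add: inner_prod_def algebra_simps)
    ultimately show "p \<in> L" by (simp add: L_def)
  qed
  have "aff_dim L = 1" using s unfolding L_eq segment_convex_hull by (simp add: aff_dim_convex_hull)
  then have edge: "L edge_of newton_polygon D" using face by (simp add: edge_of_def)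
  have compact: "compact L" unfolding L_eq by simp
  have L_iff: "(real i, real j) \<in> L \<Longrightarrow> i + s * j = 2 * s" for i j
  proof -
    assume "(real i, real j) \<in> L"
    then have "real (i + s * j) = real (2 * s)" by (simp add: L_def inner_prod_def)
    then show ?thesis by (simp only: of_nat_eq_iff)
  qed
  have end0: "(real (2 * s), real 0) \<in> L" and end2: "(real 0, real 2) \<in> L"
    unfolding L_eq by (simp_all add: ends_in_segment)
  have mid: "(real s, real 1) \<in> L"
  proof -
    have "(real s, real 1) = (1 - 1 / 2) *\<^sub>R ?P + (1 / 2) *\<^sub>R ?Q" by simp
    then show ?thesis unfolding L_eq closed_segment_def by (intro CollectI exI[of _ "1/2"]) simp
  qed
  have j0: "(LEAST j. \<exists>i. (real i, real j) \<in> L) = 0"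
    by (rule Least_equality, rule exI, rule end0) simp
  have "{(i, j). (real i, real j) \<in> L \<and> ?c i j \<noteq> 0} = {(2 * s, 0), (s, 1), (0, 2)}"
  proof (intro equalityI subsetI)
    fix p assume "p \<in> {(i, j). (real i, real j) \<in> L \<and> ?c i j \<noteq> 0}"
    then obtain i j where p: "p = (i, j)" "(real i, real j) \<in> L" "?c i j \<noteq> 0" by blast
    have "i + s * j = 2 * s" "j \<le> 2" using L_iff[OF p(2)] supp[OF p(3)] by auto
    moreover from this(2) have "j = 0 \<or> j = 1 \<or> j = 2" by linarith
    ultimately show "p \<in> {(2 * s, 0), (s, 1), (0, 2)}" using p(1) by auto
  next
    fix p :: "nat \<times> nat" assume "p \<in> {(2 * s, 0), (s, 1), (0, 2)}"
    then show "p \<in> {(i, j). (real i, real j) \<in> L \<and> ?c i j \<noteq> 0}"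
      using end0 end2 mid v0 v1 v2 a by auto
  qed
  then have "edge_polynomial D L = monom (a ^ 2) 0 + monom (- (2 * a)) 1 + monom 1 2"
    unfolding edge_polynomial_def Let_def j0 using s v0 v1 v2 by simp
  also have "\<dots> = [:- a, 1:] ^ 2"
    by (simp add: power2_eq_square monom_altdef)
  finally have "\<not> rsquarefree (edge_polynomial D L)" using quadratic_multiple_root by metis
  then show ?thesis unfolding nondegenerate_def using edge compact by blast
qed

text \<open>For an even exponent the square root of \<open>E\<close> is the convergent series u^l e,
  so the zero set consists of two graphs. Restricting the second equation to the first graph gives 2
  u^l e, of order \<open>l\<close>.\<close>

lemma double_cover_split:
  assumes D: "fps_of_cps D = (fps_X - fps_const \<phi>) ^ 2 - fps_const (fps_X ^ (2 * l) * \<epsilon>)"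
    and \<phi>: "conv \<phi>" "\<phi> $ 0 = 0" and \<epsilon>: "conv \<epsilon>" "\<epsilon> $ 0 \<noteq> 0" and l: "l > 0"
  shows "\<exists>D1 D2. D = D1 * D2 \<and> smooth_branch D1 \<and> smooth_branch D2 \<and> intersection_number D1 D2 = enat l"
proof -
  obtain e where e: "conv e" "e ^ 2 = \<epsilon>" "e $ 0 \<noteq> 0" using conv_root[of \<epsilon> 2] \<epsilon> by auto
  define \<kappa> where "\<kappa> = fps_X ^ l * e"
  have \<kappa>: "conv \<kappa>" "\<kappa> $ 0 = 0" using e l by (auto simp: \<kappa>_def intro!: conv_intros)
  have "fps_X ^ (2 * l) * \<epsilon> = \<kappa> ^ 2"
    by (simp add: \<kappa>_def e(2)[symmetric] power_mult_distrib mult.commute flip: power_mult)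
  then have D': "fps_of_cps D = (fps_X - fps_const (\<phi> + \<kappa>)) * (fps_X - fps_const (\<phi> - \<kappa>))"
    unfolding D by (simp add: power2_eq_square algebra_simps flip: fps_const_add fps_const_sub fps_const_mult)
  have c: "conv (\<phi> + \<kappa>)" "(\<phi> + \<kappa>) $ 0 = 0" "conv (\<phi> - \<kappa>)" "(\<phi> - \<kappa>) $ 0 = 0"
    using \<phi> \<kappa> by (auto intro!: conv_intros)
  define D1 where "D1 = Abs_cps (fps_X - fps_const (\<phi> + \<kappa>))"
  define D2 where "D2 = Abs_cps (fps_X - fps_const (\<phi> - \<kappa>))"
  have D1: "fps_of_cps D1 = fps_X - fps_const (\<phi> + \<kappa>)"
    unfolding D1_def by (intro fps_of_cps_Abs biconv_intros c)
  have D2: "fps_of_cps D2 = fps_X - fps_const (\<phi> - \<kappa>)"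
    unfolding D2_def by (intro fps_of_cps_Abs biconv_intros c)
  interpret parametrization D1 fps_X "\<phi> + \<kappa>" 0 by (rule parametrization_line[OF D1 c(1,2)])
  have "pull D2 = fps_X ^ l * (2 * e)"
    unfolding pull_def D2 using c by (simp add: arc_diff arc_Y arc_const \<kappa>_def)
  moreover have "2 * e \<noteq> 0" "subdegree (2 * e) = 0"
    using e by (auto simp: subdegree_eq_0_iff numeral_fps_const)
  ultimately have p: "pull D2 \<noteq> 0" "subdegree (pull D2) = l" by simp_all
  then have "\<not> D1 dvd D2" using kernel[of D2] by (simp add: pull_def)
  then have "intersection_number D1 D2 = enat l" using intersection_number_eq p by simp
  moreover have "D = D1 * D2" by (simp add: cps_eq_iff times_cps.rep_eq D' D1 D2)
  ultimately show ?thesis using smooth_branch_graph[OF D1 c(1,2)] smooth_branch_graph[OF D2 c(3,4)] by blast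
qed

text \<open>The parametrization with u = t^2 gives both irreducibility and the semigroup. The
  generators are minimal, since a proper subset generates only multiples of 2 or only multiples of
  k, while k is odd and exceeds 2.\<close>

lemma double_cover_branch:
  assumes D: "fps_of_cps D = (fps_X - fps_const \<phi>) ^ 2 - fps_const (fps_X ^ k * \<epsilon>)"
    and \<phi>: "conv \<phi>" "\<phi> $ 0 = 0" and \<epsilon>: "conv \<epsilon>" "\<epsilon> $ 0 \<noteq> 0" and k: "odd k" "k > 2"
  shows "branch D \<and> has_semigroup D [2, k]"
proof -
  obtain d where d: "conv d" "d ^ 2 = \<epsilon>" "d $ 0 \<noteq> 0" using conv_root[of \<epsilon> 2] \<epsilon> by auto
  have D': "fps_of_cps D = (fps_X - fps_const \<phi>) ^ 2 - fps_const (fps_X ^ k * d ^ 2)" using D d by simp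
  note par = parametrization_double[OF D' \<phi> d(1,3) k(1)]
  interpret parametrization D "fps_X ^ 2" "ram 2 \<phi> + fps_X ^ k * ram 2 d" k by (rule par(1))
  have c0: "cps_coeff D i 0 = (\<phi> ^ 2 - fps_X ^ k * \<epsilon>) $ i" for i
    unfolding cps_coeff_def bicoeff_def D double_cover_nth(1) ..
  have c1: "cps_coeff D i 1 = - (2 * \<phi> $ i)" for i
    unfolding cps_coeff_def bicoeff_def D double_cover_nth(2) by (simp add: numeral_fps_const)
  have c2: "cps_coeff D 0 2 \<noteq> 0"
    unfolding cps_coeff_def bicoeff_def D double_cover_nth(3) by simp
  have low: "cps_coeff D i j = 0" if "i + j < 2" for i j
  proof -
    have "i = 0 \<and> j = 0 \<or> i = 1 \<and> j = 0 \<or> i = 0 \<and> j = 1" using that by linarith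
    then show ?thesis
      using \<phi>(2) k c0[of 0] c0[of 1] c1[of 0]
      by (auto simp: power2_eq_square fps_mult_nth fps_X_power_mult_nth)
  qed
  have mult: "mult0 D = 2" by (rule mult0_eqI[OF c2]) (use low in auto)
  have "D \<noteq> 0" using c2 by (auto simp: cps_coeff_def zero_cps.rep_eq bicoeff_simps)
  moreover have "\<not> D dvd 1" using low[of 0 0] by (simp add: cps_unit_iff cps_coeff_def)
  ultimately have branch: "branch D" unfolding branch_def by (rule irreducible)
  have semi: "value_semigroup D = {2 * i + k * j | i j. True}"
    using value_semigroup_eq par(2) by simp
  have mem: "2 \<in> value_semigroup D" "k \<in> value_semigroup D"
    unfolding semi by (intro CollectI exI[of _ 1] exI[of _ 0], simp, intro CollectI exI[of _ 0] exI[of _ 1], simp)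
  have div: "q dvd x" if "x \<in> generated_semigroup G" "\<And>g. g \<in> G \<Longrightarrow> q dvd g" for q x :: nat and G
    using that by (auto simp: generated_semigroup_def intro!: dvd_sum)
  have "value_semigroup D \<noteq> generated_semigroup G" if G: "G \<subset> set [2, k]" for G
  proof
    assume eq: "value_semigroup D = generated_semigroup G"
    have "G \<subseteq> {2} \<or> G \<subseteq> {k}" using G by auto
    then show False
    proof
      assume "G \<subseteq> {2}"
      then have "2 dvd k" using mem(2) unfolding eq by (intro div[of k G 2]) auto
      then show False using k(1) by simp
    next
      assume "G \<subseteq> {k}"
      then have "k dvd 2" using mem(1) unfolding eq by (intro div[of 2 G k]) auto
      then show False using k(2) by (auto dest: dvd_imp_le)
    qed
  qed
  moreover have "value_semigroup D = generated_semigroup (set [2, k])"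
    unfolding generated_semigroup_two[OF k(2)] by (rule semi)
  ultimately have "has_semigroup D [2, k]"
    unfolding has_semigroup_def using mult k(2) by simp
  with branch show ?thesis ..
qed

section \<open>Homeomorphisms between discriminants\<close>

lemma common_conv_radius:
  assumes "finite A" "\<And>a. a \<in> A \<Longrightarrow> conv a"
  obtains \<rho> :: real where "\<rho> > 0" "\<And>a. a \<in> A \<Longrightarrow> ereal \<rho> < fps_conv_radius a"
proof -
  have "\<exists>\<rho>>0. \<forall>a\<in>A. ereal \<rho> < fps_conv_radius a"
    using assms
  proof (induction A rule: finite_induct)
    case empty
    show ?case by (intro exI[of _ 1]) simp
  next
    case (insert a A)
    then obtain \<rho> where \<rho>: "\<rho> > 0" "\<forall>a\<in>A. ereal \<rho> < fps_conv_radius a" by blast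
    obtain \<rho>' where \<rho>': "0 < \<rho>'" "ereal \<rho>' < fps_conv_radius a"
      using ereal_dense2[of 0 "fps_conv_radius a"] insert.prems by auto
    have "ereal (min \<rho> \<rho>') < fps_conv_radius b" if "b \<in> insert a A" for b
    proof (cases "b = a")
      case True
      have "ereal (min \<rho> \<rho>') \<le> ereal \<rho>'" by simp
      then show ?thesis using \<rho>'(2) unfolding True by (rule le_less_trans)
    next
      case False
      then have "ereal \<rho> < fps_conv_radius b" using that \<rho>(2) by blast
      moreover have "ereal (min \<rho> \<rho>') \<le> ereal \<rho>" by simp
      ultimately show ?thesis by (rule le_less_trans[rotated])
    qed
    then show ?case using \<rho>(1) \<rho>'(1) by (intro exI[of _ "min \<rho> \<rho>'"]) simp
  qed
  then show thesis using that by blast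
qed

text \<open>Only three columns of coefficients are nonzero, and each is an absolutely convergent
  one-variable series times a power of v.\<close>

lemma has_sum_degree_two:
  assumes F: "\<And>j. j > 2 \<Longrightarrow> F $ j = 0" and u: "\<And>j. j \<le> 2 \<Longrightarrow> norm u < fps_conv_radius (F $ j)"
  shows "((\<lambda>(i, j). bicoeff F i j * u ^ i * v ^ j) has_sum
    (eval_fps (F $ 0) u + eval_fps (F $ 1) u * v + eval_fps (F $ 2) u * v ^ 2)) UNIV"
proof -
  let ?t = "\<lambda>(i, j). bicoeff F i j * u ^ i * v ^ j"
  have col: "(?t has_sum (eval_fps (F $ j) u * v ^ j)) ((\<lambda>i. (i, j)) ` UNIV)" if "j \<le> 2" for j
  proof -
    have "((\<lambda>i. F $ j $ i * u ^ i) has_sum eval_fps (F $ j) u) UNIV"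
      using u[OF that] by (intro norm_summable_imp_has_sum norm_summable_fps sums_eval_fps)
    then have "((\<lambda>i. F $ j $ i * u ^ i * v ^ j) has_sum (eval_fps (F $ j) u * v ^ j)) UNIV"
      by (rule has_sum_cmult_left)
    then show ?thesis
      by (subst has_sum_reindex) (auto simp: inj_on_def o_def bicoeff_def)
  qed
  have "(?t has_sum (eval_fps (F $ 0) u * v ^ 0 + eval_fps (F $ 1) u * v ^ 1 + eval_fps (F $ 2) u * v ^ 2))
      ((\<lambda>i. (i, 0)) ` UNIV \<union> (\<lambda>i. (i, 1)) ` UNIV \<union> (\<lambda>i. (i, 2)) ` UNIV)"
    by (intro has_sum_Un_disjoint col) auto
  also have "?this \<longleftrightarrow> (?t has_sum (eval_fps (F $ 0) u * v ^ 0 + eval_fps (F $ 1) u * v ^ 1 + eval_fps (F $ 2) u * v ^ 2)) UNIV"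
  proof (rule has_sum_cong_neutral)
    fix p :: "nat \<times> nat"
    assume p: "p \<in> UNIV - ((\<lambda>i. (i, 0)) ` UNIV \<union> (\<lambda>i. (i, 1)) ` UNIV \<union> (\<lambda>i. (i, 2)) ` UNIV)"
    obtain i j where ij: "p = (i, j)" by (cases p)
    have "j \<noteq> 0" "j \<noteq> 1" "j \<noteq> 2" using p ij by auto
    then have "F $ j = 0" by (intro F) linarith
    then show "?t p = 0" by (simp add: ij bicoeff_def)
  qed auto
  finally show ?thesis by simp
qed

text \<open>
  The map \<open>(u, v) \<mapsto> (u, \<phi>'(u) + (v - \<phi>(u)) r(u))\<close> sends the zeros of \<open>(v - \<phi>)\<^sup>2 - E\<close> to those of
  \<open>(v - \<phi>')\<^sup>2 - r\<^sup>2 E\<close>.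
\<close>

lemma double_cover_same_topological_type:
  assumes D: "fps_of_cps D = (fps_X - fps_const \<phi>) ^ 2 - fps_const E"
    and D': "fps_of_cps D' = (fps_X - fps_const \<phi>') ^ 2 - fps_const E'"
    and conv: "conv \<phi>" "conv \<phi>'" "conv E" "conv E'" "conv r"
    and zero: "\<phi> $ 0 = 0" "\<phi>' $ 0 = 0" "r $ 0 \<noteq> 0" and E': "E' = r ^ 2 * E"
  shows "same_topological_type D D'"
proof -
  define q where "q = inverse r"
  have q: "conv q" "r * q = 1" using conv(5) zero(3) by (auto simp: q_def inverse_mult_eq_1' intro: conv_intros)
  \<comment> \<open>Besides the given series this collects the coefficient series and the
    intermediate products, since evaluation is multiplicative only inside the radii of all
    factors.\<close>
  define As where "As = {\<phi>, \<phi>', E, E', r, q, \<phi> ^ 2 - E, \<phi>' ^ 2 - E', - (2 * \<phi>), - (2 * \<phi>'), 1, \<phi> ^ 2, \<phi>' ^ 2, r ^ 2}"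
  have "conv a" if "a \<in> As" for a
    using that conv q conv_numeral[of "num.Bit0 num.One"] unfolding As_def by (auto intro!: conv_intros)
  then obtain \<rho> where \<rho>: "\<rho> > 0" "\<And>a. a \<in> As \<Longrightarrow> ereal \<rho> < fps_conv_radius a"
    using common_conv_radius[of As] by (auto simp: As_def)
  \<comment> \<open>Both equations are polynomial in v, so convergence restricts only u; this
    cylinder is also preserved by both maps below.\<close>
  define U where "U = ball (0 :: complex) \<rho> \<times> (UNIV :: complex set)"
  have rad: "ereal (norm u) < fps_conv_radius a" if "u \<in> ball 0 \<rho>" "a \<in> As" for u a
  proof -
    have "ereal (norm u) < ereal \<rho>" using that(1) by simp
    then show ?thesis using \<rho>(2)[OF that(2)] by (rule less_trans)
  qed
  have nth: "fps_of_cps D $ j \<in> As" "fps_of_cps D' $ j \<in> As" if "j \<le> 2" for j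
  proof -
    have "j = 0 \<or> j = 1 \<or> j = 2" using that by linarith
    then show "fps_of_cps D $ j \<in> As" "fps_of_cps D' $ j \<in> As"
      unfolding D D' As_def by (elim disjE; simp only: double_cover_nth; simp)+
  qed
  have sum: "((\<lambda>(i, j). cps_coeff D i j * u ^ i * v ^ j) has_sum
      ((v - eval_fps \<phi> u) ^ 2 - eval_fps E u)) UNIV"
    "((\<lambda>(i, j). cps_coeff D' i j * u ^ i * v ^ j) has_sum
      ((v - eval_fps \<phi>' u) ^ 2 - eval_fps E' u)) UNIV" if u: "u \<in> ball 0 \<rho>" for u v
  proof -
    have e: "eval_fps (\<psi> ^ 2 - H) u + eval_fps (- (2 * \<psi>)) u * v + eval_fps 1 u * v ^ 2 =
        (v - eval_fps \<psi> u) ^ 2 - eval_fps H u" if "\<psi> \<in> As" "H \<in> As" "\<psi> ^ 2 \<in> As" "- (2 * \<psi>) \<in> As" for \<psi> H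
    proof -
      have "eval_fps (\<psi> ^ 2 - H) u = eval_fps \<psi> u ^ 2 - eval_fps H u"
        using rad[OF u] that by (simp add: eval_fps_diff eval_fps_power)
      moreover have "eval_fps (- (2 * \<psi>)) u = - (2 * eval_fps \<psi> u)"
      proof -
        have "ereal (norm u) < fps_conv_radius (2 * \<psi>)" using rad[OF u that(4)] by simp
        then show ?thesis using rad[OF u that(1)] by (simp add: eval_fps_minus eval_fps_mult)
      qed
      ultimately show ?thesis by (simp add: power2_eq_square algebra_simps)
    qed
    have hs: "((\<lambda>(i, j). cps_coeff H i j * u ^ i * v ^ j) has_sum ((v - eval_fps \<psi> u) ^ 2 - eval_fps K u)) UNIV"
      if H: "fps_of_cps H = (fps_X - fps_const \<psi>) ^ 2 - fps_const K" and "\<And>j. j \<le> 2 \<Longrightarrow> fps_of_cps H $ j \<in> As"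
        and "\<psi> \<in> As" "K \<in> As" "\<psi> ^ 2 \<in> As" "- (2 * \<psi>) \<in> As" for H \<psi> K
    proof -
      have "fps_of_cps H $ 0 = \<psi> ^ 2 - K" "fps_of_cps H $ 1 = - (2 * \<psi>)" "fps_of_cps H $ 2 = 1"
        unfolding H by (rule double_cover_nth)+
      moreover have "((\<lambda>(i, j). bicoeff (fps_of_cps H) i j * u ^ i * v ^ j) has_sum
        (eval_fps (fps_of_cps H $ 0) u + eval_fps (fps_of_cps H $ 1) u * v + eval_fps (fps_of_cps H $ 2) u * v ^ 2)) UNIV"
      proof (rule has_sum_degree_two)
        show "fps_of_cps H $ j = 0" if "j > 2" for j unfolding H using that by (rule double_cover_nth)
        show "ereal (norm u) < fps_conv_radius (fps_of_cps H $ j)" if "j \<le> 2" for j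
          by (rule rad[OF u], rule \<open>\<And>j. j \<le> 2 \<Longrightarrow> fps_of_cps H $ j \<in> As\<close>[OF that])
      qed
      ultimately show ?thesis using e[OF that(3-6)] by (simp only: cps_coeff_def)
    qed
    show "((\<lambda>(i, j). cps_coeff D i j * u ^ i * v ^ j) has_sum
      ((v - eval_fps \<phi> u) ^ 2 - eval_fps E u)) UNIV"
      by (rule hs[OF D nth(1)]) (simp_all add: As_def)
    show "((\<lambda>(i, j). cps_coeff D' i j * u ^ i * v ^ j) has_sum
      ((v - eval_fps \<phi>' u) ^ 2 - eval_fps E' u)) UNIV"
      by (rule hs[OF D' nth(2)]) (simp_all add: As_def)
  qed
  have eval: "cps_eval D (u, v) = (v - eval_fps \<phi> u) ^ 2 - eval_fps E u"
    "cps_eval D' (u, v) = (v - eval_fps \<phi>' u) ^ 2 - eval_fps E' u" if "u \<in> ball 0 \<rho>" for u v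
    using sum[OF that, of v] by (simp_all add: cps_eval_def infsumI)
  have rq: "eval_fps r u * eval_fps q u = 1" if u: "u \<in> ball 0 \<rho>" for u
    using rad[OF u] eval_fps_mult[of u r q] by (simp add: q(2) As_def)
  have E'u: "eval_fps E' u = eval_fps r u ^ 2 * eval_fps E u" if u: "u \<in> ball 0 \<rho>" for u
  proof -
    have "r \<in> As" "E \<in> As" "r ^ 2 \<in> As" by (auto simp: As_def)
    then show ?thesis using rad[OF u] unfolding E' by (simp add: eval_fps_mult eval_fps_power)
  qed
  define \<Phi> where "\<Phi> = (\<lambda>(u, v). (u, eval_fps \<phi>' u + (v - eval_fps \<phi> u) * eval_fps r u))"
  define \<Psi> where "\<Psi> = (\<lambda>(u, v). (u, eval_fps \<phi> u + (v - eval_fps \<phi>' u) * eval_fps q u))"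
  have maps: "\<Phi> p \<in> U" "\<Psi> p \<in> U" "\<Psi> (\<Phi> p) = p" "\<Phi> (\<Psi> p) = p" if pU: "p \<in> U" for p
  proof -
    obtain u v where p: "p = (u, v)" and u: "u \<in> ball 0 \<rho>" using pU by (auto simp: U_def)
    show "\<Phi> p \<in> U" "\<Psi> p \<in> U" using u by (auto simp: p \<Phi>_def \<Psi>_def U_def)
    show "\<Psi> (\<Phi> p) = p" "\<Phi> (\<Psi> p) = p"
      using rq[OF u] by (simp_all add: p \<Phi>_def \<Psi>_def mult.assoc mult.commute[of "eval_fps q u"])
  qed
  have cont: "continuous_on U (\<lambda>p. eval_fps a (fst p))" if "a \<in> As" for a
  proof (rule continuous_on_eval_fps')
    show "fst ` U \<subseteq> eball 0 (fps_conv_radius a)" using rad[OF _ that] by (auto simp: U_def in_eball_iff)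
  qed (intro continuous_intros)
  have hom: "homeomorphism U U \<Phi> \<Psi>"
  proof (rule homeomorphismI)
    have "\<phi> \<in> As" "\<phi>' \<in> As" "r \<in> As" "q \<in> As" by (auto simp: As_def)
    note c = this[THEN cont]
    show "continuous_on U \<Phi>" unfolding \<Phi>_def case_prod_unfold by (intro continuous_intros c)
    show "continuous_on U \<Psi>" unfolding \<Psi>_def case_prod_unfold by (intro continuous_intros c)
  qed (use maps in auto)
  have zeros: "cps_eval D' (\<Phi> p) = 0 \<longleftrightarrow> cps_eval D p = 0" if pU: "p \<in> U" for p
  proof -
    obtain u v where p: "p = (u, v)" and u: "u \<in> ball 0 \<rho>" using pU by (auto simp: U_def)
    have "cps_eval D' (\<Phi> p) = eval_fps r u ^ 2 * cps_eval D p"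
      unfolding p \<Phi>_def by (simp add: eval[OF u] E'u[OF u] power2_eq_square algebra_simps)
    moreover have "eval_fps r u \<noteq> 0" using rq[OF u] by auto
    ultimately show ?thesis by simp
  qed
  have "\<Phi> ` {p \<in> U. cps_eval D p = 0} = {q \<in> U. cps_eval D' q = 0}"
  proof (intro equalityI subsetI)
    fix z assume "z \<in> \<Phi> ` {p \<in> U. cps_eval D p = 0}"
    then show "z \<in> {q \<in> U. cps_eval D' q = 0}" using maps zeros by auto
  next
    fix z assume z: "z \<in> {q \<in> U. cps_eval D' q = 0}"
    then have "\<Psi> z \<in> U" "\<Phi> (\<Psi> z) = z" using maps by auto
    then have "cps_eval D (\<Psi> z) = 0" using zeros[of "\<Psi> z"] z by simp
    then show "z \<in> \<Phi> ` {p \<in> U. cps_eval D p = 0}"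
      using \<open>\<Psi> z \<in> U\<close> \<open>\<Phi> (\<Psi> z) = z\<close> by (metis (mono_tags, lifting) image_eqI mem_Collect_eq)
  qed
  moreover have "cps_converges_on D U" "cps_converges_on D' U"
    unfolding cps_converges_on_def U_def
    using sum(1)[THEN has_sum_imp_summable] sum(2)[THEN has_sum_imp_summable] by auto
  moreover have "\<Phi> 0 = 0" by (simp add: \<Phi>_def zero_prod_def eval_fps_at_0 zero)
  moreover have "open U" "0 \<in> U" using \<rho>(1) by (auto simp: U_def zero_prod_def intro: open_Times)
  ultimately show ?thesis using hom unfolding same_topological_type_def by blast
qed

section \<open>Normal form for vanishing Zariski invariant\<close>

lemma arc_X_0_nth: "arc F fps_X 0 $ i = bicoeff F i 0"
proof -
  have "arc F fps_X 0 $ i = (\<Sum>k\<le>i. \<Sum>l\<le>i. if l = 0 then (if k = i then bicoeff F i 0 else 0) else 0)"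
    unfolding arc_def fps_nth_Abs_fps
    by (intro sum.cong refl) (auto simp: power_0_left fps_X_power_nth)
  also have "\<dots> = (\<Sum>k\<le>i. if k = i then bicoeff F i 0 else 0)"
    by (intro sum.cong refl) (simp add: sum.delta)
  also have "\<dots> = bicoeff F i 0" by (simp add: sum.delta)
  finally show ?thesis .
qed

lemma binomial_second_order:
  fixes z :: "'a::comm_ring_1"
  shows "\<exists>h. (1 + z) ^ n = 1 + of_nat n * z + z ^ 2 * h"
proof (induction n)
  case 0
  show ?case by (intro exI[of _ 0]) simp
next
  case (Suc n)
  then obtain h where "(1 + z) ^ n = 1 + of_nat n * z + z ^ 2 * h" by blast
  then have "(1 + z) ^ Suc n = 1 + of_nat (Suc n) * z + z ^ 2 * (of_nat n + h + z * h)"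
    by (simp add: power2_eq_square algebra_simps)
  then show ?case by blast
qed

text \<open>The factor d is a cube root of 1 + c t^(s-3). To first order d is 1 + (c/3) t^(s-3), so
  T^s = (t d)^s changes by (s c/3) t^(2s-3) in leading order; this coefficient is the parameter used
  to remove a term later.\<close>

lemma cubic_reparametrization:
  assumes s: "s \<ge> 4"
  obtains d G where "conv d" "d $ 0 = 1" "conv G" "G $ 0 = of_nat s * (c / 3)"
    "(fps_X * d) ^ 3 = fps_X ^ 3 + fps_const c * fps_X ^ s"
    "(fps_X * d) ^ s = fps_X ^ s + fps_X ^ (2 * s - 3) * G"
proof -
  let ?e = "1 + fps_const c * fps_X ^ (s - 3) :: complex fps"
  have "conv ?e" "?e $ 0 \<noteq> 0" using s by (auto intro!: conv_intros)
  then obtain d0 where d0: "conv d0" "d0 ^ 3 = ?e" "d0 $ 0 \<noteq> 0" using conv_root[of ?e 3] by auto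
  have "(d0 $ 0) ^ 3 = 1"
    using arg_cong[OF d0(2), of "\<lambda>a. a $ 0"] s by (simp add: fps_power_zeroth)
  \<comment> \<open>The constant term of \<open>d0\<close> is a cube root of unity; dividing by it
    leaves the cube unchanged and makes the constant term 1.\<close>
  define d where "d = fps_const (inverse (d0 $ 0)) * d0"
  have d: "conv d" "d $ 0 = 1" using d0 by (auto simp: d_def intro!: conv_intros)
  have "d ^ 3 = fps_const (inverse ((d0 $ 0) ^ 3)) * ?e"
    by (simp add: d_def power_mult_distrib d0(2) power_inverse fps_const_power)
  then have d3: "d ^ 3 = ?e" using \<open>(d0 $ 0) ^ 3 = 1\<close> by simp
  define \<eta> where "\<eta> = d - 1"
  define q where "q = 3 + 3 * \<eta> + \<eta> ^ 2"
  have q: "conv q" "q $ 0 = 3" unfolding q_def \<eta>_def using d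
    by (auto intro!: conv_intros conv_numeral simp: power2_eq_square numeral_fps_const)
  define i where "i = inverse q"
  have i: "conv i" "q * i = 1" "i $ 0 = 1 / 3"
  proof -
    show "conv i" unfolding i_def using q by (auto intro: conv_intros)
    show qi: "q * i = 1" unfolding i_def using q by (simp add: inverse_mult_eq_1')
    have "3 * i $ 0 = 1" using arg_cong[OF qi, of "\<lambda>a. a $ 0"] q by simp
    then show "i $ 0 = 1 / 3" by (simp add: eq_divide_eq mult.commute)
  qed
  define g where "g = fps_const c * i"
  have g: "conv g" "g $ 0 = c / 3" using i by (auto simp: g_def intro!: conv_intros)
  have "\<eta> * q = d ^ 3 - 1"
    by (simp add: \<eta>_def q_def power2_eq_square power3_eq_cube algebra_simps)
  also have "\<dots> = fps_const c * fps_X ^ (s - 3)" by (simp add: d3)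
  finally have \<eta>q: "\<eta> * q = fps_const c * fps_X ^ (s - 3)" .
  have "\<eta> = \<eta> * q * i" using i by (simp add: mult.assoc)
  also have "\<dots> = fps_X ^ (s - 3) * g" unfolding \<eta>q g_def by (simp only: mult_ac)
  finally have \<eta>: "\<eta> = fps_X ^ (s - 3) * g" .
  obtain h where h: "(1 + \<eta>) ^ s = 1 + of_nat s * \<eta> + \<eta> ^ 2 * h"
    using binomial_second_order by blast
  define G where "G = of_nat s * g + fps_X ^ (s - 3) * (g ^ 2 * h)"
  have ds: "d ^ s = 1 + fps_X ^ (s - 3) * G"
  proof -
    have "d = 1 + \<eta>" by (simp add: \<eta>_def)
    then have "d ^ s = 1 + of_nat s * \<eta> + \<eta> ^ 2 * h" using h by simp
    then show ?thesis by (simp add: \<eta> G_def power2_eq_square algebra_simps)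
  qed
  \<comment> \<open>The series \<open>h\<close> comes from a purely algebraic expansion, so
    convergence of \<open>G\<close> is obtained from d^s - 1 instead.\<close>
  have G_shift: "G = fps_shift (s - 3) (d ^ s - 1)"
    unfolding ds by (simp add: fps_shift_times_fps_X_power[of "s - 3", symmetric] mult.commute[of "fps_X ^ (s - 3)"])
  show thesis
  proof (rule that[OF d])
    show "conv G" unfolding G_shift using d by (intro conv_intros)
    show "G $ 0 = of_nat s * (c / 3)" using s g by (simp add: G_def fps_of_nat[symmetric])
    have "fps_X ^ 3 * fps_X ^ (s - 3) = (fps_X ^ s :: complex fps)" using s by (simp flip: power_add)
    then show "(fps_X * d) ^ 3 = fps_X ^ 3 + fps_const c * fps_X ^ s"
      unfolding power_mult_distrib d3 by (simp add: distrib_left mult.left_commute)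
    have "s + (s - 3) = 2 * s - 3" using s by simp
    then have "fps_X ^ s * fps_X ^ (s - 3) = (fps_X ^ (2 * s - 3) :: complex fps)" by (simp only: power_add[symmetric])
    then show "(fps_X * d) ^ s = fps_X ^ s + fps_X ^ (2 * s - 3) * G"
      unfolding power_mult_distrib ds by (simp add: distrib_left mult.assoc[symmetric])
  qed
qed

text \<open>Here p1 = 0 and B = 0, with A = 1 and q1 = -1; choosing m = s satisfies the inequality
  3m > 2s.\<close>

lemma quasihomogeneous_cubic_branch:
  assumes s: "s \<ge> 4" "\<not> 3 dvd s"
  shows "cubic_branch (cps_Y ^ 3 - cps_X ^ s) 1 0 0 (- 1) 1 0 s s"
proof
  show "fps_of_cps (cps_Y ^ 3 - cps_X ^ s) = 1 * ((fps_X - fps_const 0) ^ 3 +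
      fps_const (fps_X ^ s * 0) * (fps_X - fps_const 0) + fps_const (fps_X ^ s * (- 1)))"
    by (simp add: cps_rep flip: fps_const_neg)
qed (use s in \<open>auto simp: bicoeff_simps\<close>)

context cubic_branch
begin

text \<open>
  Here \<open>y\<close> differs from \<open>\<sigma>(t\<^sup>3) + t\<^sup>s A(t\<^sup>3)\<close> by terms of order at least \<open>2s\<close> and a multiple of \<open>t\<^bsup>2s-3\<^esup>\<close>.
  The reparametrization \<open>T\<^sup>3 = t\<^sup>3 + c t\<^sup>s\<close>, which is induced by replacing \<open>x\<close> with \<open>x + c y\<close>,
  changes the coefficient of \<open>t\<^bsup>2s-3\<^esup>\<close>, and \<open>c\<close> is chosen to cancel it.
\<close>

theorem analytically_equivalent_quasihomogeneous:
  assumes flat: "p1 = 0 \<or> m + 1 \<ge> s"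
  shows "analytically_equivalent f (cps_Y ^ 3 - cps_X ^ s)"
proof -
  let ?X3 = "fps_X ^ 3 :: complex fps" and ?Xs = "fps_X ^ s :: complex fps"
  have X3: "?X3 $ 0 = 0" and Xs: "?Xs $ 0 = 0" using s by simp_all
  \<comment> \<open>The flatness hypothesis gives either B = 0, and then V = 0, or 3m - s >= 2s - 3;
    in both cases t^(2s-3) divides \<open>V\<close>.\<close>
  define V2 where "V2 = fps_shift (2 * s - 3) V"
  have V2: "V = fps_X ^ (2 * s - 3) * V2"
  proof -
    have "V $ i = 0" if i: "i < 2 * s - 3" for i
    proof (cases "p1 = 0")
      case True
      then have "3 * A * B = 0" using AB by simp
      moreover have "A \<noteq> 0" using A by auto
      ultimately have "B = 0" by simp
      then show ?thesis unfolding V_def by (simp add: ram_0)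
    next
      case False
      then have "i < 3 * m - s" using flat i by linarith
      then show ?thesis by (rule UV_nth)
    qed
    then show ?thesis unfolding V2_def by (intro fps_ext) (simp add: fps_X_power_mult_nth)
  qed
  define b where "b = V2 $ 0"
  \<comment> \<open>This solves A(0) s c/3 + b = 0, so the contribution of the reparametrized
    \<open>U\<close> cancels the first coefficient of \<open>V2\<close>.\<close>
  define c where "c = - 3 * b / (of_nat s * A $ 0)"
  obtain d G where d: "conv d" "d $ 0 = 1" and G: "conv G" "G $ 0 = of_nat s * (c / 3)"
    and T3: "(fps_X * d) ^ 3 = ?X3 + fps_const c * ?Xs"
    and Ts: "(fps_X * d) ^ s = ?Xs + fps_X ^ (2 * s - 3) * G"
    by (rule cubic_reparametrization[OF s(1), of c])
  define T where "T = fps_X * d"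
  have T: "conv T" "T $ 0 = 0" using d by (auto simp: T_def intro!: conv_intros)
  note comp = fps_compose_add_distrib fps_compose_mult_distrib[OF T(2)] fps_compose_power[OF T(2), symmetric]
  define lin where "lin = bi_X + bi_const c * fps_X"
  have lin: "biconvergent lin" "lin \<in> adic (Suc 0)"
    unfolding lin_def by (auto intro!: biconv_intros simp: adic_1_iff bicoeff_simps bicoeff_const_mult)
  have arc_lin: "arc lin u v = u + fps_const c * v" if "u $ 0 = 0" "v $ 0 = 0" for u v
    using that by (simp add: lin_def arc_add arc_mult arc_Y arc_const)
  define R where "R = fps_compose A (T ^ 3) * G + d ^ (2 * s - 3) * fps_compose V2 T"
  define Rm where "Rm = fps_X ^ (2 * s - 3) * R"
  have T30: "(T ^ 3) $ 0 = 0" using T by (simp add: fps_power_zeroth)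
  have "conv V2" unfolding V2_def using conv_UV by (simp add: conv_shift)
  then have cR: "conv R" unfolding R_def using A G d T by (auto intro!: conv_intros)
  have R0: "R $ 0 = 0"
    using d G A s by (simp add: R_def fps_power_zeroth b_def[symmetric] c_def field_simps)
  have y_T: "fps_compose y T = fps_compose \<sigma> (T ^ 3) + fps_compose A (T ^ 3) * ?Xs + Rm"
  proof -
    have XT: "fps_compose ?X3 T = T ^ 3" using T by (simp add: fps_compose_power[symmetric] fps_X_fps_compose_startby0)
    have ramT: "fps_compose (ram 3 a) T = fps_compose a (T ^ 3)" for a
      unfolding ram_def using T by (subst fps_compose_assoc[symmetric]) (simp_all add: XT)
    have XkT: "fps_compose (fps_X ^ k) T = T ^ k" for k
      using T by (simp add: fps_compose_power[symmetric] fps_X_fps_compose_startby0)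
    have VT: "fps_compose V T = fps_X ^ (2 * s - 3) * (d ^ (2 * s - 3) * fps_compose V2 T)"
      unfolding V2 comp(2) XkT by (simp add: T_def power_mult_distrib mult.assoc)
    have UT: "fps_compose U T = (?Xs + fps_X ^ (2 * s - 3) * G) * fps_compose A (T ^ 3)"
      unfolding U_def comp(2) XkT ramT Ts[folded T_def] ..
    show ?thesis unfolding y_def comp(1) ramT UT VT Rm_def R_def by (simp add: algebra_simps)
  qed
  \<comment> \<open>In the class of 2s the only exponent below 2s that could have occurred is 2s -
    3, and it has just been cancelled. Hence all of \<open>Rm\<close> is expressible through t^3 and
    t^s.\<close>
  have Rm_nth: "Rm $ i = 0" if "i < 2 * s - 2" for i
    using that R0 by (cases "i < 2 * s - 3") (auto simp: Rm_def fps_X_power_mult_nth)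
  define \<phi> where "\<phi> = fps_section 3 0 Rm"
  define \<alpha> where "\<alpha> = fps_section 3 s Rm"
  define \<beta> where "\<beta> = fps_section 3 (2 * s) Rm"
  have Rm_eq: "Rm = ram 3 \<phi> + ?Xs * ram 3 \<alpha> + fps_X ^ (2 * s) * ram 3 \<beta>"
    unfolding \<phi>_def \<alpha>_def \<beta>_def
  proof (rule section_split_3[OF s(2)])
    fix i
    show "Rm $ i = 0" if "i mod 3 = s mod 3" "i < s" using that s by (intro Rm_nth) simp
    show "Rm $ i = 0" if "i mod 3 = 2 * s mod 3" "i < 2 * s"
    proof (rule Rm_nth)
      have "3 dvd 2 * s - i" using that by (subst mod_eq_dvd_iff_nat[symmetric]) simp_all
      then have "3 \<le> 2 * s - i" by (rule dvd_imp_le) (use that in simp)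
      then show "i < 2 * s - 2" by linarith
    qed
  qed
  have "conv Rm" unfolding Rm_def using cR by (intro conv_intros)
  then have c\<phi>: "conv \<phi>" "conv \<alpha>" "conv \<beta>" unfolding \<phi>_def \<alpha>_def \<beta>_def by (simp_all only: conv_section)
  have \<phi>0: "\<phi> $ 0 = 0" "\<phi> $ 1 = 0" "\<alpha> $ 0 = 0"
    unfolding \<phi>_def \<alpha>_def fps_section_def using s by (auto intro!: Rm_nth)
  let ?C = "\<lambda>a. fps_const a :: bifps"
  \<comment> \<open>On the arc (t^3, t^s) the linear form \<open>lin\<close> becomes T^3, so
    \<open>Bc\<close> becomes \<open>y\<close> composed with \<open>T\<close>. The pair
    (\<open>lin\<close>, \<open>Bc\<close>) has Jacobian determinant A(0) at the origin.\<close>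
  define Bc where "Bc = bisubst (?C \<sigma>) lin fps_X + bisubst (?C A) lin fps_X * fps_X
    + ?C \<phi> + ?C \<alpha> * fps_X + ?C \<beta> * fps_X ^ 2"
  have bBc: "biconvergent Bc"
    unfolding Bc_def using lin sigma A c\<phi> by (intro biconv_intros biconvergent_bisubst) simp_all
  have arc_Bc: "arc Bc u v = fps_compose \<sigma> (u + fps_const c * v) + fps_compose A (u + fps_const c * v) * v
      + fps_compose \<phi> u + fps_compose \<alpha> u * v + fps_compose \<beta> u * v ^ 2" if uv: "u $ 0 = 0" "v $ 0 = 0" for u v
  proof -
    have "arc (bisubst (?C a) lin fps_X) u v = fps_compose a (u + fps_const c * v)" for a
    proof -
      have "arc (bisubst (?C a) lin fps_X) u v = arc (?C a) (arc lin u v) (arc fps_X u v)"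
        by (rule arc_bisubst[OF uv lin(2) Y_adic_1])
      also have "\<dots> = fps_compose a (u + fps_const c * v)"
        using uv by (simp add: arc_lin[OF uv] arc_Y arc_const)
      finally show ?thesis .
    qed
    then show ?thesis using uv by (simp add: Bc_def arc_add arc_mult arc_power arc_Y arc_const)
  qed
  have Bc_adic: "Bc \<in> adic (Suc 0)"
  proof -
    have "bicoeff Bc 0 0 = arc Bc 0 0 $ 0" by (simp add: arc_nth_0)
    also have "\<dots> = 0" using sigma \<phi>0 by (simp add: arc_Bc fps_compose_0_right)
    finally show ?thesis by (simp add: adic_1_iff)
  qed
  define H where "H = bisubst (fps_of_cps f) lin Bc"
  have bH: "biconvergent H" unfolding H_def by (intro biconvergent_bisubst lin bBc Bc_adic biconvergent_fps_of_cps)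
  have arc_H: "arc H u v = arc (fps_of_cps f) (u + fps_const c * v) (arc Bc u v)" if "u $ 0 = 0" "v $ 0 = 0" for u v
    unfolding H_def using that by (simp add: arc_bisubst lin Bc_adic arc_lin)
  have "arc H ?X3 ?Xs = 0"
  proof -
    have "arc Bc ?X3 ?Xs = fps_compose y T"
      unfolding y_T arc_Bc[OF X3 Xs] T3[folded T_def, symmetric] Rm_eq
      by (simp add: ram_def add.assoc mult.commute flip: power_mult)
    moreover have "fps_compose ?X3 T = T ^ 3" using T by (simp add: fps_compose_power[symmetric] fps_X_fps_compose_startby0)
    ultimately have "arc H ?X3 ?Xs = fps_compose (arc (fps_of_cps f) ?X3 y) T"
      using X3 y_nth_0 T by (simp add: arc_H[OF X3 Xs] T3[folded T_def, symmetric] arc_compose)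
    then show ?thesis by (simp add: root_y)
  qed
  define g where "g = cps_Y ^ 3 - cps_X ^ s"
  interpret g: cubic_branch g 1 0 0 "- 1" 1 0 s s
    unfolding g_def by (rule quasihomogeneous_cubic_branch[OF s])
  have "g.y = ?Xs" by (simp add: g.y_def g.U_def g.V_def ram_0 ram_1)
  \<comment> \<open>The transformed equation vanishes on the arc of y^3 - x^s, whose ideal is known
    from its parametrization.\<close>
  then have "g dvd Abs_cps H"
    using parametrization.kernel[OF g.parametrization, of "Abs_cps H"] \<open>arc H ?X3 ?Xs = 0\<close>
    by (simp add: fps_of_cps_Abs bH)
  then obtain e where e: "biconvergent e" "H = e * fps_of_cps g"
    using bH by (auto simp: cps_dvd_iff fps_of_cps_Abs)
  define cX where "cX = fps_const c * (fps_X :: complex fps)"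
  have cX: "cX $ 0 = 0" by (simp add: cX_def)
  define \<kappa> where "\<kappa> = fps_compose A cX + fps_const (\<alpha> $ 0) + fps_const (\<beta> $ 0) * fps_X"
  have \<kappa>0: "\<kappa> $ 0 = A $ 0" using cX \<phi>0 by (simp add: \<kappa>_def)
  have arcB0: "arc Bc 0 fps_X = fps_compose \<sigma> cX + fps_X * \<kappa>"
    using \<phi>0 by (simp add: arc_Bc fps_compose_0_right cX_def \<kappa>_def power2_eq_square algebra_simps)
  \<comment> \<open>To see that the cofactor is a unit, both equations are restricted to x = 0. Each
    has order exactly 3 in y: for the transformed one the terms other than the cube have order at
    least 4, since m >= 3 and s >= 4.\<close>
  have "bicoeff e 0 0 \<noteq> 0"
  proof -
    have "arc H 0 fps_X = arc (fps_of_cps f) cX (fps_compose \<sigma> cX + fps_X * \<kappa>)"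
      by (simp add: arc_H arcB0 cX_def)
    also have "\<dots> = arc W cX (fps_compose \<sigma> cX + fps_X * \<kappa>) *
        ((fps_X * \<kappa>) ^ 3 + fps_compose (fps_X ^ m * p1) cX * (fps_X * \<kappa>) + fps_compose (fps_X ^ s * q1) cX)"
      using arc_f[OF cX, of "fps_compose \<sigma> cX + fps_X * \<kappa>"] sigma cX by simp
    also have "fps_compose (fps_X ^ m * p1) cX = fps_X ^ m * (fps_const (c ^ m) * fps_compose p1 cX)"
      using cX by (simp add: fps_compose_mult_distrib fps_compose_power[symmetric] fps_X_fps_compose_startby0
          cX_def power_mult_distrib fps_const_power mult_ac)
    also have "fps_compose (fps_X ^ s * q1) cX = fps_X ^ s * (fps_const (c ^ s) * fps_compose q1 cX)"
      using cX by (simp add: fps_compose_mult_distrib fps_compose_power[symmetric] fps_X_fps_compose_startby0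
          cX_def power_mult_distrib fps_const_power mult_ac)
    finally have arcH: "arc H 0 fps_X = arc W cX (fps_compose \<sigma> cX + fps_X * \<kappa>) *
        ((fps_X * \<kappa>) ^ 3 + fps_X ^ m * (fps_const (c ^ m) * fps_compose p1 cX) * (fps_X * \<kappa>) +
          fps_X ^ s * (fps_const (c ^ s) * fps_compose q1 cX))" .
    define K where "K = \<kappa> ^ 3 + fps_X * (fps_X ^ (m - 3) * (fps_const (c ^ m) * fps_compose p1 cX) * \<kappa>
        + fps_X ^ (s - 4) * (fps_const (c ^ s) * fps_compose q1 cX))"
    have Xm: "fps_X ^ m = fps_X ^ 3 * (fps_X ^ (m - 3) :: complex fps)"
      using orders_bounds by (simp flip: power_add)
    have Xs4: "fps_X ^ s = fps_X ^ 3 * (fps_X * fps_X ^ (s - 4) :: complex fps)"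
      using s by (simp flip: power_add power_Suc)
    have "arc H 0 fps_X = arc W cX (fps_compose \<sigma> cX + fps_X * \<kappa>) * (fps_X ^ 3 * K)"
      unfolding arcH K_def Xm Xs4 by (simp add: power_mult_distrib algebra_simps)
    moreover have "arc H 0 fps_X = arc e 0 fps_X * fps_X ^ 3"
    proof -
      have "arc (fps_of_cps g) 0 fps_X = fps_X ^ 3"
        using g.arc_f[of 0 fps_X] s by (simp add: arc_1 fps_compose_0_right)
      then show ?thesis unfolding e(2) by (simp add: arc_mult)
    qed
    ultimately have "fps_X ^ 3 * arc e 0 fps_X = fps_X ^ 3 * (arc W cX (fps_compose \<sigma> cX + fps_X * \<kappa>) * K)"
      by (simp add: mult_ac)
    then have "arc e 0 fps_X = arc W cX (fps_compose \<sigma> cX + fps_X * \<kappa>) * K" by simp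
    from arg_cong[OF this, of "\<lambda>a. a $ 0"] have "bicoeff e 0 0 = bicoeff W 0 0 * (A $ 0) ^ 3"
      using cX sigma by (simp add: arc_nth_0 K_def fps_power_zeroth \<kappa>0)
    then show ?thesis using W A by simp
  qed
  then obtain w where w: "biconvergent w" "e * w = 1" using bi_inverse[OF e(1)] by blast
  have w0: "bicoeff w 0 0 \<noteq> 0"
    using arg_cong[OF w(2), of "\<lambda>F. bicoeff F 0 0"] by (auto simp: bicoeff_00_mult bicoeff_simps)
  have "fps_of_cps g = w * H"
    using w(2) by (simp add: e(2) mult.assoc[symmetric] mult.commute[of w])
  moreover have "bicoeff lin 0 1 = c" "bicoeff lin 1 0 = 1"
    by (simp_all add: lin_def bicoeff_simps bicoeff_const_mult)
  moreover have "bicoeff Bc 0 1 = \<sigma> $ 1 * c + A $ 0"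
    unfolding arc_0_X_nth[symmetric] arcB0 cX_def fps_add_nth fps_compose_linear
    by (simp add: \<kappa>0 mult.commute)
  moreover have "bicoeff Bc 1 0 = \<sigma> $ 1"
    using \<phi>0 by (simp add: arc_X_0_nth[symmetric] arc_Bc)
  moreover have "bicoeff lin 0 0 = 0" "bicoeff Bc 0 0 = 0"
    using lin(2) Bc_adic by (simp_all add: adic_1_iff)
  ultimately show ?thesis
    unfolding analytically_equivalent_def g_def[symmetric]
    using lin(1) bBc w(1) w0 A
    by (intro exI[of _ "Abs_cps lin"] exI[of _ "Abs_cps Bc"] exI[of _ "Abs_cps w"])
      (simp add: cps_coeff_def fps_of_cps_Abs cps_unit_iff subst_coords_eq_bisubst H_def mult.commute)
qed

end

section \<open>The discriminant of a branch of multiplicity three\<close>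

lemma cubic_branch_of_semigroup:
  assumes "branch f" "x_transversal f" "has_semigroup f [3, s1]"
  obtains W \<sigma> p1 q1 A B m where "cubic_branch f W \<sigma> p1 q1 A B s1 m" "mult0 f = 3"
proof -
  have mult: "mult0 f = 3" using assms(3) by (simp add: has_semigroup_def)
  obtain W \<sigma> p1 q1 A B s m where c: "cubic_branch f W \<sigma> p1 q1 A B s m"
    by (rule cubic_branch_exists[OF assms(1,2) mult])
  then have "s1 = s" using assms(3) by (rule cubic_branch.semigroup_generator_eq)
  then show thesis using that c mult by blast
qed

lemma discriminant_double_cover:
  assumes "branch f" "x_transversal f" "has_semigroup f [3, s1]"
  obtains \<phi>1 \<epsilon> k where
    "fps_of_cps (discriminant f) = (fps_X - fps_const (fps_X ^ s1 * \<phi>1)) ^ 2 - fps_const (fps_X ^ k * \<epsilon>)"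
    "conv \<phi>1" "\<phi>1 $ 0 \<noteq> 0" "conv \<epsilon>" "k > 2 * s1" "s1 \<ge> 4"
    "zariski_invariant f \<noteq> 0 \<longrightarrow> k = s1 + zariski_invariant f \<and> \<epsilon> $ 0 \<noteq> 0"
proof -
  obtain W \<sigma> p1 q1 A B m where c: "cubic_branch f W \<sigma> p1 q1 A B s1 m" and mult: "mult0 f = 3"
    by (rule cubic_branch_of_semigroup[OF assms])
  interpret cubic_branch f W \<sigma> p1 q1 A B s1 m by (rule c)
  obtain D \<phi>1 \<epsilon> where D: "discriminant f = D" "conv \<phi>1" "\<phi>1 $ 0 \<noteq> 0" "conv \<epsilon>"
    "fps_of_cps D = (fps_X - fps_const (fps_X ^ s1 * \<phi>1)) ^ 2 - fps_const (fps_X ^ (3 * min m s1) * \<epsilon>)"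
    and \<epsilon>: "m < s1 \<longrightarrow> p1 \<noteq> 0 \<longrightarrow> \<epsilon> $ 0 \<noteq> 0"
    by (rule discriminant_cubic[OF mult])
  have "3 * min m s1 > 2 * s1" using ms s by (simp add: min_def)
  moreover have "3 * min m s1 = s1 + zariski_invariant f \<and> \<epsilon> $ 0 \<noteq> 0" if "zariski_invariant f \<noteq> 0"
  proof -
    have "p1 \<noteq> 0" "m + 1 < s1" "zariski_invariant f = 3 * m - s1"
      using that zariski_invariant_eq[OF mult] by (auto split: if_splits)
    then show ?thesis using \<epsilon> orders_bounds by simp
  qed
  ultimately show thesis using that[of \<phi>1 "3 * min m s1" \<epsilon>] D s by simp
qed

lemma quasihomogeneous_discriminant:
  assumes "s \<ge> 4"
  shows "discriminant (cps_Y ^ 3 - cps_X ^ s) = (cps_Y + cps_X ^ s) ^ 2"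
proof -
  let ?g = "cps_Y ^ 3 - cps_X ^ s"
  have rep: "fps_of_cps ?g = fps_X ^ 3 - fps_const (fps_X ^ s)" by (simp add: cps_rep)
  have coeff: "cps_coeff ?g i j = (if i = 0 \<and> j = 3 then 1 else 0) - (if i = s \<and> j = 0 then 1 else 0)" for i j
    unfolding cps_coeff_def bicoeff_def rep by (auto simp: fps_X_power_nth)
  have mult: "mult0 ?g = 3" by (rule mult0_eqI[of _ 0 3]) (use assms in \<open>auto simp: coeff\<close>)
  have three: "fps_deriv (fps_X ^ 3 :: bifps) = bi_const 3 * fps_X ^ 2"
    by (simp add: fps_deriv_power' fps_const_numeral)
  show ?thesis
  proof (rule discriminant_eqI[OF is_discriminant_from_division mult])
    show "mult0 ?g = 3" by (rule mult)
    show "biconvergent (bi_const 3)" by (intro biconv_intros conv_const)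
    show "bicoeff (bi_const 3) 0 0 \<noteq> 0" by (simp add: bicoeff_simps)
    show "fps_deriv (fps_of_cps ?g) = bi_const 3 * ((fps_X - fps_const 0) ^ 2 +
        2 * fps_const 0 * (fps_X - fps_const 0) + fps_const 0)"
      unfolding rep by (simp add: three)
    show "fps_of_cps ?g = fps_X * ((fps_X - fps_const 0) ^ 2 + 2 * fps_const 0 * (fps_X - fps_const 0) + fps_const 0) +
        fps_const (- (fps_X ^ s)) + fps_const 0 * (fps_X - fps_const 0)"
      unfolding rep by (simp add: power2_eq_square power3_eq_cube mult.assoc flip: fps_const_neg)
    show "fps_of_cps ((cps_Y + cps_X ^ s) ^ 2) = (fps_X - fps_const (- (fps_X ^ s) - 0 * 0)) ^ 2
        - fps_const (0 ^ 2 * (0 ^ 2 - 0))"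
      by (simp add: cps_rep flip: fps_const_neg)
  qed simp_all
qed

theorem proposition3p1:
  fixes f :: cps and s1 lam :: nat
  assumes "branch f"
    and "x_transversal f"
    and "has_semigroup f [3, s1]"
    and "zariski_invariant f = lam"
  shows "\<not> nondegenerate (discriminant f)
    \<and> (lam = 0 \<longrightarrow>
        analytically_equivalent f (cps_Y ^ 3 - cps_X ^ s1)
        \<and> discriminant (cps_Y ^ 3 - cps_X ^ s1) = (cps_Y + cps_X ^ s1) ^ 2
        \<and> smooth_branch (cps_Y + cps_X ^ s1))
    \<and> (lam \<noteq> 0 \<longrightarrow>
        (gcd 2 (s1 + lam) = 2 \<longrightarrow>
          (\<exists>D1 D2. discriminant f = D1 * D2 \<and> smooth_branch D1 \<and> smooth_branch D2
             \<and> intersection_number D1 D2 = enat ((s1 + lam) div 2)))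
        \<and> (gcd 2 (s1 + lam) = 1 \<longrightarrow>
          branch (discriminant f) \<and> has_semigroup (discriminant f) [2, s1 + lam])
        \<and> (\<forall>f'. branch f' \<and> x_transversal f' \<and> has_semigroup f' [3, s1]
               \<and> zariski_invariant f' = lam \<longrightarrow>
             same_topological_type (discriminant f) (discriminant f')))"
proof -
  obtain \<phi>1 \<epsilon> k where D: "fps_of_cps (discriminant f) =
      (fps_X - fps_const (fps_X ^ s1 * \<phi>1)) ^ 2 - fps_const (fps_X ^ k * \<epsilon>)"
    and \<phi>1: "conv \<phi>1" "\<phi>1 $ 0 \<noteq> 0" and \<epsilon>: "conv \<epsilon>" and k: "k > 2 * s1" and s1: "s1 \<ge> 4"
    and lam_nz: "zariski_invariant f \<noteq> 0 \<longrightarrow> k = s1 + zariski_invariant f \<and> \<epsilon> $ 0 \<noteq> 0"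
    by (rule discriminant_double_cover[OF assms(1-3)])
  have \<phi>: "conv (fps_X ^ s1 * \<phi>1)" "(fps_X ^ s1 * \<phi>1) $ 0 = 0"
    using \<phi>1 s1 by (auto intro!: conv_intros)
  have "\<not> nondegenerate (discriminant f)"
    by (rule double_cover_degenerate[OF D \<phi>1(2) _ k]) (use s1 in simp)
  moreover have "analytically_equivalent f (cps_Y ^ 3 - cps_X ^ s1)" if "lam = 0"
  proof -
    obtain W \<sigma> p1 q1 A B m where c: "cubic_branch f W \<sigma> p1 q1 A B s1 m" and mult: "mult0 f = 3"
      by (rule cubic_branch_of_semigroup[OF assms(1-3)])
    interpret cubic_branch f W \<sigma> p1 q1 A B s1 m by (rule c)
    have "p1 = 0 \<or> m + 1 \<ge> s1"
      using that assms(4) zariski_invariant_eq[OF mult] orders_bounds by (auto split: if_splits)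
    then show ?thesis by (rule analytically_equivalent_quasihomogeneous)
  qed
  moreover have "discriminant (cps_Y ^ 3 - cps_X ^ s1) = (cps_Y + cps_X ^ s1) ^ 2"
    using s1 by (rule quasihomogeneous_discriminant)
  moreover have "smooth_branch (cps_Y + cps_X ^ s1)"
    by (rule smooth_branch_graph[of _ "- (fps_X ^ s1)"])
      (use s1 in \<open>simp_all add: cps_rep flip: fps_const_neg\<close>)
  moreover have "(gcd 2 (s1 + lam) = 2 \<longrightarrow>
          (\<exists>D1 D2. discriminant f = D1 * D2 \<and> smooth_branch D1 \<and> smooth_branch D2
             \<and> intersection_number D1 D2 = enat ((s1 + lam) div 2)))
        \<and> (gcd 2 (s1 + lam) = 1 \<longrightarrow>
          branch (discriminant f) \<and> has_semigroup (discriminant f) [2, s1 + lam])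
        \<and> (\<forall>f'. branch f' \<and> x_transversal f' \<and> has_semigroup f' [3, s1]
               \<and> zariski_invariant f' = lam \<longrightarrow>
             same_topological_type (discriminant f) (discriminant f'))" if "lam \<noteq> 0"
  proof (intro conjI impI allI)
    have k_eq: "k = s1 + lam" and \<epsilon>0: "\<epsilon> $ 0 \<noteq> 0" using lam_nz that assms(4) by auto
    {
      assume "gcd 2 (s1 + lam) = 2"
      then have "even k" unfolding k_eq by (metis gcd_dvd2)
      then have l: "2 * (k div 2) = k" "k div 2 > 0" using k by auto
      show "\<exists>D1 D2. discriminant f = D1 * D2 \<and> smooth_branch D1 \<and> smooth_branch D2
             \<and> intersection_number D1 D2 = enat ((s1 + lam) div 2)"
        unfolding k_eq[symmetric]
        by (rule double_cover_split[OF _ \<phi> \<epsilon> \<epsilon>0 l(2)]) (simp only: l(1) D)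
    next
      assume g: "gcd 2 (s1 + lam) = 1"
      have "odd k"
      proof
        assume "even k"
        then have "2 dvd gcd 2 (s1 + lam)" unfolding k_eq by (rule gcd_greatest[OF dvd_refl])
        then show False unfolding g by simp
      qed
      then show "branch (discriminant f)" "has_semigroup (discriminant f) [2, s1 + lam]"
        using double_cover_branch[OF D \<phi> \<epsilon> \<epsilon>0] k s1 by (simp_all add: k_eq)
    next
      fix f'
      assume f': "branch f' \<and> x_transversal f' \<and> has_semigroup f' [3, s1] \<and> zariski_invariant f' = lam"
      then obtain \<phi>2 \<epsilon>' k' where D': "fps_of_cps (discriminant f') =
          (fps_X - fps_const (fps_X ^ s1 * \<phi>2)) ^ 2 - fps_const (fps_X ^ k' * \<epsilon>')"
        and \<phi>2: "conv \<phi>2" and \<epsilon>': "conv \<epsilon>'"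
        and lam': "zariski_invariant f' \<noteq> 0 \<longrightarrow> k' = s1 + zariski_invariant f' \<and> \<epsilon>' $ 0 \<noteq> 0"
        by (elim conjE) (rule discriminant_double_cover[of f' s1])
      have k': "k' = k" and \<epsilon>'0: "\<epsilon>' $ 0 \<noteq> 0" using lam' that f' k_eq by auto
      \<comment> \<open>Both discriminants have the same exponent k, so the ratio of their radicands
        is a unit; its square root \<open>r\<close> is the fibrewise scaling of the
        homeomorphism.\<close>
      have "conv (\<epsilon>' * inverse \<epsilon>)" "(\<epsilon>' * inverse \<epsilon>) $ 0 \<noteq> 0"
        using \<epsilon> \<epsilon>0 \<epsilon>' \<epsilon>'0 by (auto intro!: conv_intros)
      then obtain r where r: "conv r" "r ^ 2 = \<epsilon>' * inverse \<epsilon>" "r $ 0 \<noteq> 0"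
        using conv_root[of "\<epsilon>' * inverse \<epsilon>" 2] by auto
      have "fps_X ^ k' * \<epsilon>' = r ^ 2 * (fps_X ^ k * \<epsilon>)"
      proof -
        have "r ^ 2 * (fps_X ^ k * \<epsilon>) = fps_X ^ k * \<epsilon>' * (inverse \<epsilon> * \<epsilon>)"
          unfolding r(2) by (simp only: mult_ac)
        then show ?thesis using \<epsilon>0 by (simp add: k' inverse_mult_eq_1)
      qed
      then show "same_topological_type (discriminant f) (discriminant f')"
        by (intro double_cover_same_topological_type[OF D D' _ _ _ _ r(1) _ _ r(3)] conv_intros \<phi>1(1) \<phi>2 \<epsilon> \<epsilon>')
          (use s1 in simp_all)
    }
  qed
  ultimately show ?thesis by blast
qed

end
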